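(* Let $\mathcal U$ be an abelian $\bigvee$-definable group in a sufficiently saturated NIP structure $\mathcal M$. Assume that the non-generic definable subsets of $\mathcal U$ form an ideal and that $\mathcal U$ contains some definable generic set. Then for any definable generic set $X\subseteq\mathcal U$, the set $Stab_{ng}(X)$ is a type-definable subgroup of $\mathcal U$ of bounded index in $\mathcal U$. In particular, $\mathcal U^{00}$ exists.
   Context: $\mathcal M$ is $\kappa$-saturated for large $\kappa$; "small"/"bounded" means cardinality $<\kappa$. A $\bigvee$-definable group is a group whose universe is a directed union $\bigcup_{i\in I}X_i$ of definable subsets of $M^n$ (fixed $n$), $I$ small, with the group operation restricted to each $X_i\times X_j$ definable. A definable $X\subseteq\mathcal U$ is generic if $\mathcal U$ is covered by a small number of left translates and by a small number of right translates of $X$. The non-generic definable sets form an ideal means the union of two non-generic definable subsets is non-generic. For definable $X\subseteq \mathcal U$, $Stab_{ng}(X)=\{g\in\mathcal U: gX\,\Delta\, X \text{ is non-generic in }\mathcal U\}$. A type-definable subgroup is one defined by a small conjunction of formulas (in particular contained in a definable subset of $\mathcal U$). "$\mathcal U^{00}$ exists" means there is a smallest type-definable subgroup of $\mathcal U$ of bounded index. *)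

theory Defs
  imports "HOL-Algebra.Coset"
begin

unbundle cardinal_syntax

section \<open>First-order structures\<close>

datatype 'f fo_term = Var nat | Fn 'f "'f fo_term list"

datatype ('f, 'r) fo_form =
    Equal "'f fo_term" "'f fo_term"
  | Rel 'r "'f fo_term list"
  | Neg "('f, 'r) fo_form"
  | Conj "('f, 'r) fo_form" "('f, 'r) fo_form"
  | Exists nat "('f, 'r) fo_form"

record ('f, 'r) language =
  fsyms :: "'f set"
  farity :: "'f \<Rightarrow> nat"
  rsyms :: "'r set"
  rarity :: "'r \<Rightarrow> nat"

text \<open>The universe of a structure is the whole type \<^typ>\<open>'m\<close>; tuples are lists, and
  interpretations matter only on lists whose length is the arity of the symbol.\<close>

record ('f, 'r, 'm) fo_structure = "('f, 'r) language" +
  fint :: "'f \<Rightarrow> 'm list \<Rightarrow> 'm"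
  rint :: "'r \<Rightarrow> 'm list \<Rightarrow> bool"

fun wf_term :: "('f, 'r, 'z) language_scheme \<Rightarrow> 'f fo_term \<Rightarrow> bool" where
  "wf_term L (Var i) \<longleftrightarrow> True"
| "wf_term L (Fn f ts) \<longleftrightarrow> f \<in> fsyms L \<and> length ts = farity L f \<and> (\<forall>t\<in>set ts. wf_term L t)"

fun wf_form :: "('f, 'r, 'z) language_scheme \<Rightarrow> ('f, 'r) fo_form \<Rightarrow> bool" where
  "wf_form L (Equal s t) \<longleftrightarrow> wf_term L s \<and> wf_term L t"
| "wf_form L (Rel r ts) \<longleftrightarrow> r \<in> rsyms L \<and> length ts = rarity L r \<and> (\<forall>t\<in>set ts. wf_term L t)"
| "wf_form L (Neg p) \<longleftrightarrow> wf_form L p"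
| "wf_form L (Conj p q) \<longleftrightarrow> wf_form L p \<and> wf_form L q"
| "wf_form L (Exists i p) \<longleftrightarrow> wf_form L p"

fun fv_term :: "'f fo_term \<Rightarrow> nat set" where
  "fv_term (Var i) = {i}"
| "fv_term (Fn f ts) = (\<Union>t\<in>set ts. fv_term t)"

fun fv :: "('f, 'r) fo_form \<Rightarrow> nat set" where
  "fv (Equal s t) = fv_term s \<union> fv_term t"
| "fv (Rel r ts) = (\<Union>t\<in>set ts. fv_term t)"
| "fv (Neg p) = fv p"
| "fv (Conj p q) = fv p \<union> fv q"
| "fv (Exists i p) = fv p - {i}"

fun eval_term :: "('f, 'r, 'm, 'z) fo_structure_scheme \<Rightarrow> (nat \<Rightarrow> 'm) \<Rightarrow> 'f fo_term \<Rightarrow> 'm" where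
  "eval_term M v (Var i) = v i"
| "eval_term M v (Fn f ts) = fint M f (map (eval_term M v) ts)"

fun sat :: "('f, 'r, 'm, 'z) fo_structure_scheme \<Rightarrow> (nat \<Rightarrow> 'm) \<Rightarrow> ('f, 'r) fo_form \<Rightarrow> bool" where
  "sat M v (Equal s t) \<longleftrightarrow> eval_term M v s = eval_term M v t"
| "sat M v (Rel r ts) \<longleftrightarrow> rint M r (map (eval_term M v) ts)"
| "sat M v (Neg p) \<longleftrightarrow> \<not> sat M v p"
| "sat M v (Conj p q) \<longleftrightarrow> sat M v p \<and> sat M v q"
| "sat M v (Exists i p) \<longleftrightarrow> (\<exists>a. sat M (v(i := a)) p)"

definition tuples :: "nat \<Rightarrow> 'm list set" where
  "tuples n = {x. length x = n}"

text \<open>Variables \<open>0, \<dots>, n - 1\<close> stand for the point of \<open>M\<^sup>n\<close>, the following ones for the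
  parameters; the condition on \<open>fv\<close> keeps \<^const>\<open>nth\<close> within range.\<close>

definition definable_over ::
  "('f, 'r, 'm, 'z) fo_structure_scheme \<Rightarrow> 'm set \<Rightarrow> nat \<Rightarrow> 'm list set \<Rightarrow> bool" where
  "definable_over M A n D \<longleftrightarrow>
    (\<exists>p b. wf_form M p \<and> set b \<subseteq> A \<and> fv p \<subseteq> {..<n + length b} \<and>
       D = {x \<in> tuples n. sat M (nth (x @ b)) p})"

abbreviation definable ::
  "('f, 'r, 'm, 'z) fo_structure_scheme \<Rightarrow> nat \<Rightarrow> 'm list set \<Rightarrow> bool" where
  "definable M \<equiv> definable_over M UNIV"

text \<open>Cardinals are represented by cardinal orders; \<open>small\<close> and \<open>bounded\<close> are relative to
  the degree of saturation \<open>\<kappa>\<close>.\<close>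

definition small :: "'k rel \<Rightarrow> 'a set \<Rightarrow> bool" where
  "small \<kappa> A \<longleftrightarrow> |A| <o \<kappa>"

text \<open>A partial \<open>n\<close>-type over \<open>A\<close> is given by the family of \<open>A\<close>-definable sets that its
  formulas define.\<close>

definition saturated :: "'k rel \<Rightarrow> ('f, 'r, 'm, 'z) fo_structure_scheme \<Rightarrow> bool" where
  "saturated \<kappa> M \<longleftrightarrow>
    (\<forall>A n F. small \<kappa> A \<and> (\<forall>D\<in>F. definable_over M A n D) \<and>
       (\<forall>F0. F0 \<subseteq> F \<and> finite F0 \<longrightarrow> tuples n \<inter> \<Inter>F0 \<noteq> {}) \<longrightarrow>
       tuples n \<inter> \<Inter>F \<noteq> {})"

text \<open>The independence property of \<open>p(x; y)\<close> with \<open>|x| = n\<close>, \<open>|y| = m\<close>.\<close>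

definition has_IP ::
  "('f, 'r, 'm, 'z) fo_structure_scheme \<Rightarrow> nat \<Rightarrow> nat \<Rightarrow> ('f, 'r) fo_form \<Rightarrow> bool" where
  "has_IP M n m p \<longleftrightarrow>
    (\<forall>k. \<exists>(a :: nat \<Rightarrow> 'm list) (b :: nat set \<Rightarrow> 'm list).
       (\<forall>i<k. a i \<in> tuples n) \<and> (\<forall>S. S \<subseteq> {..<k} \<longrightarrow> b S \<in> tuples m) \<and>
       (\<forall>i<k. \<forall>S. S \<subseteq> {..<k} \<longrightarrow> (sat M (nth (a i @ b S)) p \<longleftrightarrow> i \<in> S)))"

definition NIP :: "('f, 'r, 'm, 'z) fo_structure_scheme \<Rightarrow> bool" where
  "NIP M \<longleftrightarrow> (\<forall>n m p. wf_form M p \<and> fv p \<subseteq> {..<n + m} \<longrightarrow> \<not> has_IP M n m p)"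

section \<open>\<open>\<Or>\<close>-definable groups\<close>

text \<open>The directed union is indexed by the family \<open>\<X>\<close> of definable sets itself.\<close>

definition vee_definable_group ::
  "'k rel \<Rightarrow> ('f, 'r, 'm, 'z) fo_structure_scheme \<Rightarrow> nat \<Rightarrow> ('m list, 'b) monoid_scheme \<Rightarrow> bool"
  where
  "vee_definable_group \<kappa> M n G \<longleftrightarrow> group G \<and>
    (\<exists>\<X>. small \<kappa> \<X> \<and> (\<forall>X\<in>\<X>. definable M n X) \<and>
       (\<forall>X\<in>\<X>. \<forall>Y\<in>\<X>. \<exists>Z\<in>\<X>. X \<union> Y \<subseteq> Z) \<and> carrier G = \<Union>\<X> \<and>
       (\<forall>X\<in>\<X>. \<forall>Y\<in>\<X>. definable M (3 * n) {x @ y @ (x \<otimes>\<^bsub>G\<^esub> y) | x y. x \<in> X \<and> y \<in> Y}))"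

definition definable_in ::
  "('f, 'r, 'm, 'z) fo_structure_scheme \<Rightarrow> nat \<Rightarrow> ('m list, 'b) monoid_scheme \<Rightarrow> 'm list set \<Rightarrow> bool"
  where
  "definable_in M n G X \<longleftrightarrow> definable M n X \<and> X \<subseteq> carrier G"

definition generic ::
  "'k rel \<Rightarrow> ('f, 'r, 'm, 'z) fo_structure_scheme \<Rightarrow> nat \<Rightarrow> ('m list, 'b) monoid_scheme \<Rightarrow>
    'm list set \<Rightarrow> bool" where
  "generic \<kappa> M n G X \<longleftrightarrow> definable_in M n G X \<and>
    (\<exists>S \<subseteq> carrier G. small \<kappa> S \<and> carrier G \<subseteq> (\<Union>g\<in>S. g <#\<^bsub>G\<^esub> X)) \<and>
    (\<exists>S \<subseteq> carrier G. small \<kappa> S \<and> carrier G \<subseteq> (\<Union>g\<in>S. X #>\<^bsub>G\<^esub> g))"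

definition nongeneric ::
  "'k rel \<Rightarrow> ('f, 'r, 'm, 'z) fo_structure_scheme \<Rightarrow> nat \<Rightarrow> ('m list, 'b) monoid_scheme \<Rightarrow>
    'm list set \<Rightarrow> bool" where
  "nongeneric \<kappa> M n G X \<longleftrightarrow> definable_in M n G X \<and> \<not> generic \<kappa> M n G X"

definition nongeneric_ideal ::
  "'k rel \<Rightarrow> ('f, 'r, 'm, 'z) fo_structure_scheme \<Rightarrow> nat \<Rightarrow> ('m list, 'b) monoid_scheme \<Rightarrow> bool"
  where
  "nongeneric_ideal \<kappa> M n G \<longleftrightarrow>
    (\<forall>X Y. nongeneric \<kappa> M n G X \<and> nongeneric \<kappa> M n G Y \<longrightarrow> nongeneric \<kappa> M n G (X \<union> Y))"

definition Stab_ng ::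
  "'k rel \<Rightarrow> ('f, 'r, 'm, 'z) fo_structure_scheme \<Rightarrow> nat \<Rightarrow> ('m list, 'b) monoid_scheme \<Rightarrow>
    'm list set \<Rightarrow> 'm list set" where
  "Stab_ng \<kappa> M n G X = {g \<in> carrier G. nongeneric \<kappa> M n G (sym_diff (g <#\<^bsub>G\<^esub> X) X)}"

definition type_definable ::
  "'k rel \<Rightarrow> ('f, 'r, 'm, 'z) fo_structure_scheme \<Rightarrow> nat \<Rightarrow> 'm list set \<Rightarrow> bool" where
  "type_definable \<kappa> M n H \<longleftrightarrow>
    (\<exists>F. small \<kappa> F \<and> (\<forall>D\<in>F. definable M n D) \<and> H = tuples n \<inter> \<Inter>F)"

definition type_definable_subgroup ::
  "'k rel \<Rightarrow> ('f, 'r, 'm, 'z) fo_structure_scheme \<Rightarrow> nat \<Rightarrow> ('m list, 'b) monoid_scheme \<Rightarrow>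
    'm list set \<Rightarrow> bool" where
  "type_definable_subgroup \<kappa> M n G H \<longleftrightarrow> subgroup H G \<and> type_definable \<kappa> M n H"

definition bounded_index ::
  "'k rel \<Rightarrow> ('a, 'b) monoid_scheme \<Rightarrow> 'a set \<Rightarrow> bool" where
  "bounded_index \<kappa> G H \<longleftrightarrow> small \<kappa> (rcosets\<^bsub>G\<^esub> H)"

definition exists_00 ::
  "'k rel \<Rightarrow> ('f, 'r, 'm, 'z) fo_structure_scheme \<Rightarrow> nat \<Rightarrow> ('m list, 'b) monoid_scheme \<Rightarrow> bool"
  where
  "exists_00 \<kappa> M n G \<longleftrightarrow>
    (\<exists>H. type_definable_subgroup \<kappa> M n G H \<and> bounded_index \<kappa> G H \<and>
       (\<forall>K. type_definable_subgroup \<kappa> M n G K \<and> bounded_index \<kappa> G K \<longrightarrow> H \<subseteq> K))"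

text \<open>\<open>\<kappa>\<close> is sufficiently large: it exceeds \<open>2\<^bsup>|L|\<^esup>\<close>, where \<open>|L|\<close> is the (infinite) number of
  formulas of the language. Some such bound is needed, since the index of a type-definable
  subgroup defined by countably many formulas can already be the continuum.\<close>

definition sufficiently_large :: "'k rel \<Rightarrow> ('f, 'r, 'z) language_scheme \<Rightarrow> bool" where
  "sufficiently_large \<kappa> L \<longleftrightarrow> Card_order \<kappa> \<and> small \<kappa> (Pow {p. wf_form L p})"

end

theory Submission
  imports Defs Complex_Main "HOL-Algebra.FiniteProduct" "HOL-Library.Ramsey"
begin

text \<open>
  If \<open>X\<close> is generic, then a definable \<open>W\<close> is generic iff finitely many translates of \<open>W\<close> cover
  \<open>X\<close>, so \<open>Stab\<^sub>n\<^sub>g(X)\<close> is the intersection of the definable sets \<open>N\<^sub>k\<close> of those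
  \<open>g \<in> X X\<^sup>-\<^sup>1\<close> for which no \<open>k\<close> translates of \<open>gX \<triangle> X\<close> cover \<open>X\<close>. Its index is bounded because
  finitely many translates of each \<open>N\<^sub>k\<close> cover \<open>X\<close>. Otherwise there are infinitely many \<open>g\<^sub>i \<in> X\<close>
  such that \<open>k\<close> translates of each \<open>g\<^sub>i X \<triangle> g\<^sub>j X\<close> cover \<open>X\<close>; by Ramsey's theorem and NIP one may
  assume that every point lies in at most \<open>d\<close> of the sets \<open>g\<^bsub>2i\<^esub> X \<triangle> g\<^bsub>2i+1\<^esub> X\<close>, and this
  contradicts the polynomial growth of finitely generated abelian groups.

  For \<open>U\<^sup>0\<^sup>0\<close>, every type-definable subgroup of bounded index is an intersection of cores of chains
  of symmetric generic definable sets \<open>E\<^sub>j\<close> with \<open>E\<^bsub>j+1\<^esub> E\<^bsub>j+1\<^esub> \<subseteq> E\<^sub>j\<close>. Chains are sorted into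
  \<open>|L|\<close> many kinds, according to the formula defining \<open>E\<^sub>1\<close> and a covering number. Again by Ramsey's
  theorem and NIP, a Baldwin-Saxl argument shows that finitely many chains of each kind suffice, so
  that the intersection of all cores is given by \<open>|L|\<close> many generic sets and has index less than
  \<open>\<kappa>\<close>.
\<close>

section \<open>Closure properties of definable sets\<close>

text \<open>The conflict with polynomial growth is a measure argument in disguise. For a
  translation-invariant finitely additive measure giving \<open>X\<close> positive finite mass, each
  of \<open>K\<close> sets \<open>W\<close> of which \<open>k\<close> translates cover
  \<open>X\<close> would have at least \<open>1 / k\<close> of that mass. If these sets overlap at
  most \<open>d\<close>-fold inside \<open>X X\<close>, and \<open>t\<close> translates of
  \<open>X\<close> cover \<open>X X\<close>, then \<open>K \<le> k d t\<close>, while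
  \<open>t\<close> does not depend on \<open>K\<close>. Counting orbit points in balls replaces the
  measure; commutativity keeps the balls so small that their sizes cannot grow by a constant factor
  in every step.

  The obstacle to \<open>U^00\<close> is that subgroups of bounded index may use arbitrary
  parameters, so that their intersection is not visibly given by a small family. Hence chains are
  sorted by data without parameters, of which there are only \<open>|L|\<close> many. Each element
  is then coded by a small amount of data together with a subset of a set of size
  \<open>|L|\<close>, and this is where \<open>2^|L| < \<kappa>\<close> bounds the index. Both uses
  of NIP compare only a fixed finite number of indices, so Ramsey's theorem can take the place of
  indiscernible sequences.\<close>

fun rename_term :: "(nat \<Rightarrow> nat) \<Rightarrow> 'f fo_term \<Rightarrow> 'f fo_term" where
  "rename_term r (Var i) = Var (r i)"
| "rename_term r (Fn f ts) = Fn f (map (rename_term r) ts)"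

text \<open>The new bound variable exceeds the images of all free variables of the body, which rules
  out capture; the inserted 0 keeps \<open>Max\<close> away from the empty set.\<close>

fun rename :: "(nat \<Rightarrow> nat) \<Rightarrow> ('f, 'r) fo_form \<Rightarrow> ('f, 'r) fo_form" where
  "rename r (Equal s t) = Equal (rename_term r s) (rename_term r t)"
| "rename r (Rel R ts) = Rel R (map (rename_term r) ts)"
| "rename r (Neg p) = Neg (rename r p)"
| "rename r (Conj p q) = Conj (rename r p) (rename r q)"
| "rename r (Exists i p) =
    (let j = Suc (Max (insert 0 (r ` fv p))) in Exists j (rename (r(i := j)) p))"

lemma finite_fv_term: "finite (fv_term t)"
  by (induction t) auto

lemma finite_fv: "finite (fv p)"
  by (induction p) (auto simp: finite_fv_term)

lemma eval_term_cong: "(\<And>i. i \<in> fv_term t \<Longrightarrow> v i = v' i) \<Longrightarrow> eval_term M v t = eval_term M v' t"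
proof (induction t)
  case (Fn f ts)
  have "map (eval_term M v) ts = map (eval_term M v') ts"
    using Fn by (auto intro!: map_cong)
  then show ?case by (metis eval_term.simps(2))
qed simp

lemma sat_cong: "(\<And>i. i \<in> fv p \<Longrightarrow> v i = v' i) \<Longrightarrow> sat M v p = sat M v' p"
proof (induction p arbitrary: v v')
  case (Equal s t)
  then show ?case by (simp add: eval_term_cong[of s v v'] eval_term_cong[of t v v'])
next
  case (Rel R ts)
  then have "map (eval_term M v) ts = map (eval_term M v') ts"
    by (auto intro!: eval_term_cong)
  then show ?case by (metis sat.simps(2))
next
  case (Conj p q)
  then show ?case by (metis UnCI fv.simps(4) sat.simps(4))
next
  case (Exists i p)
  have "sat M (v(i := a)) p = sat M (v'(i := a)) p" for a
    by (rule Exists.IH) (use Exists.prems in auto)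
  then show ?case by simp
next
  case (Neg p)
  then show ?case by (metis fv.simps(3) sat.simps(3))
qed

lemma wf_rename_term: "wf_term L (rename_term r t) = wf_term L t"
  by (induction t) auto

lemma wf_rename: "wf_form L (rename r p) = wf_form L p"
  by (induction p arbitrary: r) (auto simp: wf_rename_term Let_def)

lemma eval_rename_term: "eval_term M v (rename_term r t) = eval_term M (v \<circ> r) t"
  by (induction t) (auto intro!: arg_cong[where f = "fint M _"])

lemma sat_rename: "sat M v (rename r p) = sat M (v \<circ> r) p"
proof (induction p arbitrary: v r)
  case (Rel R ts)
  then show ?case by (simp add: eval_rename_term comp_def)
next
  case (Exists i p)
  define j where "j = Suc (Max (insert 0 (r ` fv p)))"
  have fresh: "r k \<noteq> j" if "k \<in> fv p" for k
  proof -
    have "r k \<le> Max (insert 0 (r ` fv p))"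
      using that by (intro Max_ge) (auto simp: finite_fv)
    then show ?thesis by (simp add: j_def)
  qed
  have "sat M (v(j := a) \<circ> r(i := j)) p = sat M ((v \<circ> r)(i := a)) p" for a
    by (rule sat_cong) (use fresh in auto)
  then have "sat M v (Exists j (rename (r(i := j)) p)) = sat M (v \<circ> r) (Exists i p)"
    unfolding sat.simps Exists.IH by simp
  then show ?case by (simp only: rename.simps Let_def flip: j_def)
qed (auto simp: eval_rename_term)

lemma fv_rename_term: "fv_term (rename_term r t) = r ` fv_term t"
  by (induction t) auto

lemma fv_rename: "fv (rename r p) \<subseteq> r ` fv p"
proof (induction p arbitrary: r)
  case (Exists i p)
  define j where "j = Suc (Max (insert 0 (r ` fv p)))"
  have "fv (rename (r(i := j)) p) \<subseteq> r(i := j) ` fv p"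
    by (rule Exists.IH)
  then show ?case by (auto simp: Let_def simp flip: j_def)
next
  case (Conj p q)
  then show ?case by (simp add: image_Un) blast
qed (auto simp: fv_rename_term)

section \<open>Definable predicates on valuations\<close>

definition plug :: "(nat \<Rightarrow> nat + 'm) \<Rightarrow> (nat \<Rightarrow> 'm) \<Rightarrow> nat \<Rightarrow> 'm" where
  "plug s v i = (case s i of Inl j \<Rightarrow> v j | Inr a \<Rightarrow> a)"

text \<open>Substituting parameters directly for variables frees the closure lemmas from the
  numbering that \<open>definable_over\<close> imposes on points and parameters.\<close>

definition val_definable :: "('f, 'r, 'm, 'z) fo_structure_scheme \<Rightarrow> ((nat \<Rightarrow> 'm) \<Rightarrow> bool) \<Rightarrow> bool" where
  "val_definable M P \<longleftrightarrow> (\<exists>p s. wf_form M p \<and> (\<forall>v. P v = sat M (plug s v) p))"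

lemma val_definable_plug:
  assumes "val_definable M P"
  shows "val_definable M (\<lambda>v. P (plug t v))"
proof -
  obtain p s where p: "wf_form M p" "\<And>v. P v = sat M (plug s v) p"
    using assms unfolding val_definable_def by blast
  have "plug s (plug t v) = plug (\<lambda>i. case s i of Inl j \<Rightarrow> t j | Inr a \<Rightarrow> Inr a) v" for v
    by (auto simp: plug_def fun_eq_iff split: sum.splits)
  then show ?thesis unfolding val_definable_def using p by metis
qed

lemma val_definable_not: "val_definable M P \<Longrightarrow> val_definable M (\<lambda>v. \<not> P v)"
  unfolding val_definable_def by (metis sat.simps(3) wf_form.simps(3))

lemma val_definable_conj:
  assumes "val_definable M P" "val_definable M Q"
  shows "val_definable M (\<lambda>v. P v \<and> Q v)"
proof -
  obtain p s where p: "wf_form M p" "\<And>v. P v = sat M (plug s v) p"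
    using assms(1) unfolding val_definable_def by blast
  obtain q t where q: "wf_form M q" "\<And>v. Q v = sat M (plug t v) q"
    using assms(2) unfolding val_definable_def by blast
  \<comment> \<open>The two formulas come with unrelated substitutions; moving one to the even and
    the other to the odd variables lets a single substitution serve both.\<close>
  let ?r = "Conj (rename (\<lambda>i. 2 * i) p) (rename (\<lambda>i. 2 * i + 1) q)"
  let ?u = "\<lambda>i. if even i then s (i div 2) else t (i div 2)"
  have "plug ?u v \<circ> (\<lambda>i. 2 * i) = plug s v" "plug ?u v \<circ> (\<lambda>i. 2 * i + 1) = plug t v" for v
    by (auto simp: plug_def fun_eq_iff)
  then have "(P v \<and> Q v) = sat M (plug ?u v) ?r" for v
    by (simp only: sat.simps sat_rename p(2) q(2))
  moreover have "wf_form M ?r" using p q by (simp add: wf_rename)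
  ultimately show ?thesis unfolding val_definable_def by blast
qed

lemma val_definable_ex:
  assumes "val_definable M P"
  shows "val_definable M (\<lambda>v. \<exists>a. P (v(j := a)))"
proof -
  obtain p s where p: "wf_form M p" "\<And>v. P v = sat M (plug s v) p"
    using assms unfolding val_definable_def by blast
  \<comment> \<open>Variable 0 is freed for the quantifier: exactly the variables that read
    \<open>v j\<close> go there, all others move up by one.\<close>
  let ?r = "\<lambda>i. if s i = Inl j then 0 else Suc i"
  let ?t = "\<lambda>i. if i = 0 then Inl 0 else s (i - 1)"
  have "(plug ?t v)(0 := a) \<circ> ?r = plug s (v(j := a))" for v a
    by (auto simp: plug_def fun_eq_iff split: sum.splits)
  then have "(\<exists>a. P (v(j := a))) = sat M (plug ?t v) (Exists 0 (rename ?r p))" for v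
    by (simp only: sat.simps sat_rename p(2))
  moreover have "wf_form M (Exists 0 (rename ?r p))" using p by (simp add: wf_rename)
  ultimately show ?thesis unfolding val_definable_def by blast
qed

lemma val_definable_ex_list:
  fixes M :: "('f, 'r, 'm, 'z) fo_structure_scheme"
  assumes "val_definable M P"
  shows "val_definable M
    (\<lambda>v. \<exists>a. length a = k \<and> P (\<lambda>x. if s \<le> x \<and> x < s + k then a ! (x - s) else v x))"
  using assms
proof (induction k arbitrary: P)
  case 0
  have "(\<lambda>x. if s \<le> x \<and> x < s + 0 then [] ! (x - s) else v x) = v" for v :: "nat \<Rightarrow> 'm"
    by (rule ext) auto
  then show ?case using 0 by simp
next
  case (Suc k)
  have "val_definable M (\<lambda>v. \<exists>c. P (v(s + k := c)))"
    by (rule val_definable_ex[OF Suc.prems])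
  from Suc.IH[OF this] have *: "val_definable M (\<lambda>v. \<exists>a. length a = k \<and>
      (\<exists>c. P ((\<lambda>x. if s \<le> x \<and> x < s + k then a ! (x - s) else v x)(s + k := c))))" .
  have eq: "(\<lambda>x. if s \<le> x \<and> x < s + k then a ! (x - s) else v x)(s + k := c) =
      (\<lambda>x. if s \<le> x \<and> x < s + Suc k then (a @ [c]) ! (x - s) else v x)" if "length a = k" for a c v
    using that by (auto simp: fun_eq_iff nth_append)
  have "(\<exists>a. length a = k \<and> (\<exists>c. P ((\<lambda>x. if s \<le> x \<and> x < s + k then a ! (x - s) else v x)(s + k := c))))
     = (\<exists>a. length a = Suc k \<and> P (\<lambda>x. if s \<le> x \<and> x < s + Suc k then a ! (x - s) else v x))"
    (is "?L = ?R") for v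
  proof
    assume ?L
    then obtain a c where "length a = k"
      "P ((\<lambda>x. if s \<le> x \<and> x < s + k then a ! (x - s) else v x)(s + k := c))" by blast
    then show ?R using eq[of a v c] by (intro exI[of _ "a @ [c]"]) auto
  next
    assume ?R
    then obtain b where b: "length b = Suc k"
      "P (\<lambda>x. if s \<le> x \<and> x < s + Suc k then b ! (x - s) else v x)" by blast
    obtain a c where ac: "b = a @ [c]" "length a = k" using b(1) by (metis length_Suc_conv_rev)
    show ?L using b(2) unfolding ac(1) eq[OF ac(2), symmetric]
      by (intro exI[of _ a] conjI ac(2)) (rule exI)
  qed
  then show ?case using * by simp
qed

lemma val_definable_mem:
  assumes "definable M N D" "length is = N"
  shows "val_definable M (\<lambda>v. map v is \<in> D)"
proof -
  obtain p b where p: "wf_form M p" "fv p \<subseteq> {..<N + length b}"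
    "D = {x \<in> tuples N. sat M (nth (x @ b)) p}"
    using assms(1) unfolding definable_over_def by blast
  let ?s = "\<lambda>i. if i < N then Inl (is ! i) else Inr (b ! (i - N))"
  have "sat M (nth (map v is @ b)) p = sat M (plug ?s v) p" for v
    by (rule sat_cong) (use p(2) assms(2) in \<open>auto simp: plug_def nth_append\<close>)
  then show ?thesis unfolding val_definable_def using p assms(2)
    by (auto simp: tuples_def)
qed

lemma definable_if_val_definable:
  assumes "val_definable M P" "\<And>v v'. (\<And>i. i < N \<Longrightarrow> v i = v' i) \<Longrightarrow> P v = P v'"
  shows "definable M N {x \<in> tuples N. P (nth x)}"
proof -
  obtain p s where p: "wf_form M p" "\<And>v. P v = sat M (plug s v) p"
    using assms unfolding val_definable_def by blast
  obtain K where K: "fv p \<subseteq> {..<K}"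
    using finite_fv[of p] by (auto simp: finite_nat_set_iff_bounded)
  define b where "b = map (\<lambda>i. case s i of Inl j \<Rightarrow> undefined | Inr a \<Rightarrow> a) [0..<K]"
  \<comment> \<open>Variables reading positions outside the point share the dummy
    \<open>N + K\<close>. It lies beyond the range that \<open>definable_over\<close> admits, so
    \<open>q\<close> binds it; by the second assumption its value does not matter.\<close>
  define r where "r = (\<lambda>i. case s i of Inl j \<Rightarrow> if j < N then j else N + K | Inr a \<Rightarrow> N + i)"
  define q where "q = Exists (N + K) (rename r p)"
  have lb: "length b = K" by (simp add: b_def)
  have "fv (rename r p) \<subseteq> r ` fv p" by (rule fv_rename)
  moreover have "r i \<le> N + K" if "i \<in> fv p" for i
    using that K by (auto simp: r_def split: sum.splits)
  ultimately have "fv (rename r p) \<subseteq> {..N + K}" by fastforce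
  then have fq: "fv q \<subseteq> {..<N + length b}" by (auto simp: q_def lb)
  have "sat M (nth (x @ b)) q = P (nth x)" if x: "length x = N" for x
  proof -
    have "sat M ((nth (x @ b))(N + K := a) \<circ> r) p = P (nth x)" for a
    proof -
      have "sat M ((nth (x @ b))(N + K := a) \<circ> r) p =
          sat M (plug s (\<lambda>i. if i < N then x ! i else a)) p"
        by (rule sat_cong) (use K x in \<open>auto simp: r_def plug_def nth_append b_def split: sum.splits\<close>)
      also have "\<dots> = P (\<lambda>i. if i < N then x ! i else a)" by (simp add: p(2))
      also have "\<dots> = P (nth x)" by (rule assms(2)) auto
      finally show ?thesis .
    qed
    then show ?thesis by (simp add: q_def sat_rename)
  qed
  moreover have "wf_form M q" by (simp add: q_def wf_rename p)
  ultimately show ?thesis unfolding definable_over_def using fq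
    by (intro exI[of _ q] exI[of _ b]) (auto simp: tuples_def)
qed

section \<open>Definable predicates on sequences of points\<close>

definition block :: "nat \<Rightarrow> (nat \<Rightarrow> 'm) \<Rightarrow> nat \<Rightarrow> 'm list" where
  "block n v i = map (\<lambda>j. v (i * n + j)) [0..<n]"

text \<open>Reading a valuation as a sequence of \<open>n\<close>-tuples allows statements about
  points, and thus about the group operation, without indices of coordinates.\<close>

definition block_definable ::
  "('f, 'r, 'm, 'z) fo_structure_scheme \<Rightarrow> nat \<Rightarrow> ((nat \<Rightarrow> 'm list) \<Rightarrow> bool) \<Rightarrow> bool" where
  "block_definable M n Q \<longleftrightarrow> val_definable M (\<lambda>v. Q (block n v))"

lemma length_block [simp]: "length (block n v i) = n"
  by (simp add: block_def)

lemma nth_block: "j < n \<Longrightarrow> block n v i ! j = v (i * n + j)"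
  by (simp add: block_def)

lemma block_definable_not: "block_definable M n P \<Longrightarrow> block_definable M n (\<lambda>w. \<not> P w)"
  unfolding block_definable_def by (rule val_definable_not)

lemma block_definable_conj:
  "block_definable M n P \<Longrightarrow> block_definable M n Q \<Longrightarrow> block_definable M n (\<lambda>w. P w \<and> Q w)"
  unfolding block_definable_def by (rule val_definable_conj)

lemma block_definable_disj:
  assumes "block_definable M n P" "block_definable M n Q"
  shows "block_definable M n (\<lambda>w. P w \<or> Q w)"
  using block_definable_not[OF block_definable_conj[OF block_definable_not[OF assms(1)]
      block_definable_not[OF assms(2)]]] by simp

lemma block_index: "j < n \<Longrightarrow> (i * n \<le> i' * n + j \<and> i' * n + j < i * n + n) = (i' = i)" for i i' j n :: nat
proof
  assume j: "j < n" and *: "i * n \<le> i' * n + j \<and> i' * n + j < i * n + n"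
  have "i' * n < Suc i * n" using * by simp
  then have "i' < Suc i" using mult_less_cancel2 by blast
  have "i * n < Suc i' * n" using * j by simp
  then have "i < Suc i'" using mult_less_cancel2 by blast
  then show "i' = i" using \<open>i' < Suc i\<close> by simp
qed auto

lemma block_definable_ex:
  assumes "block_definable M n Q"
  shows "block_definable M n (\<lambda>w. \<exists>a. length a = n \<and> Q (w(i := a)))"
proof -
  have eq: "block n (\<lambda>x. if i * n \<le> x \<and> x < i * n + n then a ! (x - i * n) else v x) =
      (block n v)(i := a)" if "length a = n" for a v
  proof
    fix i'
    show "block n (\<lambda>x. if i * n \<le> x \<and> x < i * n + n then a ! (x - i * n) else v x) i' =
      ((block n v)(i := a)) i'"
    proof (rule nth_equalityI)
      fix j assume "j < length (block n (\<lambda>x. if i * n \<le> x \<and> x < i * n + n then a ! (x - i * n) else v x) i')"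
      then have j: "j < n" by simp
      show "block n (\<lambda>x. if i * n \<le> x \<and> x < i * n + n then a ! (x - i * n) else v x) i' ! j =
        ((block n v)(i := a)) i' ! j"
        unfolding nth_block[OF j] block_index[OF j]
        using j by (cases "i' = i") (auto simp: nth_block)
    qed (use that in auto)
  qed
  have "val_definable M (\<lambda>v. \<exists>a. length a = n \<and>
      Q (block n (\<lambda>x. if i * n \<le> x \<and> x < i * n + n then a ! (x - i * n) else v x)))"
    using val_definable_ex_list[OF assms[unfolded block_definable_def], of n "i * n"] .
  moreover have "(\<exists>a. length a = n \<and>
      Q (block n (\<lambda>x. if i * n \<le> x \<and> x < i * n + n then a ! (x - i * n) else v x))) =
     (\<exists>a. length a = n \<and> Q ((block n v)(i := a)))" for v
    by (intro ex_cong1 conj_cong refl) (simp only: eq)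
  ultimately show ?thesis unfolding block_definable_def by simp
qed

lemma block_definable_subst:
  assumes "block_definable M n Q" "\<And>i c. t i = Inr c \<Longrightarrow> length c = n"
  shows "block_definable M n (\<lambda>w. Q (\<lambda>i. case t i of Inl j \<Rightarrow> w j | Inr c \<Rightarrow> c))"
proof -
  let ?t = "\<lambda>x. case t (x div n) of Inl j \<Rightarrow> Inl (j * n + x mod n) | Inr c \<Rightarrow> Inr (c ! (x mod n))"
  have "block n (plug ?t v) = (\<lambda>i. case t i of Inl j \<Rightarrow> block n v j | Inr c \<Rightarrow> c)" for v
    using assms(2)
    by (auto simp: block_def plug_def fun_eq_iff list_eq_iff_nth_eq split: sum.splits)
  then show ?thesis
    using val_definable_plug[OF assms(1)[unfolded block_definable_def], of ?t]
    unfolding block_definable_def by simp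
qed

lemma block_definable_mem:
  assumes "definable M n D"
  shows "block_definable M n (\<lambda>w. w i \<in> D)"
  using val_definable_mem[OF assms, of "map (\<lambda>j. i * n + j) [0..<n]"]
  unfolding block_definable_def by (simp add: block_def comp_def)

lemma block_definable_mem3:
  assumes "definable M (3 * n) D"
  shows "block_definable M n (\<lambda>w. w i @ w j @ w k \<in> D)"
  using val_definable_mem[OF assms, of "map (\<lambda>l. i * n + l) [0..<n] @ map (\<lambda>l. j * n + l) [0..<n]
     @ map (\<lambda>l. k * n + l) [0..<n]"]
  unfolding block_definable_def by (simp add: block_def comp_def)

text \<open>A predicate on blocks may look at any of them; identifying all with block 0 leaves only
  variables below \<open>n\<close>.\<close>

lemma definable_if_block_definable:
  fixes M :: "('f, 'r, 'm, 'z) fo_structure_scheme"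
  assumes "block_definable M n Q"
  shows "definable M n {x \<in> tuples n. Q (\<lambda>_. x)}"
proof -
  have "block_definable M n (\<lambda>w. Q (\<lambda>i. w 0))"
    using block_definable_subst[OF assms, of "\<lambda>_. Inl 0"] by simp
  then have "definable M n {x \<in> tuples n. Q (\<lambda>i. block n (nth x) 0)}"
    unfolding block_definable_def
  proof (rule definable_if_val_definable)
    fix v v' :: "nat \<Rightarrow> 'm" assume "\<And>i. i < n \<Longrightarrow> v i = v' i"
    then have "block n v 0 = block n v' 0" by (simp add: block_def)
    then show "Q (\<lambda>i. block n v 0) = Q (\<lambda>i. block n v' 0)" by simp
  qed
  moreover have "block n (nth x) 0 = x" if "x \<in> tuples n" for x :: "'m list"
    using that by (auto simp: block_def tuples_def map_nth)
  then have "{x \<in> tuples n. Q (\<lambda>i. block n (nth x) 0)} = {x \<in> tuples n. Q (\<lambda>_. x)}"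
    by auto
  ultimately show ?thesis by simp
qed

lemma definable_if_block_definable2:
  fixes M :: "('f, 'r, 'm, 'z) fo_structure_scheme"
  assumes "block_definable M n Q"
  shows "definable M (2 * n) {x @ y | x y. x \<in> tuples n \<and> y \<in> tuples n \<and> Q (\<lambda>i. if i = 0 then x else y)}"
proof -
  have "block_definable M n (\<lambda>w. Q (\<lambda>i. case (if i = 0 then Inl 0 else Inl 1) of
      Inl j \<Rightarrow> w j | Inr c \<Rightarrow> c))"
    by (rule block_definable_subst[OF assms]) (simp split: if_splits)
  moreover have "(case (if i = 0 then Inl 0 else Inl 1) of Inl j \<Rightarrow> w j | Inr c \<Rightarrow> c) =
      (if i = 0 then w 0 else w 1)" for i :: nat and w :: "nat \<Rightarrow> 'm list"
    by simp
  ultimately have "block_definable M n (\<lambda>w. Q (\<lambda>i. if i = 0 then w 0 else w 1))"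
    by simp
  then have "definable M (2 * n)
      {z \<in> tuples (2 * n). Q (\<lambda>i. if i = 0 then block n (nth z) 0 else block n (nth z) 1)}"
    unfolding block_definable_def
  proof (rule definable_if_val_definable)
    fix v v' :: "nat \<Rightarrow> 'm" assume "\<And>i. i < 2 * n \<Longrightarrow> v i = v' i"
    then have "block n v 0 = block n v' 0" "block n v 1 = block n v' 1"
      by (auto simp: block_def)
    then show "Q (\<lambda>i. if i = 0 then block n v 0 else block n v 1) =
       Q (\<lambda>i. if i = 0 then block n v' 0 else block n v' 1)" by (simp only:)
  qed
  moreover have "{z \<in> tuples (2 * n). Q (\<lambda>i. if i = 0 then block n (nth z) 0 else block n (nth z) 1)} =
     {x @ y | x y. x \<in> tuples n \<and> y \<in> tuples n \<and> Q (\<lambda>i. if i = 0 then x else y)}" (is "?A = ?B")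
  proof
    show "?A \<subseteq> ?B"
    proof
      fix z assume z: "z \<in> ?A"
      have "z = block n (nth z) 0 @ block n (nth z) 1"
        using z by (auto simp: tuples_def block_def list_eq_iff_nth_eq nth_append)
      moreover have "Q (\<lambda>i. if i = 0 then block n (nth z) 0 else block n (nth z) 1)" using z by blast
      ultimately show "z \<in> ?B" unfolding tuples_def mem_Collect_eq
        by (intro exI[of _ "block n (nth z) 0"] exI[of _ "block n (nth z) 1"] conjI length_block)
    qed
    show "?B \<subseteq> ?A"
    proof
      fix z assume "z \<in> ?B"
      then obtain x y where xy: "z = x @ y" "length x = n" "length y = n" "Q (\<lambda>i. if i = 0 then x else y)"
        by (auto simp: tuples_def)
      have "block n (nth z) 0 = x" "block n (nth z) 1 = y"
        using xy by (auto simp: block_def list_eq_iff_nth_eq nth_append)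
      then have "Q (\<lambda>i. if i = 0 then block n (nth z) 0 else block n (nth z) 1)"
        using xy(4) by (simp only:)
      moreover have "z \<in> tuples (2 * n)" using xy(1-3) by (simp add: tuples_def)
      ultimately show "z \<in> ?A" by blast
    qed
  qed
  ultimately show ?thesis by simp
qed

text \<open>Blocks always have length \<open>n\<close>, so a definition may be rewritten under that
  assumption. It is what makes a concatenation of blocks determine the blocks.\<close>

lemma block_definable_cong:
  assumes "block_definable M n P" "\<And>w. (\<And>i. length (w i) = n) \<Longrightarrow> P w = Q w"
  shows "block_definable M n Q"
  using assms unfolding block_definable_def by simp

text \<open>Serves to quantify over the \<open>k\<close> translating elements of a cover at
  once.\<close>

lemma block_definable_ex_many:
  fixes M :: "('f, 'r, 'm, 'z) fo_structure_scheme"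
  assumes "block_definable M n Q"
  shows "block_definable M n
    (\<lambda>w. \<exists>h. (\<forall>i<k. length (h i) = n) \<and> Q (\<lambda>i. if s \<le> i \<and> i < s + k then h (i - s) else w i))"
  using assms
proof (induction k arbitrary: Q)
  case 0
  have "(\<lambda>i. if s \<le> i \<and> i < s + 0 then h (i - s) else w i) = w" for h w :: "nat \<Rightarrow> 'm list"
    by (rule ext) auto
  then show ?case using 0 by simp
next
  case (Suc k)
  have "block_definable M n (\<lambda>w. \<exists>c. length c = n \<and> Q (w(s + k := c)))"
    by (rule block_definable_ex[OF Suc.prems])
  from Suc.IH[OF this] have *: "block_definable M n (\<lambda>w. \<exists>h. (\<forall>i<k. length (h i) = n) \<and>
      (\<exists>c. length c = n \<and> Q ((\<lambda>i. if s \<le> i \<and> i < s + k then h (i - s) else w i)(s + k := c))))" .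
  have eq: "(\<lambda>i. if s \<le> i \<and> i < s + k then h (i - s) else w i)(s + k := c) =
      (\<lambda>i. if s \<le> i \<and> i < s + Suc k then (h(k := c)) (i - s) else w i)" for h c w
    by (auto simp: fun_eq_iff)
  show ?case
  proof (rule block_definable_cong[OF *])
    fix w :: "nat \<Rightarrow> 'm list"
    show "(\<exists>h. (\<forall>i<k. length (h i) = n) \<and>
      (\<exists>c. length c = n \<and> Q ((\<lambda>i. if s \<le> i \<and> i < s + k then h (i - s) else w i)(s + k := c)))) =
      (\<exists>h. (\<forall>i<Suc k. length (h i) = n) \<and> Q (\<lambda>i. if s \<le> i \<and> i < s + Suc k then h (i - s) else w i))"
      (is "?L = ?R")
    proof
      assume ?L
      then obtain h c where "\<forall>i<k. length (h i) = n" "length c = n"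
        "Q (\<lambda>i. if s \<le> i \<and> i < s + Suc k then (h(k := c)) (i - s) else w i)"
        unfolding eq by blast
      then show ?R by (intro exI[of _ "h(k := c)"]) (auto simp: less_Suc_eq)
    next
      assume ?R
      then obtain h where "\<forall>i<Suc k. length (h i) = n"
        "Q (\<lambda>i. if s \<le> i \<and> i < s + Suc k then h (i - s) else w i)" by blast
      then show ?L unfolding eq by (intro exI[of _ h] conjI exI[of _ "h k"]) (simp_all only: fun_upd_triv, auto)
    qed
  qed
qed

section \<open>Boolean operations on definable sets\<close>

lemma definable_subset_tuples: "definable M n D \<Longrightarrow> D \<subseteq> tuples n"
  unfolding definable_over_def by auto

lemma definable_Int:
  assumes "definable M n A" "definable M n B"
  shows "definable M n (A \<inter> B)"
proof -
  have "{x \<in> tuples n. x \<in> A \<and> x \<in> B} = A \<inter> B"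
    using assms[THEN definable_subset_tuples] by auto
  then show ?thesis
    using definable_if_block_definable[OF block_definable_conj[OF block_definable_mem[OF assms(1), of 0]
      block_definable_mem[OF assms(2), of 0]]] by simp
qed

lemma definable_Un:
  assumes "definable M n A" "definable M n B"
  shows "definable M n (A \<union> B)"
proof -
  have "{x \<in> tuples n. x \<in> A \<or> x \<in> B} = A \<union> B"
    using assms[THEN definable_subset_tuples] by auto
  then show ?thesis
    using definable_if_block_definable[OF block_definable_disj[OF block_definable_mem[OF assms(1), of 0]
      block_definable_mem[OF assms(2), of 0]]] by simp
qed

lemma definable_compl:
  assumes "definable M n A"
  shows "definable M n (tuples n - A)"
proof -
  have "{x \<in> tuples n. x \<notin> A} = tuples n - A" by auto
  then show ?thesis
    using definable_if_block_definable[OF block_definable_not[OF block_definable_mem[OF assms(1), of 0]]]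
    by simp
qed

lemma definable_diff:
  assumes "definable M n A" "definable M n B"
  shows "definable M n (A - B)"
proof -
  have "A \<inter> (tuples n - B) = A - B"
    using assms[THEN definable_subset_tuples] by auto
  then show ?thesis using definable_Int[OF assms(1) definable_compl[OF assms(2)]] by simp
qed

lemma definable_tuples: "definable M n (tuples n)"
  unfolding definable_over_def
  by (intro exI[of _ "Exists 0 (Equal (Var 0) (Var 0))"] exI[of _ "[]"]) auto

lemma definable_Inter_finite:
  "finite F \<Longrightarrow> (\<And>D. D \<in> F \<Longrightarrow> definable M n D) \<Longrightarrow> definable M n (tuples n \<inter> \<Inter>F)"
proof (induction F rule: finite_induct)
  case empty
  then show ?case by (simp add: definable_tuples)
next
  case (insert D F)
  have "tuples n \<inter> \<Inter>(insert D F) = D \<inter> (tuples n \<inter> \<Inter>F)" by auto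
  then show ?case using insert by (simp add: definable_Int del: Inter_insert)
qed

section \<open>Compactness\<close>

lemma small_subset: "small \<kappa> B \<Longrightarrow> A \<subseteq> B \<Longrightarrow> small \<kappa> A"
  unfolding small_def using card_of_mono1 ordLeq_ordLess_trans by blast

lemma small_image: "small \<kappa> A \<Longrightarrow> small \<kappa> (f ` A)"
  unfolding small_def using card_of_image ordLeq_ordLess_trans by blast

locale saturated_structure =
  fixes M :: "('f, 'r, 'm, 'z) fo_structure_scheme" and \<kappa> :: "'k rel"
  assumes large: "sufficiently_large \<kappa> M" and sat: "saturated \<kappa> M"
begin

abbreviation "formulas \<equiv> {p. wf_form M p}"

lemma infinite_formulas: "infinite formulas"
proof -
  have "inj (\<lambda>i. Equal (Var i) (Var i))" by (auto simp: inj_on_def)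
  moreover have "range (\<lambda>i. Equal (Var i) (Var i)) \<subseteq> formulas" by auto
  ultimately show ?thesis using infinite_iff_countable_subset by blast
qed

lemma small_Pow_formulas: "small \<kappa> (Pow formulas)"
  using large by (simp add: sufficiently_large_def)

text \<open>The bound on \<open>\<kappa>\<close> concerns the power set, into which singletons embed
  the formulas.\<close>

lemma small_formulas: "small \<kappa> formulas"
proof -
  have "formulas \<subseteq> the_elem ` Pow formulas"
  proof
    fix p assume "p \<in> formulas"
    then have "{p} \<in> Pow formulas" by auto
    then show "p \<in> the_elem ` Pow formulas" by (metis imageI the_elem_eq)
  qed
  then show ?thesis using small_Pow_formulas small_image small_subset by blast
qed

lemma small_nat: "small \<kappa> (UNIV :: nat set)"
  using infinite_formulas small_formulas unfolding small_def infinite_iff_card_of_nat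
  by (rule ordLeq_ordLess_trans)

lemma small_finite: "finite A \<Longrightarrow> small \<kappa> A"
  using small_nat unfolding small_def
  by (meson card_of_nat finite_iff_ordLess_natLeq ordIso_symmetric ordLess_ordIso_trans ordLess_transitive)

lemma small_Times:
  assumes "small \<kappa> A" "small \<kappa> B"
  shows "small \<kappa> (A \<times> B)"
proof (cases "finite (A \<times> B)")
  case False
  then have ne: "A \<noteq> {}" "B \<noteq> {}" by auto
  from False have inf: "infinite A \<or> infinite B" by blast
  consider "|A| \<le>o |B|" | "|B| \<le>o |A|" using ordLeq_total[OF card_of_Well_order card_of_Well_order] by blast
  then show ?thesis
  proof cases
    case 1
    then have "infinite B" using inf card_of_ordLeq_infinite by blast
    then have "|A \<times> B| \<le>o |B|" 
      using card_of_Times_infinite[OF _ ne(1) 1] ordIso_imp_ordLeq by auto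
    then show ?thesis using assms unfolding small_def by (rule_tac ordLeq_ordLess_trans)
  next
    case 2
    then have "infinite A" using inf card_of_ordLeq_infinite by blast
    then have "|A \<times> B| \<le>o |A|" 
      using card_of_Times_infinite[OF _ ne(2) 2] ordIso_imp_ordLeq by auto
    then show ?thesis using assms unfolding small_def by (rule_tac ordLeq_ordLess_trans)
  qed
qed (rule small_finite)

text \<open>As \<open>\<kappa>\<close> may be singular, small unions of small sets can fail to be
  small; finite members, however, are enumerated by naturals, and products of two small sets are
  small.\<close>

lemma small_UN_finite:
  assumes "small \<kappa> I" "\<And>i. i \<in> I \<Longrightarrow> finite (A i)"
  shows "small \<kappa> (\<Union>i\<in>I. A i)"
proof -
  define xs where "xs i = (SOME l. set l = A i)" for i
  have xs: "set (xs i) = A i" if "i \<in> I" for i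
    unfolding xs_def by (rule someI_ex) (rule finite_list[OF assms(2)[OF that]])
  have "(\<Union>i\<in>I. A i) \<subseteq> (\<lambda>(i, k). xs i ! k) ` (I \<times> UNIV)"
  proof
    fix x assume "x \<in> (\<Union>i\<in>I. A i)"
    then obtain i where "i \<in> I" "x \<in> set (xs i)" using xs by auto
    then obtain k where "xs i ! k = x" by (auto simp: in_set_conv_nth)
    then show "x \<in> (\<lambda>(i, k). xs i ! k) ` (I \<times> UNIV)" using \<open>i \<in> I\<close> by force
  qed
  then show ?thesis
    by (rule small_subset[OF small_image[OF small_Times[OF assms(1) small_nat]]])
qed

lemma small_Un: "small \<kappa> A \<Longrightarrow> small \<kappa> B \<Longrightarrow> small \<kappa> (A \<union> B)"
proof -
  assume A: "small \<kappa> A" and B: "small \<kappa> B"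
  show ?thesis
  proof (cases "A = {} \<or> B = {}")
    case True
    then show ?thesis using A B by auto
  next
    case False
    then obtain a b where ab: "a \<in> A" "b \<in> B" by blast
    have "A \<union> B \<subseteq> (\<lambda>z. if snd z then fst (fst z) else snd (fst z)) ` ((A \<times> B) \<times> UNIV)"
    proof
      fix x assume "x \<in> A \<union> B"
      then have "((x, b), True) \<in> (A \<times> B) \<times> UNIV \<or> ((a, x), False) \<in> (A \<times> B) \<times> UNIV"
        using ab by auto
      then show "x \<in> (\<lambda>z. if snd z then fst (fst z) else snd (fst z)) ` ((A \<times> B) \<times> UNIV)"
        by (elim disjE) (erule rev_image_eqI, simp)+
    qed
    moreover have "small \<kappa> ((A \<times> B) \<times> (UNIV :: bool set))"
      by (intro small_Times A B small_finite) auto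
    ultimately show ?thesis using small_image small_subset by blast
  qed
qed

text \<open>Saturation concerns types over one small parameter set. A small family has one, since
  each of its members uses finitely many parameters.\<close>

lemma compactness:
  assumes "small \<kappa> F" "\<And>D. D \<in> F \<Longrightarrow> definable M N D"
    and "\<And>F0. F0 \<subseteq> F \<Longrightarrow> finite F0 \<Longrightarrow> tuples N \<inter> \<Inter>F0 \<noteq> {}"
  shows "tuples N \<inter> \<Inter>F \<noteq> {}"
proof -
  have "\<exists>b. definable_over M (set b) N D" if "D \<in> F" for D
    using assms(2)[OF that] unfolding definable_over_def by blast
  then obtain b where b: "\<And>D. D \<in> F \<Longrightarrow> definable_over M (set (b D)) N D" by metis
  define A where "A = (\<Union>D\<in>F. set (b D))"
  have "small \<kappa> A" unfolding A_def by (rule small_UN_finite[OF assms(1)]) simp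
  moreover have "definable_over M A N D" if "D \<in> F" for D
    using b[OF that] that unfolding definable_over_def A_def by blast
  ultimately show ?thesis using sat assms(3) unfolding saturated_def by blast
qed

text \<open>This is compactness for \<open>F\<close> together with the complements of the members of
  \<open>C\<close>.\<close>

lemma compactness_cover:
  assumes F: "small \<kappa> F" "\<And>D. D \<in> F \<Longrightarrow> definable M N D"
    and C: "small \<kappa> C" "\<And>D. D \<in> C \<Longrightarrow> definable M N D"
    and cov: "tuples N \<inter> \<Inter>F \<subseteq> \<Union>C"
  obtains F0 C0 where "F0 \<subseteq> F" "finite F0" "C0 \<subseteq> C" "finite C0" "tuples N \<inter> \<Inter>F0 \<subseteq> \<Union>C0"
proof -
  let ?G = "F \<union> (\<lambda>D. tuples N - D) ` C"
  have "tuples N \<inter> \<Inter>?G = {}" using cov by auto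
  then have "\<not> (\<forall>G0. G0 \<subseteq> ?G \<longrightarrow> finite G0 \<longrightarrow> tuples N \<inter> \<Inter>G0 \<noteq> {})"
    using compactness[of ?G N] F C by (auto intro!: small_Un small_image definable_compl)
  then obtain G0 where G0: "G0 \<subseteq> ?G" "finite G0" "tuples N \<inter> \<Inter>G0 = {}" by blast
  define F0 where "F0 = G0 \<inter> F"
  have "G0 - F \<subseteq> (\<lambda>D. tuples N - D) ` C" using G0 by auto
  then obtain C0 where C0: "C0 \<subseteq> C" "finite C0" "G0 - F = (\<lambda>D. tuples N - D) ` C0"
    using finite_subset_image[of "G0 - F" "\<lambda>D. tuples N - D" C] G0(2) by auto
  have "tuples N \<inter> \<Inter>F0 \<subseteq> \<Union>C0"
  proof
    fix x assume x: "x \<in> tuples N \<inter> \<Inter>F0"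
    then obtain D where D: "D \<in> G0" "x \<notin> D" using G0(3) by auto
    then have "D \<in> G0 - F" using x by (auto simp: F0_def)
    then show "x \<in> \<Union>C0" using D x C0(3) by auto
  qed
  then show ?thesis using that[of F0 C0] C0 G0(2) by (auto simp: F0_def)
qed

lemma definable_cover:
  assumes "definable M N Y" and "small \<kappa> C" "\<And>D. D \<in> C \<Longrightarrow> definable M N D" "Y \<subseteq> \<Union>C"
  obtains C0 where "C0 \<subseteq> C" "finite C0" "Y \<subseteq> \<Union>C0"
proof -
  obtain F0 C0 where "F0 \<subseteq> {Y}" "finite F0" "C0 \<subseteq> C" "finite C0" "tuples N \<inter> \<Inter>F0 \<subseteq> \<Union>C0"
    by (rule compactness_cover[of "{Y}" N C])
      (use assms definable_subset_tuples in \<open>auto intro: small_finite\<close>)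
  moreover have "Y \<subseteq> tuples N \<inter> \<Inter>F0"
    using definable_subset_tuples[OF assms(1)] \<open>F0 \<subseteq> {Y}\<close> by auto
  ultimately show ?thesis using that[of C0] by (meson order_trans)
qed

end

section \<open>Translates in abelian groups\<close>

text \<open>With \<open>q = K / C > 1\<close>, the contrary bounds \<open>q ^ r\<close> by a
  polynomial in \<open>r\<close>. Taking \<open>r = s (N + 1)\<close> and extracting an
  \<open>(N + 1)\<close>-th root makes the bound linear in \<open>s\<close>, whereas the square of
  Bernoulli's inequality makes \<open>q ^ (2 s)\<close> at least quadratic in
  \<open>s\<close>.\<close>

lemma exponential_not_polynomially_bounded:
  fixes C K N :: nat
  assumes "C < K"
  shows "\<exists>r. C ^ r * (2 * r + 1) ^ N < K ^ r"
proof (rule ccontr)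
  assume neg: "\<not> ?thesis"
  have le: "K ^ r \<le> C ^ r * (2 * r + 1) ^ N" for r
    using neg by (meson not_less)
  show False
  proof (cases "C = 0")
    case True
    then show ?thesis using le[of 1] assms by simp
  next
    case False
    define q where "q = real K / real C"
    define \<delta> where "\<delta> = q - 1"
    have \<delta>: "\<delta> > 0" using assms False by (simp add: \<delta>_def q_def)
    \<comment> \<open>The exponent is raised from \<open>N\<close> to \<open>Suc N\<close> so that a
      root can be extracted even if \<open>N = 0\<close>.\<close>
    have q: "q ^ r \<le> (2 * real r + 1) ^ Suc N" for r
    proof -
      have "real (K ^ r) \<le> real (C ^ r * (2 * r + 1) ^ N)" using le[of r] by (simp only: of_nat_le_iff)
      then have "q ^ r \<le> (2 * real r + 1) ^ N"
        using False by (simp add: q_def power_divide divide_simps mult.commute add.commute)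
      also have "\<dots> \<le> (2 * real r + 1) ^ Suc N" by (rule power_increasing) auto
      finally show ?thesis .
    qed
    have lin: "q ^ s \<le> 2 * real s * real (Suc N) + 1" for s
    proof -
      have "(q ^ s) ^ Suc N \<le> (2 * real s * real (Suc N) + 1) ^ Suc N"
        using q[of "s * Suc N"] by (simp add: power_mult[symmetric] algebra_simps del: power_Suc)
      then show ?thesis by (rule power_le_imp_le_base) auto
    qed
    have bnd: "real s * \<delta>\<^sup>2 \<le> 5 * real (Suc N)" if s: "s > 0" for s
    proof -
      have "real s * \<delta> \<le> 1 + real s * \<delta>" by simp
      also have "\<dots> \<le> (1 + \<delta>) ^ s" using \<delta> by (intro Bernoulli_inequality) simp
      finally have b: "real s * \<delta> \<le> q ^ s" by (simp add: \<delta>_def)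
      then have "(real s * \<delta>)\<^sup>2 \<le> (q ^ s)\<^sup>2" using \<delta> by (intro power_mono) auto
      also have "\<dots> = q ^ (s * 2)" by (simp add: power_mult)
      also have "\<dots> \<le> 2 * real (s * 2) * real (Suc N) + 1" by (rule lin)
      also have "\<dots> \<le> 5 * real s * real (Suc N)"
      proof -
        have "1 \<le> s * Suc N" using s by simp
        then have "real 1 \<le> real (s * Suc N)" by (simp only: of_nat_le_iff)
        then have "1 \<le> real s * real (Suc N)" by (simp only: of_nat_mult of_nat_1)
        then show ?thesis by (simp add: algebra_simps)
      qed
      finally have "real s * (real s * \<delta>\<^sup>2) \<le> real s * (5 * real (Suc N))"
        by (simp add: power2_eq_square algebra_simps)
      then show ?thesis using s by (simp only: mult_le_cancel_left_pos of_nat_0_less_iff)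
    qed
    obtain s :: nat where s: "5 * real (Suc N) < real s * \<delta>\<^sup>2"
      using \<delta> reals_Archimedean3[of "\<delta>\<^sup>2"] by auto
    then have "s > 0" by (intro gr0I) auto
    then show False using bnd[of s] s by linarith
  qed
qed

context comm_group
begin

text \<open>Natural exponents suffice because \<open>translate_counting\<close> puts the inverses it
  needs into the list. By commutativity every product of at most \<open>r\<close> list members has
  this normal form, and there are only polynomially many normal forms.\<close>

primrec ball :: "'a list \<Rightarrow> nat \<Rightarrow> 'a set" where
  "ball [] r = {\<one>}"
| "ball (f # fs) r = (\<lambda>(e, b). f [^] e \<otimes> b) ` ({..r} \<times> ball fs r)"

lemma ball_carrier: "set fs \<subseteq> carrier G \<Longrightarrow> ball fs r \<subseteq> carrier G"
  by (induction fs) auto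

lemma finite_ball: "finite (ball fs r)"
  by (induction fs) auto

lemma card_ball: "card (ball fs r) \<le> (r + 1) ^ length fs"
proof (induction fs)
  case (Cons f fs)
  have "card (ball (f # fs) r) \<le> card ({..r} \<times> ball fs r)"
    unfolding ball.simps by (rule card_image_le) (simp add: finite_ball)
  also have "\<dots> = (r + 1) * card (ball fs r)" by (simp add: card_cartesian_product)
  also have "\<dots> \<le> (r + 1) * (r + 1) ^ length fs" using Cons by (rule mult_le_mono2)
  also have "\<dots> = (r + 1) ^ length (f # fs)" by simp
  finally show ?case .
qed simp

lemma one_in_ball: "set fs \<subseteq> carrier G \<Longrightarrow> \<one> \<in> ball fs r"
proof (induction fs)
  case (Cons f fs)
  then have "f [^] (0::nat) \<otimes> \<one> = \<one>" by simp
  then show ?case using Cons by (auto intro!: image_eqI[of _ _ "(0, \<one>)"])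
qed simp

lemma ball_mono: "r \<le> s \<Longrightarrow> ball fs r \<subseteq> ball fs s"
proof (induction fs)
  case (Cons f fs)
  then have "{..r} \<times> ball fs r \<subseteq> {..s} \<times> ball fs s" by auto
  then show ?case by auto
qed simp

lemma mult_in_ball:
  "set fs \<subseteq> carrier G \<Longrightarrow> f \<in> set fs \<Longrightarrow> b \<in> ball fs r \<Longrightarrow> f \<otimes> b \<in> ball fs (Suc r)"
proof (induction fs arbitrary: b)
  case (Cons g fs)
  then obtain e b' where b: "b = g [^] e \<otimes> b'" "e \<le> r" "b' \<in> ball fs r" by auto
  have car: "g \<in> carrier G" "f \<in> carrier G" "b' \<in> carrier G"
    using Cons.prems b(3) ball_carrier[of fs r] by auto
  show ?case
  proof (cases "f = g")
    case True
    have "f \<otimes> b = g [^] Suc e \<otimes> b'"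
      using car True b(1) by (simp add: m_ac)
    moreover have "(Suc e, b') \<in> {..Suc r} \<times> ball fs (Suc r)"
      using b ball_mono[of r "Suc r" fs] by auto
    ultimately show ?thesis by (auto intro!: image_eqI[of _ _ "(Suc e, b')"])
  next
    case False
    then have "f \<otimes> b' \<in> ball fs (Suc r)" using Cons b by auto
    moreover have "f \<otimes> b = g [^] e \<otimes> (f \<otimes> b')"
      using car b(1) by (simp add: m_lcomm)
    ultimately show ?thesis using b(2) by (auto intro!: image_eqI[of _ _ "(e, f \<otimes> b')"])
  qed
qed simp

text \<open>Finitely generated abelian groups have polynomial growth: otherwise
  \<open>|X \<inter> B\<^sub>r x\<^sub>0|\<close>, for balls \<open>B\<^sub>r\<close> with respect to all the translations involved, would
  grow by a factor \<open>K / (k m |T|) > 1\<close> whenever \<open>r\<close> increases by 2.\<close>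

lemma translate_counting:
  fixes K k m :: nat
  assumes X: "X \<subseteq> carrier G" "x0 \<in> X"
    and W: "\<And>i. i < K \<Longrightarrow> W i \<subseteq> carrier G"
    and cov: "\<And>i. i < K \<Longrightarrow> \<exists>A. A \<subseteq> carrier G \<and> finite A \<and> card A \<le> k \<and> X \<subseteq> (\<Union>h\<in>A. h <# W i)"
    and mult: "\<And>z. z \<in> carrier G \<Longrightarrow> card {i. i < K \<and> z \<in> W i} \<le> m"
    and T: "finite T" "T \<subseteq> carrier G" "\<And>i. i < K \<Longrightarrow> W i \<subseteq> (\<Union>t\<in>T. t <# X)"
  shows "K \<le> k * m * card T"
proof (rule ccontr)
  assume "\<not> ?thesis"
  then have CK: "k * m * card T < K" by simp
  have "\<forall>i\<in>{..<K}. \<exists>A. A \<subseteq> carrier G \<and> finite A \<and> card A \<le> k \<and> X \<subseteq> (\<Union>h\<in>A. h <# W i)"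
    using cov by simp
  from bchoice[OF this] obtain A where
    "\<forall>i\<in>{..<K}. A i \<subseteq> carrier G \<and> finite (A i) \<and> card (A i) \<le> k \<and> X \<subseteq> (\<Union>h\<in>A i. h <# W i)" ..
  then have A: "\<And>i. i < K \<Longrightarrow> A i \<subseteq> carrier G" "\<And>i. i < K \<Longrightarrow> finite (A i)"
    "\<And>i. i < K \<Longrightarrow> card (A i) \<le> k" "\<And>i. i < K \<Longrightarrow> X \<subseteq> (\<Union>h\<in>A i. h <# W i)"
    by simp_all
  have "finite (m_inv G ` ((\<Union>i<K. A i) \<union> T))" using A(2) T(1) by simp
  \<comment> \<open>The generators are inverses because points get pulled back: if
    \<open>y = h \<otimes> w\<close> lies in \<open>S r\<close>, then
    \<open>w = inv h \<otimes> y\<close> lies in \<open>S (Suc r)\<close>.\<close>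
  from finite_list[OF this] obtain fs where fs: "set fs = m_inv G ` ((\<Union>i<K. A i) \<union> T)" ..
  have fsc: "set fs \<subseteq> carrier G" using fs A(1) T(2) by auto
  define S where "S r = (\<lambda>b. b \<otimes> x0) ` ball fs r" for r
  have finS: "finite (S r)" for r by (simp add: S_def finite_ball)
  have x0: "x0 \<in> carrier G" using X by auto
  have step: "inv h \<otimes> y \<in> S (Suc r)" if y: "y \<in> S r" and h: "inv h \<in> set fs" "h \<in> carrier G" for h y r
  proof -
    obtain b where b: "b \<in> ball fs r" "y = b \<otimes> x0" using y by (auto simp: S_def)
    have "b \<in> carrier G" using b ball_carrier[OF fsc] by auto
    then have "inv h \<otimes> y = (inv h \<otimes> b) \<otimes> x0" using b h x0 by (simp add: m_assoc)
    then show ?thesis using mult_in_ball[OF fsc h(1) b(1)] by (auto simp: S_def)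
  qed
  \<comment> \<open>Every point of \<open>Y \<inter> S r\<close> is pulled back into
    \<open>V \<inter> S (Suc r)\<close>, and each point there is reached from at most
    \<open>card B\<close> points.\<close>
  have shift: "card (Y \<inter> S r) \<le> card B * card (V \<inter> S (Suc r))"
    if B: "B \<subseteq> carrier G" "finite B" "m_inv G ` B \<subseteq> set fs" and V: "V \<subseteq> carrier G"
      and Y: "Y \<subseteq> (\<Union>h\<in>B. h <# V)" for B V Y r
  proof -
    have "Y \<inter> S r \<subseteq> (\<Union>h\<in>B. (\<lambda>w. h \<otimes> w) ` (V \<inter> S (Suc r)))"
    proof
      fix y assume y: "y \<in> Y \<inter> S r"
      then obtain h w where h: "h \<in> B" "w \<in> V" "y = h \<otimes> w" using Y by (auto simp: l_coset_def)
      have "inv h \<otimes> y = w" using h B(1) V by (metis inv_solve_left subsetD m_closed)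
      then have "w \<in> S (Suc r)" using step[of y r h] y h(1) B by auto
      then show "y \<in> (\<Union>h\<in>B. (\<lambda>w. h \<otimes> w) ` (V \<inter> S (Suc r)))" using h by auto
    qed
    then have "card (Y \<inter> S r) \<le> card (\<Union>h\<in>B. (\<lambda>w. h \<otimes> w) ` (V \<inter> S (Suc r)))"
      using B(2) finS by (intro card_mono) auto
    also have "\<dots> \<le> (\<Sum>h\<in>B. card ((\<lambda>w. h \<otimes> w) ` (V \<inter> S (Suc r))))"
      by (rule card_UN_le[OF B(2)])
    also have "\<dots> \<le> (\<Sum>h\<in>B. card (V \<inter> S (Suc r)))"
      by (intro sum_mono card_image_le) (simp add: finS)
    finally show ?thesis by simp
  qed
  define a where "a r = card (X \<inter> S r)" for r
  \<comment> \<open>Two shifts: from \<open>X\<close> to each \<open>W i\<close> at the cost of a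
    factor \<open>k\<close>, then from the union of the \<open>W i\<close> to \<open>X\<close> at
    the cost of \<open>card T\<close>. In between, incidences are counted point by point, each point
    lying in at most \<open>m\<close> of the sets.\<close>
  have grow: "K * a r \<le> k * m * card T * a (Suc (Suc r))" for r
  proof -
    define P where "P = (\<Union>i<K. W i) \<inter> S (Suc r)"
    have finP: "finite P" using finS by (simp add: P_def)
    have 1: "a r \<le> k * card (W i \<inter> S (Suc r))" if "i < K" for i
    proof -
      have "a r \<le> card (A i) * card (W i \<inter> S (Suc r))"
        unfolding a_def by (rule shift) (use A that W fs in auto)
      also have "\<dots> \<le> k * card (W i \<inter> S (Suc r))" using A(3)[OF that] by (rule mult_right_mono) simp
      finally show ?thesis .
    qed
    have "K * a r = (\<Sum>i<K. a r)" by simp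
    also have "\<dots> \<le> (\<Sum>i<K. k * card (W i \<inter> S (Suc r)))" by (rule sum_mono) (use 1 in auto)
    also have "\<dots> = k * (\<Sum>i<K. card (W i \<inter> S (Suc r)))" by (simp add: sum_distrib_left)
    also have "(\<Sum>i<K. card (W i \<inter> S (Suc r))) = (\<Sum>i<K. \<Sum>z\<in>P. if z \<in> W i then 1 else 0)"
    proof (rule sum.cong)
      fix i assume "i \<in> {..<K}"
      then have "W i \<inter> S (Suc r) = {z \<in> P. z \<in> W i}" by (auto simp: P_def)
      then show "card (W i \<inter> S (Suc r)) = (\<Sum>z\<in>P. if z \<in> W i then 1 else 0)"
        using finP by (simp add: sum.If_cases Int_def)
    qed simp
    also have "\<dots> = (\<Sum>z\<in>P. \<Sum>i<K. if z \<in> W i then 1 else 0)" by (rule sum.swap)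
    also have "\<dots> = (\<Sum>z\<in>P. card {i. i < K \<and> z \<in> W i})"
      by (intro sum.cong) (simp_all add: sum.If_cases Int_def)
    also have "\<dots> \<le> (\<Sum>z\<in>P. m)" by (rule sum_mono) (use mult W in \<open>auto simp: P_def\<close>)
    also have "\<dots> = m * card P" by simp
    also have "card P \<le> card T * a (Suc (Suc r))"
      unfolding P_def a_def by (rule shift) (use T X fs in auto)
    finally show ?thesis by (simp add: mult.assoc)
  qed
  have a0: "a 0 \<ge> 1"
  proof -
    have "\<one> \<otimes> x0 \<in> S 0" using one_in_ball[OF fsc] by (auto simp: S_def)
    then have "X \<inter> S 0 \<noteq> {}" using X x0 by auto
    then show ?thesis unfolding a_def using finS by (simp add: Suc_leI card_gt_0_iff)
  qed
  have exp: "K ^ r \<le> (k * m * card T) ^ r * a (2 * r)" for r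
  proof (induction r)
    case (Suc r)
    have "K ^ Suc r \<le> K * ((k * m * card T) ^ r * a (2 * r))" using Suc by simp
    also have "\<dots> = (k * m * card T) ^ r * (K * a (2 * r))" by simp
    also have "\<dots> \<le> (k * m * card T) ^ r * (k * m * card T * a (Suc (Suc (2 * r))))"
      by (intro mult_left_mono grow) simp
    finally show ?case by (simp add: mult.assoc mult.left_commute)
  qed (use a0 in simp)
  have "a r \<le> (r + 1) ^ length fs" for r
  proof -
    have "a r \<le> card (S r)" unfolding a_def by (intro card_mono) (auto simp: finS)
    also have "\<dots> \<le> card (ball fs r)" unfolding S_def by (rule card_image_le[OF finite_ball])
    also have "\<dots> \<le> (r + 1) ^ length fs" by (rule card_ball)
    finally show ?thesis .
  qed
  then have "K ^ r \<le> (k * m * card T) ^ r * (2 * r + 1) ^ length fs" for r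
    using exp[of r] by (meson le_trans mult_le_mono2)
  then show False using exponential_not_polynomially_bounded[OF CK, of "length fs"] by (meson not_less)
qed

end

section \<open>Definable subsets of a \<open>\<Or>\<close>-definable group\<close>

locale vee_group = saturated_structure M \<kappa> + comm_group U
  for M :: "('f, 'r, 'm, 'z) fo_structure_scheme" and \<kappa> :: "'k rel"
    and U :: "('m list, 'b) monoid_scheme" (structure) +
  fixes n :: nat and \<X> :: "'m list set set"
  assumes small_family: "small \<kappa> \<X>"
    and definable_family: "X \<in> \<X> \<Longrightarrow> definable M n X"
    and directed_family: "X \<in> \<X> \<Longrightarrow> Y \<in> \<X> \<Longrightarrow> \<exists>Z\<in>\<X>. X \<union> Y \<subseteq> Z"
    and carrier_family: "carrier U = \<Union>\<X>"
    and definable_mult_family: "X \<in> \<X> \<Longrightarrow> Y \<in> \<X> \<Longrightarrow>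
      definable M (3 * n) {x @ y @ (x \<otimes> y) | x y. x \<in> X \<and> y \<in> Y}"
begin

abbreviation "dU \<equiv> definable_in M n U"
abbreviation "bd \<equiv> block_definable M n"

lemma carrier_tuples: "carrier U \<subseteq> tuples n"
  using carrier_family definable_family definable_subset_tuples by blast

lemma length_carrier: "x \<in> carrier U \<Longrightarrow> length x = n"
  using carrier_tuples by (auto simp: tuples_def)

lemma dU_definable: "dU Y \<Longrightarrow> definable M n Y"
  and dU_carrier: "dU Y \<Longrightarrow> Y \<subseteq> carrier U"
  by (auto simp: definable_in_def)

lemma dU_family: "X \<in> \<X> \<Longrightarrow> dU X"
  using carrier_family definable_family by (auto simp: definable_in_def)

lemma dU_Un: "dU Y \<Longrightarrow> dU Z \<Longrightarrow> dU (Y \<union> Z)"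
  by (auto simp: definable_in_def definable_Un)

lemma dU_Int: "dU Y \<Longrightarrow> definable M n Z \<Longrightarrow> dU (Y \<inter> Z)"
  by (auto simp: definable_in_def definable_Int)

lemma dU_diff: "dU Y \<Longrightarrow> dU Z \<Longrightarrow> dU (Y - Z)"
  by (auto simp: definable_in_def definable_diff)

lemma finite_family_bounded:
  "finite C \<Longrightarrow> C \<subseteq> \<X> \<Longrightarrow> \<exists>Z\<in>\<X>. \<Union>C \<subseteq> Z"
proof (induction C rule: finite_induct)
  case empty
  have "\<X> \<noteq> {}" using carrier_family one_closed by auto
  then show ?case by auto
next
  case (insert X C)
  then obtain Z where "Z \<in> \<X>" "\<Union>C \<subseteq> Z" by auto
  moreover obtain Z' where "Z' \<in> \<X>" "X \<union> Z \<subseteq> Z'"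
    using directed_family[of X Z] insert \<open>Z \<in> \<X>\<close> by auto
  ultimately show ?case by (intro bexI[of _ Z']) auto
qed

text \<open>Compactness makes the cover by \<open>\<X>\<close> finite, and directedness merges it
  into one member.\<close>

lemma dU_bounded:
  assumes "dU Y"
  shows "\<exists>Z\<in>\<X>. Y \<subseteq> Z"
proof -
  obtain C0 where C0: "C0 \<subseteq> \<X>" "finite C0" "Y \<subseteq> \<Union>C0"
    by (rule definable_cover[OF dU_definable[OF assms] small_family definable_family])
      (use dU_carrier[OF assms] carrier_family in auto)
  then show ?thesis using finite_family_bounded[OF C0(2,1)] by (meson order_trans)
qed

text \<open>Multiplication is definable only on products of members of \<open>\<X>\<close>, so every
  predicate that involves it carries guards confining the factors to definable sets.\<close>

lemma bd_mult:
  assumes "dU Y" "dU Z"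
  shows "bd (\<lambda>w. w i \<in> Y \<and> w j \<in> Z \<and> w k = w i \<otimes> w j)"
proof -
  obtain B where B: "B \<in> \<X>" "Y \<union> Z \<subseteq> B"
    using dU_bounded[OF dU_Un[OF assms]] by blast
  have BU: "B \<subseteq> carrier U" using B carrier_family by auto
  have "bd (\<lambda>w. (w i \<in> Y \<and> w j \<in> Z) \<and> w i @ w j @ w k \<in> {x @ y @ (x \<otimes> y) | x y. x \<in> B \<and> y \<in> B})"
    by (intro block_definable_conj block_definable_mem block_definable_mem3
        definable_mult_family B dU_definable assms)
  then show ?thesis
  proof (rule block_definable_cong)
    fix w :: "nat \<Rightarrow> 'm list"
    assume w: "\<And>i. length (w i) = n"
    have "x = w i \<and> y = w j \<and> x \<otimes> y = w k"
      if eq: "w i @ w j @ w k = x @ y @ (x \<otimes> y)" and xy: "x \<in> B" "y \<in> B" for x y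
    proof -
      have "length x = n" "length y = n" using xy BU length_carrier by auto
      then show ?thesis using eq w by simp
    qed
    then have "w i @ w j @ w k \<in> {x @ y @ (x \<otimes> y) | x y. x \<in> B \<and> y \<in> B} \<longleftrightarrow>
        w i \<in> B \<and> w j \<in> B \<and> w k = w i \<otimes> w j" by blast
    then show "((w i \<in> Y \<and> w j \<in> Z) \<and> w i @ w j @ w k \<in> {x @ y @ (x \<otimes> y) | x y. x \<in> B \<and> y \<in> B}) =
      (w i \<in> Y \<and> w j \<in> Z \<and> w k = w i \<otimes> w j)"
      using B(2) by blast
  qed
qed

lemma bd_fix:
  assumes "bd Q" "length c = n"
  shows "bd (\<lambda>w. Q (w(i := c)))"
proof -
  have "bd (\<lambda>w. Q (\<lambda>k. case (if k = i then Inr c else Inl k) of Inl j \<Rightarrow> w j | Inr c \<Rightarrow> c))"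
    by (rule block_definable_subst[OF assms(1)]) (use assms(2) in \<open>auto split: if_splits\<close>)
  moreover have "(\<lambda>k. case (if k = i then Inr c else Inl k) of Inl j \<Rightarrow> w j | Inr c \<Rightarrow> c) = w(i := c)"
    for w :: "nat \<Rightarrow> 'm list" by (auto simp: fun_eq_iff)
  ultimately show ?thesis by simp
qed

lemma dU_I:
  assumes "bd Q" "Y = {x \<in> tuples n. Q (\<lambda>_. x)}" "Y \<subseteq> carrier U"
  shows "dU Y"
  using definable_if_block_definable[OF assms(1)] assms by (simp add: definable_in_def)

lemma bd_mem_mult:
  assumes "dU Y" "dU Z" "definable M n D"
  shows "bd (\<lambda>w. w i \<in> Y \<and> w j \<in> Z \<and> w i \<otimes> w j \<in> D)"
proof -
  define k where "k = Suc (i + j)"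
  have k: "k \<noteq> i" "k \<noteq> j" by (auto simp: k_def)
  have "bd (\<lambda>w. (w i \<in> Y \<and> w j \<in> Z \<and> w k = w i \<otimes> w j) \<and> w k \<in> D)"
    by (intro block_definable_conj[OF bd_mult] block_definable_mem assms)
  from block_definable_ex[OF this, of k] show ?thesis
    by (rule block_definable_cong)
      (use k dU_carrier[OF assms(1)] dU_carrier[OF assms(2)] in \<open>auto intro!: length_carrier\<close>)
qed

lemma dU_set_mult:
  assumes "dU Y" "dU Z"
  shows "dU (Y <#> Z)"
proof -
  have "bd (\<lambda>w. w 1 \<in> Y \<and> w 2 \<in> Z \<and> w 0 = w 1 \<otimes> w 2)"
    by (rule bd_mult[OF assms])
  from block_definable_ex[OF block_definable_ex[OF this, of 2], of 1]
  have "bd (\<lambda>w. \<exists>a. length a = n \<and> (\<exists>b. length b = n \<and> a \<in> Y \<and> b \<in> Z \<and> w 0 = a \<otimes> b))"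
    by simp
  then show ?thesis
  proof (rule dU_I)
    show "Y <#> Z = {x \<in> tuples n. \<exists>a. length a = n \<and> (\<exists>b. length b = n \<and> a \<in> Y \<and> b \<in> Z \<and> x = a \<otimes> b)}"
      (is "_ = ?R")
    proof
      show "Y <#> Z \<subseteq> ?R"
      proof
        fix x assume "x \<in> Y <#> Z"
        then obtain a b where ab: "a \<in> Y" "b \<in> Z" "x = a \<otimes> b" by (auto simp: set_mult_def)
        then have "a \<in> carrier U" "b \<in> carrier U" "x \<in> carrier U"
          using dU_carrier[OF assms(1)] dU_carrier[OF assms(2)] by auto
        then show "x \<in> ?R" using ab length_carrier unfolding tuples_def by blast
      qed
    qed (auto simp: set_mult_def)
  qed (use dU_carrier[OF assms(1)] dU_carrier[OF assms(2)] in \<open>auto simp: set_mult_def\<close>)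
qed

lemma dU_singleton:
  assumes "g \<in> carrier U" shows "dU {g}"
proof -
  obtain B where B: "B \<in> \<X>" "g \<in> B" using assms carrier_family by auto
  obtain B' where B': "B' \<in> \<X>" "\<one> \<in> B'" using one_closed carrier_family by auto
  have "bd (\<lambda>w. w 1 \<in> B \<and> w 2 \<in> B' \<and> w 0 = w 1 \<otimes> w 2)"
    by (rule bd_mult) (use B B' dU_family in auto)
  \<comment> \<open>Equality with \<open>g\<close> is read off from the graph of multiplication as
    \<open>w 0 = g \<otimes> \<one>\<close>.\<close>
  from bd_fix[OF bd_fix[OF this, of \<one> 2], of g 1]
  have "bd (\<lambda>w. w 0 = g)" using assms B B' length_carrier by auto
  then show ?thesis by (rule dU_I) (use assms in \<open>auto simp: tuples_def length_carrier\<close>)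
qed

lemma dU_translate:
  assumes "g \<in> carrier U" "dU Y"
  shows "dU (g <# Y)"
proof -
  have "g <# Y = {g} <#> Y" by (auto simp: l_coset_def set_mult_def)
  then show ?thesis using dU_set_mult[OF dU_singleton[OF assms(1)] assms(2)] by simp
qed

text \<open>The relation \<open>x \<otimes> y = \<one>\<close> is definable only for
  \<open>x\<close> in a fixed member \<open>B\<close> of \<open>\<X>\<close>, and it is not evident
  that one \<open>B\<close> contains the inverses of all elements of \<open>Y\<close>. The elements
  of \<open>Y\<close> with inverse in \<open>B\<close> form a definable set \<open>I B\<close>;
  these sets cover \<open>Y\<close>, so compactness and directedness provide a common
  \<open>B\<close>.\<close>

lemma dU_inverse:
  assumes "dU Y"
  shows "dU (m_inv U ` Y)"
proof -
  have YU: "Y \<subseteq> carrier U" by (rule dU_carrier[OF assms])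
  define I where "I B = {y \<in> Y. \<exists>x\<in>B. x \<otimes> y = \<one>}" for B
  have I_bd: "bd (\<lambda>w. w 0 \<in> B \<and> w 1 \<in> Y \<and> w 0 \<otimes> w 1 \<in> {\<one>})" if "B \<in> \<X>" for B
    by (rule bd_mem_mult) (use that dU_family assms dU_definable dU_singleton in auto)
  have I: "definable M n (I B)" if B: "B \<in> \<X>" for B
  proof -
    have "bd (\<lambda>w. \<exists>a. length a = n \<and> a \<in> B \<and> w 1 \<in> Y \<and> a \<otimes> w 1 \<in> {\<one>})"
      using block_definable_ex[OF I_bd[OF B], of 0] by simp
    then have "dU (I B)"
      by (rule dU_I) (use YU dU_carrier[OF dU_family[OF B]] in
        \<open>auto simp: I_def tuples_def subset_iff intro!: length_carrier\<close>)
    then show ?thesis by (rule dU_definable)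
  qed
  have "Y \<subseteq> \<Union>(I ` \<X>)"
  proof
    fix y assume y: "y \<in> Y"
    then have "inv y \<in> carrier U" using YU by auto
    then obtain B where "B \<in> \<X>" "inv y \<in> B" using carrier_family by auto
    moreover have "inv y \<otimes> y = \<one>" using y YU by (intro l_inv) auto
    ultimately show "y \<in> \<Union>(I ` \<X>)" using y by (auto simp: I_def)
  qed
  then obtain C0 where C0: "C0 \<subseteq> I ` \<X>" "finite C0" "Y \<subseteq> \<Union>C0"
    by (rule definable_cover[OF dU_definable[OF assms] small_image[OF small_family, of I], rotated])
      (use I in auto)
  obtain C1 where C1: "C1 \<subseteq> \<X>" "finite C1" "C0 = I ` C1"
    using finite_subset_image[OF C0(2,1)] by auto
  obtain B where B: "B \<in> \<X>" "\<Union>C1 \<subseteq> B" using finite_family_bounded[OF C1(2,1)] by blast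
  have BU: "B \<subseteq> carrier U" using B(1) carrier_family by auto
  have inv: "inv y \<in> B" if y: "y \<in> Y" for y
  proof -
    obtain B' x where "B' \<in> C1" "x \<in> B'" "x \<otimes> y = \<one>" using C0(3) C1(3) y by (auto simp: I_def)
    then have "x \<in> B" using B(2) by auto
    then have "inv y = x" using \<open>x \<otimes> y = \<one>\<close> y YU BU by (intro inv_equality) auto
    then show ?thesis using \<open>x \<in> B\<close> by simp
  qed
  have "bd (\<lambda>w. \<exists>a. length a = n \<and> w 0 \<in> B \<and> a \<in> Y \<and> w 0 \<otimes> a \<in> {\<one>})"
    using block_definable_ex[OF I_bd[OF B(1)], of 1] by simp
  then show ?thesis
  proof (rule dU_I)
    show "m_inv U ` Y = {x \<in> tuples n. \<exists>a. length a = n \<and> x \<in> B \<and> a \<in> Y \<and> x \<otimes> a \<in> {\<one>}}"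
      (is "_ = ?R")
    proof
      show "m_inv U ` Y \<subseteq> ?R"
      proof
        fix x assume "x \<in> m_inv U ` Y"
        then obtain y where y: "y \<in> Y" "x = inv y" by auto
        then have "y \<in> carrier U" "x \<in> carrier U" using YU by auto
        then show "x \<in> ?R" using y inv[OF y(1)] length_carrier
          by (auto simp: tuples_def intro!: exI[of _ y])
      qed
      show "?R \<subseteq> m_inv U ` Y"
      proof
        fix x assume "x \<in> ?R"
        then obtain a where a: "x \<in> B" "a \<in> Y" "x \<otimes> a = \<one>" by auto
        then have "inv a = x" using YU BU by (intro inv_equality) auto
        then show "x \<in> m_inv U ` Y" using a(2) by auto
      qed
    qed
  qed (use YU in auto)
qed

end

section \<open>Genericity\<close>

context vee_group
begin

lemma l_coset_mono: "A \<subseteq> B \<Longrightarrow> g <# A \<subseteq> g <# B"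
  by (auto simp: l_coset_def)

lemma set_multI: "a \<in> A \<Longrightarrow> b \<in> B \<Longrightarrow> a \<otimes> b \<in> A <#> B"
  by (auto simp: set_mult_def)

lemma mem_l_coset_iff:
  assumes "g \<in> carrier U" "W \<subseteq> carrier U" "x \<in> carrier U"
  shows "x \<in> g <# W \<longleftrightarrow> inv g \<otimes> x \<in> W"
proof
  assume "x \<in> g <# W"
  then obtain w where "w \<in> W" "x = g \<otimes> w" by (auto simp: l_coset_def)
  then show "inv g \<otimes> x \<in> W" using assms by (auto simp: subset_iff m_assoc[symmetric])
next
  assume "inv g \<otimes> x \<in> W"
  moreover have "x = g \<otimes> (inv g \<otimes> x)" using assms by (simp add: m_assoc[symmetric])
  ultimately show "x \<in> g <# W" by (auto simp: l_coset_def)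
qed

lemma l_coset_carrier: "g \<in> carrier U \<Longrightarrow> W \<subseteq> carrier U \<Longrightarrow> g <# W \<subseteq> carrier U"
  by (auto simp: l_coset_def)

lemma l_coset_l_coset:
  "g \<in> carrier U \<Longrightarrow> h \<in> carrier U \<Longrightarrow> W \<subseteq> carrier U \<Longrightarrow> g <# (h <# W) = (g \<otimes> h) <# W"
  by (rule lcos_m_assoc)

lemma l_coset_sym_diff:
  assumes "g \<in> carrier U" "A \<subseteq> carrier U" "B \<subseteq> carrier U"
  shows "g <# sym_diff A B = sym_diff (g <# A) (g <# B)"
proof -
  have *: "x \<in> g <# sym_diff A B \<longleftrightarrow> x \<in> sym_diff (g <# A) (g <# B)" if x: "x \<in> carrier U" for x
  proof -
    have "sym_diff A B \<subseteq> carrier U" using assms by auto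
    then show ?thesis using assms x by (simp add: mem_l_coset_iff)
  qed
  have "g <# sym_diff A B \<subseteq> carrier U" "sym_diff (g <# A) (g <# B) \<subseteq> carrier U"
    using assms l_coset_carrier[OF assms(1,2)] l_coset_carrier[OF assms(1,3)]
      l_coset_carrier[OF assms(1), of "sym_diff A B"] by auto
  then show ?thesis using * by blast
qed

text \<open>Fixing the number \<open>k\<close> makes the condition first order, whence
  \<open>dU_covers_by\<close>; genericity itself is only a disjunction over all
  \<open>k\<close>.\<close>

definition covers_by :: "nat \<Rightarrow> 'm list set \<Rightarrow> 'm list set \<Rightarrow> bool" where
  "covers_by k W X \<longleftrightarrow> (\<exists>h. (\<forall>i<k. h i \<in> carrier U) \<and> X \<subseteq> (\<Union>i<k. h i <# W))"

definition covers :: "'m list set \<Rightarrow> 'm list set \<Rightarrow> bool" where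
  "covers W X \<longleftrightarrow> (\<exists>S. finite S \<and> S \<subseteq> carrier U \<and> X \<subseteq> (\<Union>s\<in>S. s <# W))"

lemma covers_iff: "covers W X \<longleftrightarrow> (\<exists>k. covers_by k W X)"
proof
  assume "covers W X"
  then obtain S where S: "finite S" "S \<subseteq> carrier U" "X \<subseteq> (\<Union>s\<in>S. s <# W)"
    unfolding covers_def by blast
  from finite_list[OF S(1)] obtain l where l: "set l = S" ..
  have cov: "X \<subseteq> (\<Union>i<length l. (l ! i) <# W)"
  proof
    fix x assume "x \<in> X"
    then obtain s where "s \<in> set l" "x \<in> s <# W" using S(3) l by auto
    then show "x \<in> (\<Union>i<length l. (l ! i) <# W)" by (auto simp: in_set_conv_nth)
  qed
  have "\<forall>i<length l. l ! i \<in> carrier U"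
    by (intro allI impI subsetD[OF S(2)[folded l]] nth_mem)
  then have "covers_by (length l) W X"
    unfolding covers_by_def using cov by (rule_tac exI[of _ "nth l"]) (rule conjI)
  then show "\<exists>k. covers_by k W X" ..
next
  assume "\<exists>k. covers_by k W X"
  then obtain k where "covers_by k W X" ..
  then obtain h where "\<forall>i<k. h i \<in> carrier U" "X \<subseteq> (\<Union>i<k. h i <# W)"
    unfolding covers_by_def by blast
  then show "covers W X" unfolding covers_def by (intro exI[of _ "h ` {..<k}"]) auto
qed

lemma covers_by_mono:
  assumes "covers_by k W X" "k \<le> l"
  shows "covers_by l W X"
proof -
  obtain h where h: "\<forall>i<k. h i \<in> carrier U" "X \<subseteq> (\<Union>i<k. h i <# W)"
    using assms unfolding covers_by_def by blast
  have "X \<subseteq> (\<Union>i<l. (if i < k then h i else \<one>) <# W)"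
  proof
    fix x assume "x \<in> X"
    then obtain i where "i < k" "x \<in> h i <# W" using h by auto
    then show "x \<in> (\<Union>i<l. (if i < k then h i else \<one>) <# W)"
      using assms(2) by (intro UN_I[of i]) auto
  qed
  then show ?thesis using h unfolding covers_by_def
    by (intro exI[of _ "\<lambda>i. if i < k then h i else \<one>"]) auto
qed

lemma covers_by_translate:
  assumes "covers_by k (g <# W) X" "g \<in> carrier U" "W \<subseteq> carrier U"
  shows "covers_by k W X"
proof -
  obtain h where h: "\<forall>i<k. h i \<in> carrier U" "X \<subseteq> (\<Union>i<k. h i <# (g <# W))"
    using assms unfolding covers_by_def by blast
  then have "X \<subseteq> (\<Union>i<k. (h i \<otimes> g) <# W)" using assms by (simp add: l_coset_l_coset)
  then show ?thesis using h assms unfolding covers_by_def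
    by (intro exI[of _ "\<lambda>i. h i \<otimes> g"]) auto
qed

lemma generic_iff:
  "generic \<kappa> M n U W \<longleftrightarrow>
    dU W \<and> (\<exists>S \<subseteq> carrier U. small \<kappa> S \<and> carrier U \<subseteq> (\<Union>g\<in>S. g <# W))"
proof -
  have "W #> g = g <# W" if "g \<in> carrier U" "dU W" for g
    using that dU_carrier[of W] by (auto simp: l_coset_def r_coset_def m_comm subset_iff)
  then have "(\<Union>g\<in>S. W #> g) = (\<Union>g\<in>S. g <# W)" if "S \<subseteq> carrier U" "dU W" for S
    using that by (intro SUP_cong) auto
  then show ?thesis unfolding generic_def by metis
qed

lemma generic_dU: "generic \<kappa> M n U W \<Longrightarrow> dU W"
  by (simp add: generic_iff)

lemma generic_superset:
  assumes "generic \<kappa> M n U W" "W \<subseteq> V" "dU V"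
  shows "generic \<kappa> M n U V"
proof -
  obtain S where "S \<subseteq> carrier U" "small \<kappa> S" "carrier U \<subseteq> (\<Union>g\<in>S. g <# W)"
    using assms unfolding generic_iff by blast
  moreover have "(\<Union>g\<in>S. g <# W) \<subseteq> (\<Union>g\<in>S. g <# V)"
    by (intro UN_mono l_coset_mono assms order_refl)
  ultimately show ?thesis using assms(3) unfolding generic_iff by (meson order_trans)
qed

text \<open>By saturation, a small cover of the definable set \<open>Y\<close> by definable
  translates has a finite subcover.\<close>

lemma generic_covers:
  assumes "generic \<kappa> M n U W" "dU Y"
  shows "covers W Y"
proof -
  obtain S where S: "S \<subseteq> carrier U" "small \<kappa> S" "carrier U \<subseteq> (\<Union>g\<in>S. g <# W)"
    using assms unfolding generic_iff by blast
  obtain C0 where C0: "C0 \<subseteq> (\<lambda>g. g <# W) ` S" "finite C0" "Y \<subseteq> \<Union>C0"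
  proof (rule definable_cover[OF dU_definable[OF assms(2)] small_image[OF S(2)]])
    show "definable M n D" if "D \<in> (\<lambda>g. g <# W) ` S" for D
      using that S(1) generic_dU[OF assms(1)] dU_translate dU_definable by blast
    show "Y \<subseteq> \<Union> ((\<lambda>g. g <# W) ` S)" using S(3) dU_carrier[OF assms(2)] by auto
  qed
  obtain S0 where "S0 \<subseteq> S" "finite S0" "C0 = (\<lambda>g. g <# W) ` S0"
    using finite_subset_image[OF C0(2,1)] by auto
  then show ?thesis using C0(3) S(1) unfolding covers_def by (intro exI[of _ S0]) auto
qed

lemma covers_generic:
  assumes "covers W X" "generic \<kappa> M n U X" "dU W"
  shows "generic \<kappa> M n U W"
proof -
  obtain S where S: "S \<subseteq> carrier U" "small \<kappa> S" "carrier U \<subseteq> (\<Union>g\<in>S. g <# X)"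
    using assms unfolding generic_iff by blast
  obtain T where T: "finite T" "T \<subseteq> carrier U" "X \<subseteq> (\<Union>t\<in>T. t <# W)"
    using assms(1) unfolding covers_def by blast
  have WU: "W \<subseteq> carrier U" by (rule dU_carrier[OF assms(3)])
  let ?R = "(\<lambda>(s, t). s \<otimes> t) ` (S \<times> T)"
  have "small \<kappa> ?R" by (intro small_image small_Times S small_finite T)
  moreover have "?R \<subseteq> carrier U" using S T by auto
  moreover have "carrier U \<subseteq> (\<Union>g\<in>?R. g <# W)"
  proof
    fix u assume "u \<in> carrier U"
    then obtain s x where sx: "s \<in> S" "x \<in> X" "u = s \<otimes> x" using S(3) by (auto simp: l_coset_def)
    then obtain t w where tw: "t \<in> T" "w \<in> W" "x = t \<otimes> w" using T(3) by (auto simp: l_coset_def)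
    have "s \<in> carrier U" "t \<in> carrier U" "w \<in> carrier U" using sx tw S T WU by auto
    then have "u = (s \<otimes> t) \<otimes> w" using sx tw by (simp add: m_assoc)
    then show "u \<in> (\<Union>g\<in>?R. g <# W)" using sx tw by (auto simp: l_coset_def)
  qed
  ultimately show ?thesis using assms(3) unfolding generic_iff by blast
qed

lemma generic_iff_covers:
  assumes "generic \<kappa> M n U X" "dU W"
  shows "generic \<kappa> M n U W \<longleftrightarrow> (\<exists>k. covers_by k W X)"
  using generic_covers[OF _ generic_dU[OF assms(1)]] covers_generic[OF _ assms] covers_iff by blast

lemma generic_translate:
  assumes "generic \<kappa> M n U W" "g \<in> carrier U"
  shows "generic \<kappa> M n U (g <# W)"
proof (rule covers_generic[OF _ assms(1)])
  have WU: "W \<subseteq> carrier U" using generic_dU[OF assms(1)] by (rule dU_carrier)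
  have "W \<subseteq> inv g <# (g <# W)" using assms(2) WU by (simp add: l_coset_l_coset lcos_mult_one)
  then show "covers (g <# W) W" using assms(2) unfolding covers_def by (intro exI[of _ "{inv g}"]) auto
  show "dU (g <# W)" by (rule dU_translate[OF assms(2) generic_dU[OF assms(1)]])
qed

lemma bd_ex_less:
  "(\<And>i. i < k \<Longrightarrow> bd (Q i)) \<Longrightarrow> bd (\<lambda>w. \<exists>i<k. Q i w)" for k :: nat
proof (induction k)
  case 0
  have "bd (\<lambda>w. w 0 \<in> tuples n - tuples n)"
    by (intro block_definable_mem definable_diff definable_tuples)
  then show ?case by simp
next
  case (Suc k)
  have "bd (\<lambda>w. (\<exists>i<k. Q i w) \<or> Q k w)"
    by (intro block_definable_disj Suc) simp_all
  then show ?case by (rule block_definable_cong) (auto simp: less_Suc_eq)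
qed

lemma bd_mem_l_coset:
  assumes "dU Y" "dU T" "dU X"
  shows "bd (\<lambda>w. w i \<in> Y \<and> w j \<in> T \<and> w k \<in> X \<and> w j \<otimes> w k \<in> w i <# X)"
proof -
  define p q where "p = Suc (i + j + k)" "q = Suc (Suc (i + j + k))"
  have pq: "p \<noteq> i" "p \<noteq> j" "p \<noteq> k" "q \<noteq> i" "q \<noteq> j" "q \<noteq> k" "p \<noteq> q" by (auto simp: p_q_def)
  have "bd (\<lambda>w. (w j \<in> T \<and> w k \<in> X \<and> w p = w j \<otimes> w k) \<and> (w i \<in> Y \<and> w q \<in> X \<and> w p = w i \<otimes> w q))"
    by (intro block_definable_conj[OF bd_mult bd_mult] assms)
  from block_definable_ex[OF block_definable_ex[OF this, of p], of q] show ?thesis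
  proof (rule block_definable_cong)
    fix w :: "nat \<Rightarrow> 'm list"
    show "(\<exists>a. length a = n \<and> (\<exists>b. length b = n \<and>
        ((w(q := a, p := b)) j \<in> T \<and> (w(q := a, p := b)) k \<in> X \<and>
          (w(q := a, p := b)) p = (w(q := a, p := b)) j \<otimes> (w(q := a, p := b)) k) \<and>
        (w(q := a, p := b)) i \<in> Y \<and> (w(q := a, p := b)) q \<in> X \<and>
          (w(q := a, p := b)) p = (w(q := a, p := b)) i \<otimes> (w(q := a, p := b)) q)) =
      (w i \<in> Y \<and> w j \<in> T \<and> w k \<in> X \<and> w j \<otimes> w k \<in> w i <# X)" (is "?L = ?R")
    proof
      assume ?L
      then show ?R using pq by (auto simp: l_coset_def)
    next
      assume R: ?R
      then obtain a where a: "a \<in> X" "w j \<otimes> w k = w i \<otimes> a" by (auto simp: l_coset_def)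
      have "a \<in> carrier U" "w i \<in> carrier U"
        using a R dU_carrier[OF assms(1)] dU_carrier[OF assms(3)] by auto
      then have "length a = n" "length (w i \<otimes> a) = n" by (auto intro: length_carrier)
      then show ?L using R a pq by (intro exI[of _ a] conjI exI[of _ "w i \<otimes> a"]) auto
    qed
  qed
qed

text \<open>The obstacle is that translating elements range over \<open>U\<close>, which need not be
  definable. If \<open>x\<close> in \<open>X\<close> lies in \<open>h <# W\<close>, where
  \<open>W\<close> is the symmetric difference, then
  \<open>inv h = (inv h \<otimes> x) \<otimes> inv x\<close> lies in the definable set
  \<open>T\<close>; all other translates miss \<open>X\<close>. So the quantified elements stand for
  inverses of translating elements, and only those in \<open>T\<close> count.\<close>

lemma dU_covers_by:
  assumes "dU X" "dU Y"
  shows "dU {g \<in> Y. covers_by k (sym_diff (g <# X) X) X}"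
proof -
  have XU: "X \<subseteq> carrier U" and YU: "Y \<subseteq> carrier U" using assms by (auto dest: dU_carrier)
  define T where "T = ((Y <#> X) \<union> X) <#> (m_inv U ` X)"
  have T: "dU T" unfolding T_def by (intro dU_set_mult dU_Un dU_inverse assms)
  have TU: "T \<subseteq> carrier U" by (rule dU_carrier[OF T])
  define C where "C g x h \<longleftrightarrow> h \<in> T \<and> h \<otimes> x \<in> sym_diff (g <# X) X" for g x h
  \<comment> \<open>Block 0 holds the group element, block 1 the point of \<open>X\<close> to be
    covered, and the blocks from 2 on the inverses of the translating elements.\<close>
  have "bd (\<lambda>w. w 0 \<in> Y \<and> w 1 \<in> X \<and> C (w 0) (w 1) (w (2 + i)))" for i
  proof -
    have "bd (\<lambda>w. (w 0 \<in> Y \<and> w (2 + i) \<in> T \<and> w 1 \<in> X \<and> w (2 + i) \<otimes> w 1 \<in> w 0 <# X) \<and>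
        \<not> (w (2 + i) \<in> T \<and> w 1 \<in> X \<and> w (2 + i) \<otimes> w 1 \<in> X) \<or>
        (w 0 \<in> Y \<and> (w (2 + i) \<in> T \<and> w 1 \<in> X \<and> w (2 + i) \<otimes> w 1 \<in> X)) \<and>
        \<not> (w 0 \<in> Y \<and> w (2 + i) \<in> T \<and> w 1 \<in> X \<and> w (2 + i) \<otimes> w 1 \<in> w 0 <# X))"
      by (intro block_definable_disj block_definable_conj block_definable_not bd_mem_l_coset
          bd_mem_mult block_definable_mem dU_definable assms T)
    then show ?thesis by (rule block_definable_cong) (auto simp: C_def)
  qed
  then have "bd (\<lambda>w. \<exists>i<k. w 0 \<in> Y \<and> w 1 \<in> X \<and> C (w 0) (w 1) (w (2 + i)))"
    by (rule bd_ex_less)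
  then have "bd (\<lambda>w. w 1 \<in> X \<and> \<not> (\<exists>i<k. w 0 \<in> Y \<and> w 1 \<in> X \<and> C (w 0) (w 1) (w (2 + i))))"
    by (intro block_definable_conj block_definable_not block_definable_mem dU_definable assms)
  from block_definable_not[OF block_definable_ex[OF this, of 1]]
  have "bd (\<lambda>w. \<not> (\<exists>a. length a = n \<and> a \<in> X \<and> \<not> (\<exists>i<k. w 0 \<in> Y \<and> a \<in> X \<and> C (w 0) a (w (2 + i)))))"
    by simp
  from block_definable_ex_many[OF this, of k 2]
  have "bd (\<lambda>w. \<exists>h. (\<forall>i<k. length (h i) = n) \<and> \<not> (\<exists>a. length a = n \<and> a \<in> X \<and>
      \<not> (\<exists>i<k. w 0 \<in> Y \<and> a \<in> X \<and> C (w 0) a (h i))))"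
    by (rule block_definable_cong) (auto cong: conj_cong)
  then have "bd (\<lambda>w. w 0 \<in> Y \<and> (\<exists>h. (\<forall>i<k. length (h i) = n) \<and> \<not> (\<exists>a. length a = n \<and> a \<in> X \<and>
      \<not> (\<exists>i<k. w 0 \<in> Y \<and> a \<in> X \<and> C (w 0) a (h i)))))"
    by (intro block_definable_conj block_definable_mem dU_definable assms)
  then show ?thesis
  proof (rule dU_I)
    have cov: "covers_by k (sym_diff (g <# X) X) X \<longleftrightarrow>
      (\<exists>h. (\<forall>i<k. length (h i) = n) \<and> (\<forall>x\<in>X. \<exists>i<k. C g x (h i)))" if g: "g \<in> Y" for g
    proof -
      define W where "W = sym_diff (g <# X) X"
      have gU: "g \<in> carrier U" using g YU by auto
      have WU: "W \<subseteq> carrier U" using l_coset_carrier[OF gU XU] XU by (auto simp: W_def)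
      have W: "W \<subseteq> (Y <#> X) \<union> X" using g by (auto simp: W_def l_coset_def set_mult_def)
      show ?thesis unfolding C_def W_def[symmetric]
      proof
        assume "covers_by k W X"
        then obtain h where h: "\<forall>i<k. h i \<in> carrier U" "X \<subseteq> (\<Union>i<k. h i <# W)"
          unfolding covers_by_def by blast
        have "\<exists>i<k. inv (h i) \<in> T \<and> inv (h i) \<otimes> x \<in> W" if x: "x \<in> X" for x
        proof -
          obtain i where i: "i < k" "x \<in> h i <# W" using h x by auto
          have xU: "x \<in> carrier U" using x XU by auto
          have hU: "h i \<in> carrier U" using h i by auto
          have iW: "inv (h i) \<otimes> x \<in> W" using mem_l_coset_iff[OF hU WU xU] i by simp
          have "inv (h i) = (inv (h i) \<otimes> x) \<otimes> inv x" using xU hU by (simp add: m_assoc)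
          moreover have "inv (h i) \<otimes> x \<in> (Y <#> X) \<union> X" using iW W by (rule_tac subsetD)
          ultimately have "inv (h i) \<in> T"
            using x set_multI[of "inv (h i) \<otimes> x" "(Y <#> X) \<union> X" "inv x" "m_inv U ` X"]
            unfolding T_def by simp
          then show ?thesis using i iW by blast
        qed
        then show "\<exists>h. (\<forall>i<k. length (h i) = n) \<and> (\<forall>x\<in>X. \<exists>i<k. h i \<in> T \<and> h i \<otimes> x \<in> W)"
          using h(1) by (intro exI[of _ "\<lambda>i. inv (h i)"]) (auto simp: length_carrier)
      next
        assume "\<exists>h. (\<forall>i<k. length (h i) = n) \<and> (\<forall>x\<in>X. \<exists>i<k. h i \<in> T \<and> h i \<otimes> x \<in> W)"
        then obtain h where h: "\<forall>x\<in>X. \<exists>i<k. h i \<in> T \<and> h i \<otimes> x \<in> W" by blast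
        \<comment> \<open>Entries outside \<open>T\<close> are arbitrary tuples that cover nothing,
          so any group element may replace them.\<close>
        define h' where "h' i = (if h i \<in> T then inv (h i) else \<one>)" for i
        have h'U: "h' i \<in> carrier U" for i using TU by (auto simp: h'_def)
        have "x \<in> (\<Union>i<k. h' i <# W)" if x: "x \<in> X" for x
        proof -
          obtain i where i: "i < k" "h i \<in> T" "h i \<otimes> x \<in> W" using h x by blast
          have "h i \<in> carrier U" "x \<in> carrier U" using i TU x XU by auto
          then have "x \<in> h' i <# W" using i h'U mem_l_coset_iff[OF h'U WU, of x i] by (simp add: h'_def)
          then show ?thesis using i(1) by blast
        qed
        then show "covers_by k W X" unfolding covers_by_def using h'U by blast
      qed
    qed
    have C: "(\<forall>x\<in>X. \<exists>i<k. C g x (h i)) \<longleftrightarrow>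
      \<not> (\<exists>a. length a = n \<and> a \<in> X \<and> \<not> (\<exists>i<k. g \<in> Y \<and> a \<in> X \<and> C g a (h i)))" if "g \<in> Y" for g h
      using that XU length_carrier by blast
    show "{g \<in> Y. covers_by k (sym_diff (g <# X) X) X} = {x \<in> tuples n. x \<in> Y \<and>
      (\<exists>h. (\<forall>i<k. length (h i) = n) \<and> \<not> (\<exists>a. length a = n \<and> a \<in> X \<and>
       \<not> (\<exists>i<k. x \<in> Y \<and> a \<in> X \<and> C x a (h i))))}"
    proof (intro Collect_cong)
      fix g
      have "g \<in> Y \<Longrightarrow> g \<in> tuples n" using YU carrier_tuples by auto
      then show "(g \<in> Y \<and> covers_by k (sym_diff (g <# X) X) X) = (g \<in> tuples n \<and> g \<in> Y \<and>
        (\<exists>h. (\<forall>i<k. length (h i) = n) \<and> \<not> (\<exists>a. length a = n \<and> a \<in> X \<and>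
         \<not> (\<exists>i<k. g \<in> Y \<and> a \<in> X \<and> C g a (h i)))))"
        by (cases "g \<in> Y") (simp_all only: cov C simp_thms)
    qed
  qed (use YU in auto)
qed

end

section \<open>Consequences of NIP\<close>

text \<open>A strictly increasing sequence of \<open>r\<close> naturals amounts to a set of size
  \<open>r\<close>, so Ramsey's theorem for sets applies. This finite homogeneity does the work of
  an indiscernible sequence.\<close>

lemma Ramsey_sequence:
  fixes col :: "(nat \<Rightarrow> nat) \<Rightarrow> 'c"
  assumes "finite C" "\<And>s. col s \<in> C" "\<And>s t. (\<And>i. i < r \<Longrightarrow> s i = t i) \<Longrightarrow> col s = col t"
  obtains u :: "nat \<Rightarrow> nat" and c where "strict_mono u" "\<forall>s. strict_mono_on {..<r} s \<longrightarrow> col (u \<circ> s) = c"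
proof -
  obtain e :: "'c \<Rightarrow> nat" and m where e: "e ` C = {i. i < m}" "inj_on e C"
    using finite_imp_inj_to_nat_seg[OF assms(1)] by auto
  define f where "f X = e (col (\<lambda>i. sorted_list_of_set X ! i))" for X
  have "\<forall>X. X \<subseteq> (UNIV :: nat set) \<and> finite X \<and> card X = r \<longrightarrow> f X < m"
    using e(1) assms(2) by (auto simp: f_def)
  from Ramsey[OF infinite_UNIV_nat this] obtain Y t where Y: "infinite Y"
    "\<And>X. X \<subseteq> Y \<Longrightarrow> finite X \<Longrightarrow> card X = r \<Longrightarrow> f X = t" by auto
  define u where "u = enumerate Y"
  have u: "strict_mono u" unfolding u_def using Y(1) by (simp add: strict_mono_def)
  have "e (col (u \<circ> s)) = t" if s: "strict_mono_on {..<r} s" for s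
  proof -
    define X where "X = (u \<circ> s) ` {..<r}"
    have us: "(u \<circ> s) i < (u \<circ> s) j" if "i < j" "j < r" for i j
      using strict_mono_onD[OF s, of i j] that u by (simp add: strict_mono_def)
    have sl: "sorted_list_of_set X = map (u \<circ> s) [0..<r]"
      by (rule strict_sorted_equal[symmetric])
        (use us in \<open>auto simp: X_def sorted_wrt_iff_nth_less[of _ "map _ _"] comp_def\<close>)
    have "inj_on (u \<circ> s) {..<r}"
      by (rule linorder_inj_onI) (use us in \<open>fastforce simp: comp_def\<close>)+
    then have "card X = r" by (simp only: X_def card_image card_lessThan)
    moreover have "X \<subseteq> Y" using enumerate_in_set[OF Y(1)] by (auto simp: X_def u_def)
    ultimately have "f X = t" by (intro Y(2)) (auto simp: X_def)
    moreover have "col (\<lambda>i. sorted_list_of_set X ! i) = col (u \<circ> s)"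
      by (rule assms(3)) (simp add: sl)
    ultimately show ?thesis by (simp add: f_def)
  qed
  then have "col (u \<circ> s) = the_inv_into C e t" if "strict_mono_on {..<r} s" for s
    using the_inv_into_f_f[OF e(2) assms(2)[of "u \<circ> s"]] that by auto
  then show ?thesis using that[OF u] by blast
qed

text \<open>The pairs \<open>(u (2 i), u (2 i + 1))\<close> separated by a point play the role of alternations
  along an indiscernible sequence: by homogeneity, one member of each of \<open>d\<close> such pairs could
  be replaced by a prescribed index, so that \<open>d\<close> indices would be shattered.\<close>

lemma bounded_alternation:
  fixes P :: "nat \<Rightarrow> 'x \<Rightarrow> bool" and d :: nat
  assumes noshatter: "\<And>a. \<exists>S\<subseteq>{..<d}. \<not> (\<exists>x\<in>A. \<forall>j<d. P (a j) x \<longleftrightarrow> j \<in> S)"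
  obtains u :: "nat \<Rightarrow> nat" where "strict_mono u"
    "\<forall>x\<in>A. \<forall>K. card {i. i < K \<and> P (u (2 * i)) x \<noteq> P (u (2 * i + 1)) x} \<le> d"
proof -
  \<comment> \<open>Homogeneity for this colour transfers a truth pattern realized along one
    increasing \<open>2 d\<close>-tuple of indices to every other one.\<close>
  define col where "col s = {\<sigma>. \<sigma> \<subseteq> {..<2 * d} \<and> (\<exists>x\<in>A. \<forall>m<2 * d. P (s m) x \<longleftrightarrow> m \<in> \<sigma>)}" for s
  have c1: "finite (Pow (Pow {..<2 * d}))" by simp
  have c2: "col s \<in> Pow (Pow {..<2 * d})" for s by (auto simp: col_def)
  have c3: "col s = col t" if "\<And>i. i < 2 * d \<Longrightarrow> s i = t i" for s t
    using that unfolding col_def by simp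
  obtain u :: "nat \<Rightarrow> nat" and c where u: "strict_mono u" "\<forall>s. strict_mono_on {..<2 * d} s \<longrightarrow> col (u \<circ> s) = c"
    by (rule Ramsey_sequence[OF c1 c2 c3])
  have "card {i. i < K \<and> P (u (2 * i)) x \<noteq> P (u (2 * i + 1)) x} \<le> d" if x: "x \<in> A" for x K
  proof (rule ccontr)
    define I0 where "I0 = {i. i < K \<and> P (u (2 * i)) x \<noteq> P (u (2 * i + 1)) x}"
    assume "\<not> card {i. i < K \<and> P (u (2 * i)) x \<noteq> P (u (2 * i + 1)) x} \<le> d"
    then have "d \<le> card I0" by (simp add: I0_def)
    from obtain_subset_with_card_n[OF this] obtain I where I: "I \<subseteq> I0" "card I = d" "finite I" by blast
    define e where "e j = sorted_list_of_set I ! j" for j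
    have e_mono: "e i < e j" if "i < j" "j < d" for i j
      unfolding e_def using sorted_wrt_nth_less[OF strict_sorted_list_of_set that(1), of I] that I(2) by simp
    have e_in: "e j \<in> I0" if "j < d" for j
      unfolding e_def using nth_mem[of j "sorted_list_of_set I"] that I by auto
    define s where "s m = 2 * e (m div 2) + m mod 2" for m
    have s: "strict_mono_on {..<2 * d} s"
    proof (rule strict_mono_onI)
      fix m m' assume m: "m \<in> {..<2 * d}" "m' \<in> {..<2 * d}" "m < m'"
      show "s m < s m'"
      proof (cases "m div 2 = m' div 2")
        case True
        then have "m mod 2 < m' mod 2" 
          using m(3) div_mult_mod_eq[of m 2] div_mult_mod_eq[of m' 2] by linarith
        then show ?thesis using True by (simp add: s_def)
      next
        case False
        then have "m div 2 < m' div 2" "m' div 2 < d" using m by auto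
        then have "e (m div 2) < e (m' div 2)" by (rule e_mono)
        moreover have "m mod 2 < 2" by simp
        ultimately show ?thesis unfolding s_def by linarith
      qed
    qed
    define \<sigma> where "\<sigma> = {m. m < 2 * d \<and> P (u (s m)) x}"
    have "\<sigma> \<in> col (u \<circ> s)" unfolding col_def using x by (auto simp: \<sigma>_def)
    then have \<sigma>c: "\<sigma> \<in> c" using u(2) s by simp
    have alt: "(2 * j \<in> \<sigma>) \<noteq> (2 * j + 1 \<in> \<sigma>)" if j: "j < d" for j
    proof -
      have "s (2 * j) = 2 * e j" "s (2 * j + 1) = 2 * e j + 1" by (simp_all add: s_def)
      then show ?thesis using e_in[OF j] j by (auto simp: \<sigma>_def I0_def)
    qed
    have shatter: "\<exists>y\<in>A. \<forall>j<d. P (u (3 * j + 1)) y \<longleftrightarrow> j \<in> S" if S: "S \<subseteq> {..<d}" for S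
    proof -
      \<comment> \<open>Pair \<open>j\<close> is moved to \<open>(3 j + 1, 3 j + 2)\<close> or to
        \<open>(3 j, 3 j + 1)\<close>. As the pattern differs on the two members of the pair, one of
        these choices gives index \<open>3 j + 1\<close> the truth value that \<open>S\<close>
        prescribes.\<close>
      define s' where "s' m = (if (2 * (m div 2) \<in> \<sigma>) = (m div 2 \<in> S) then 3 * (m div 2) + 1 + m mod 2
        else 3 * (m div 2) + m mod 2)" for m
      have "strict_mono_on {..<2 * d} s'"
      proof (rule strict_mono_onI)
        fix m m' assume m: "m \<in> {..<2 * d}" "m' \<in> {..<2 * d}" "m < m'"
        show "s' m < s' m'"
        proof (cases "m div 2 = m' div 2")
          case True
          then have "m mod 2 < m' mod 2" 
          using m(3) div_mult_mod_eq[of m 2] div_mult_mod_eq[of m' 2] by linarith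
          then show ?thesis using True by (simp add: s'_def)
        next
          case False
          then have "m div 2 < m' div 2" using m by auto
          moreover have "s' m \<le> 3 * (m div 2) + 2"
            unfolding s'_def by (simp add: add_le_mono) linarith
          moreover have "3 * (m' div 2) \<le> s' m'" by (simp add: s'_def)
          ultimately show ?thesis by linarith
        qed
      qed
      then have "\<sigma> \<in> col (u \<circ> s')" using u(2) \<sigma>c by simp
      then obtain y where y: "y \<in> A" "\<And>m. m < 2 * d \<Longrightarrow> P (u (s' m)) y \<longleftrightarrow> m \<in> \<sigma>"
        by (auto simp: col_def)
      have "P (u (3 * j + 1)) y \<longleftrightarrow> j \<in> S" if j: "j < d" for j
      proof (cases "(2 * j \<in> \<sigma>) = (j \<in> S)")
        case True
        then have "s' (2 * j) = 3 * j + 1" by (simp add: s'_def)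
        then show ?thesis using y(2)[of "2 * j"] j True by simp
      next
        case False
        then have "s' (2 * j + 1) = 3 * j + 1" by (simp add: s'_def)
        then show ?thesis using y(2)[of "2 * j + 1"] j False alt[OF j] by simp
      qed
      then show ?thesis using y(1) by blast
    qed
    obtain S where S: "S \<subseteq> {..<d}" "\<not> (\<exists>x\<in>A. \<forall>j<d. P (u (3 * j + 1)) x \<longleftrightarrow> j \<in> S)"
      using noshatter[of "\<lambda>j. u (3 * j + 1)"] by (elim exE conjE)
    show False by (rule notE[OF S(2) shatter[OF S(1)]])
  qed
  then show ?thesis using that[OF u(1)] by blast
qed

text \<open>\<open>has_IP\<close> concerns formulas without parameters; the parameters
  \<open>c\<close> of \<open>R\<close> are therefore appended to every second tuple, which does not
  affect shattering.\<close>

lemma NIP_relation: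
  assumes "NIP M" "definable M (2 * n) R"
  obtains d :: nat where "\<And>a b. \<lbrakk>\<And>i. i < d \<Longrightarrow> length (a i) = n; \<And>S. S \<subseteq> {..<d} \<Longrightarrow> length (b S) = n;
    \<And>i S. i < d \<Longrightarrow> S \<subseteq> {..<d} \<Longrightarrow> a i @ b S \<in> R \<longleftrightarrow> i \<in> S\<rbrakk> \<Longrightarrow> False"
proof -
  obtain p c where p: "wf_form M p" "fv p \<subseteq> {..<2 * n + length c}"
    "R = {x \<in> tuples (2 * n). sat M (nth (x @ c)) p}"
    using assms(2) unfolding definable_over_def by blast
  have "fv p \<subseteq> {..<n + (n + length c)}" using p(2) by (simp add: mult_2 add.assoc)
  then have "\<not> has_IP M n (n + length c) p" using assms(1) p(1) unfolding NIP_def by blast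
  then obtain d where d: "\<not> (\<exists>(a :: nat \<Rightarrow> _ list) (b :: nat set \<Rightarrow> _ list).
       (\<forall>i<d. a i \<in> tuples n) \<and> (\<forall>S. S \<subseteq> {..<d} \<longrightarrow> b S \<in> tuples (n + length c)) \<and>
       (\<forall>i<d. \<forall>S. S \<subseteq> {..<d} \<longrightarrow> (sat M (nth (a i @ b S)) p \<longleftrightarrow> i \<in> S)))"
    unfolding has_IP_def by auto
  show ?thesis
  proof (rule that[of d])
    fix a b
    assume a: "\<And>i. i < d \<Longrightarrow> length (a i) = n" and b: "\<And>S. S \<subseteq> {..<d} \<Longrightarrow> length (b S) = n"
      and ab: "\<And>i S. i < d \<Longrightarrow> S \<subseteq> {..<d} \<Longrightarrow> a i @ b S \<in> R \<longleftrightarrow> i \<in> S"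
    have "sat M (nth (a i @ (b S @ c))) p \<longleftrightarrow> i \<in> S" if "i < d" "S \<subseteq> {..<d}" for i S
      using ab[OF that] a[OF that(1)] b[OF that(2)] unfolding p(3) by (simp add: tuples_def)
    then have "(\<forall>i<d. a i \<in> tuples n) \<and> (\<forall>S. S \<subseteq> {..<d} \<longrightarrow> b S @ c \<in> tuples (n + length c)) \<and>
       (\<forall>i<d. \<forall>S. S \<subseteq> {..<d} \<longrightarrow> (sat M (nth (a i @ (b S @ c))) p \<longleftrightarrow> i \<in> S))"
      using a b by (simp add: tuples_def)
    then show False
      by (rule_tac notE[OF d], rule_tac exI[of _ a], rule_tac exI[of _ "\<lambda>S. b S @ c"])
  qed
qed

text \<open>In contrast to \<^const>\<open>has_IP\<close>, here it is the parameters, occupying the variables from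
  \<open>n\<close> on, that cannot be shattered.\<close>

definition shatter_free ::
  "('f, 'r, 'm, 'z) fo_structure_scheme \<Rightarrow> nat \<Rightarrow> nat \<Rightarrow> ('f, 'r) fo_form \<Rightarrow> nat \<Rightarrow> bool" where
  "shatter_free M n m p d \<longleftrightarrow> (\<forall>a b. \<not> ((\<forall>i<d. length (a i) = m) \<and> (\<forall>S\<subseteq>{..<d}. length (b S) = n) \<and>
     (\<forall>i<d. \<forall>S\<subseteq>{..<d}. sat M (nth (b S @ a i)) p \<longleftrightarrow> i \<in> S)))"

text \<open>\<open>NIP M\<close> speaks of all formulas, in particular of \<open>p\<close> with its
  two groups of variables exchanged, which is \<open>q\<close>.\<close>

lemma NIP_shatter_free:
  assumes "NIP M" "wf_form M p" "fv p \<subseteq> {..<n + m}"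
  shows "\<exists>d. shatter_free M n m p d"
proof -
  define r where "r i = (if i < n then m + i else i - n)" for i
  define q where "q = rename r p"
  have "wf_form M q" using assms(2) by (simp add: q_def wf_rename)
  moreover have "fv q \<subseteq> {..<m + n}"
    using fv_rename[of r p] assms(3) by (force simp: q_def r_def split: if_splits)
  ultimately have "\<not> has_IP M m n q" using assms(1) unfolding NIP_def by blast
  then obtain d where d: "\<not> (\<exists>(a :: nat \<Rightarrow> _ list) (b :: nat set \<Rightarrow> _ list).
       (\<forall>i<d. a i \<in> tuples m) \<and> (\<forall>S. S \<subseteq> {..<d} \<longrightarrow> b S \<in> tuples n) \<and>
       (\<forall>i<d. \<forall>S. S \<subseteq> {..<d} \<longrightarrow> (sat M (nth (a i @ b S)) q \<longleftrightarrow> i \<in> S)))"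
    unfolding has_IP_def by auto
  have sw: "sat M (nth (x @ y)) q = sat M (nth (y @ x)) p" if "length x = m" "length y = n" for x y
    unfolding q_def sat_rename by (rule sat_cong) (use that assms(3) in \<open>auto simp: r_def nth_append\<close>)
  have "shatter_free M n m p d" unfolding shatter_free_def
  proof (intro allI notI, elim conjE)
    fix a b
    assume a: "\<forall>i<d. length (a i) = m" and b: "\<forall>S\<subseteq>{..<d}. length (b S) = n"
      and ab: "\<forall>i<d. \<forall>S\<subseteq>{..<d}. sat M (nth (b S @ a i)) p \<longleftrightarrow> i \<in> S"
    have "sat M (nth (a i @ b S)) q \<longleftrightarrow> i \<in> S" if "i < d" "S \<subseteq> {..<d}" for i S
      using ab sw[of "a i" "b S"] a b that by simp
    then have "(\<forall>i<d. a i \<in> tuples m) \<and> (\<forall>S. S \<subseteq> {..<d} \<longrightarrow> b S \<in> tuples n) \<and>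
       (\<forall>i<d. \<forall>S. S \<subseteq> {..<d} \<longrightarrow> (sat M (nth (a i @ b S)) q \<longleftrightarrow> i \<in> S))"
      using a b by (simp add: tuples_def)
    then show False by (rule_tac notE[OF d], rule_tac exI[of _ a], rule_tac exI[of _ b])
  qed
  then show ?thesis ..
qed

section \<open>Differences of translates of a generic set\<close>

context vee_group
begin

lemma definable_translates:
  assumes "dU X"
  shows "definable M (2 * n) {g @ x | g x. g \<in> X \<and> x \<in> g <# X}"
proof -
  have XU: "X \<subseteq> carrier U" by (rule dU_carrier[OF assms])
  have "bd (\<lambda>w. w 0 \<in> X \<and> w 2 \<in> X \<and> w 1 = w 0 \<otimes> w 2)" by (rule bd_mult[OF assms assms])
  from block_definable_ex[OF this, of 2]
  have "bd (\<lambda>w. \<exists>a. length a = n \<and> w 0 \<in> X \<and> a \<in> X \<and> w 1 = w 0 \<otimes> a)" by simp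
  then have "bd (\<lambda>w. w 0 \<in> X \<and> w 1 \<in> w 0 <# X)"
    by (rule block_definable_cong) (use XU length_carrier in \<open>auto simp: l_coset_def\<close>)
  from definable_if_block_definable2[OF this]
  have "definable M (2 * n) {x @ y |x y. x \<in> tuples n \<and> y \<in> tuples n \<and> x \<in> X \<and> y \<in> x <# X}" by simp
  moreover have "{x @ y |x y. x \<in> tuples n \<and> y \<in> tuples n \<and> x \<in> X \<and> y \<in> x <# X} =
      {g @ x | g x. g \<in> X \<and> x \<in> g <# X}"
  proof -
    have "x \<in> tuples n \<and> y \<in> tuples n" if "x \<in> X" "y \<in> x <# X" for x y
      using that XU carrier_tuples l_coset_carrier[of x X] by auto
    then show ?thesis by (intro Collect_cong) blast
  qed
  ultimately show ?thesis by simp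
qed

lemma no_infinite_generic_differences:
  fixes g :: "nat \<Rightarrow> 'm list"
  assumes "NIP M" "generic \<kappa> M n U X" "\<And>i. g i \<in> X"
    and cov: "\<And>i j. i < j \<Longrightarrow> covers_by k (sym_diff (g i <# X) (g j <# X)) X"
  shows False
proof -
  have dX: "dU X" by (rule generic_dU[OF assms(2)])
  have XU: "X \<subseteq> carrier U" by (rule dU_carrier[OF dX])
  have gU: "g i \<in> carrier U" for i using XU assms(3) by auto
  obtain d :: nat where d: "\<And>a b. \<lbrakk>\<And>i. i < d \<Longrightarrow> length (a i) = n; \<And>S. S \<subseteq> {..<d} \<Longrightarrow> length (b S) = n;
    \<And>i S. i < d \<Longrightarrow> S \<subseteq> {..<d} \<Longrightarrow> a i @ b S \<in> {g @ x | g x. g \<in> X \<and> x \<in> g <# X} \<longleftrightarrow> i \<in> S\<rbrakk> \<Longrightarrow> False"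
    by (rule NIP_relation[OF assms(1) definable_translates[OF dX]]) blast
  have noshatter: "\<exists>S\<subseteq>{..<d}. \<not> (\<exists>x\<in>carrier U. \<forall>j<d. x \<in> g (a j) <# X \<longleftrightarrow> j \<in> S)" for a
  proof (rule ccontr)
    define Q where "Q S x \<longleftrightarrow> x \<in> carrier U \<and> (\<forall>j<d. x \<in> g (a j) <# X \<longleftrightarrow> j \<in> S)" for S x
    assume "\<not> ?thesis"
    then have "\<not> (\<exists>S\<subseteq>{..<d}. \<not> (\<exists>x. Q S x))" unfolding Q_def Bex_def .
    then have "\<forall>S\<in>Pow {..<d}. \<exists>x. Q S x" by blast
    from bchoice[OF this] obtain b where
      b: "\<And>S. S \<subseteq> {..<d} \<Longrightarrow> b S \<in> carrier U" "\<And>S j. S \<subseteq> {..<d} \<Longrightarrow> j < d \<Longrightarrow> b S \<in> g (a j) <# X \<longleftrightarrow> j \<in> S"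
      by (auto simp: Q_def)
    show False
    proof (rule d[of "\<lambda>j. g (a j)" b])
      fix i S assume iS: "i < d" "S \<subseteq> {..<d}"
      have len: "length (g (a i)) = n" by (rule length_carrier[OF gU])
      have "g (a i) @ b S \<in> {g @ x | g x. g \<in> X \<and> x \<in> g <# X} \<longleftrightarrow> b S \<in> g (a i) <# X"
      proof
        assume "g (a i) @ b S \<in> {g @ x | g x. g \<in> X \<and> x \<in> g <# X}"
        then obtain h x where h: "g (a i) @ b S = h @ x" "h \<in> X" "x \<in> h <# X" by blast
        have "length h = n" using h(2) XU length_carrier by auto
        then show "b S \<in> g (a i) <# X" using h len by simp
      qed (use assms(3) in blast)
      then show "g (a i) @ b S \<in> {g @ x | g x. g \<in> X \<and> x \<in> g <# X} \<longleftrightarrow> i \<in> S"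
        using b(2)[OF iS(2,1)] by simp
    qed (use gU b(1) length_carrier in auto)
  qed
  obtain u :: "nat \<Rightarrow> nat" where u: "strict_mono u"
    "\<forall>x\<in>carrier U. \<forall>K. card {i. i < K \<and> (x \<in> g (u (2 * i)) <# X) \<noteq> (x \<in> g (u (2 * i + 1)) <# X)} \<le> d"
    by (rule bounded_alternation[of d "carrier U" "\<lambda>i x. x \<in> g i <# X", OF noshatter])
  define W where "W i = sym_diff (g (u (2 * i)) <# X) (g (u (2 * i + 1)) <# X)" for i
  \<comment> \<open>Since the \<open>g i\<close> lie in \<open>X\<close>, all \<open>W i\<close> lie
    in the definable set \<open>X <#> X\<close>. Hence one finite \<open>T\<close> serves for any
    number of sets, and \<open>K\<close> may be chosen after \<open>T\<close>.\<close>
  have "covers X (X <#> X)" by (rule generic_covers[OF assms(2) dU_set_mult[OF dX dX]])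
  then obtain T where T: "finite T" "T \<subseteq> carrier U" "X <#> X \<subseteq> (\<Union>t\<in>T. t <# X)"
    unfolding covers_def by blast
  have WX: "W i \<subseteq> X <#> X" for i
    using assms(3) by (auto simp: W_def l_coset_def set_mult_def)
  define K where "K = Suc (k * d * card T)"
  have "K \<le> k * d * card T"
  proof (rule translate_counting[OF XU assms(3)[of 0], of K W k d T])
    fix i assume "i < K"
    show "W i \<subseteq> carrier U" using WX[of i] dU_carrier[OF dU_set_mult[OF dX dX]] by auto
    show "W i \<subseteq> (\<Union>t\<in>T. t <# X)" using WX[of i] T(3) by (rule order_trans)
    have "covers_by k (W i) X" unfolding W_def by (rule cov) (use u(1) in \<open>simp add: strict_mono_def\<close>)
    then obtain h where "\<forall>j<k. h j \<in> carrier U" "X \<subseteq> (\<Union>j<k. h j <# W i)"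
      unfolding covers_by_def by blast
    moreover have "card (h ` {..<k}) \<le> k" using card_image_le[of "{..<k}" h] by simp
    ultimately show "\<exists>A\<subseteq>carrier U. finite A \<and> card A \<le> k \<and> X \<subseteq> (\<Union>h\<in>A. h <# W i)"
      by (intro exI[of _ "h ` {..<k}"]) auto
  next
    fix z assume "z \<in> carrier U"
    have "{i. i < K \<and> z \<in> W i} =
        {i. i < K \<and> (z \<in> g (u (2 * i)) <# X) \<noteq> (z \<in> g (u (2 * i + 1)) <# X)}"
      by (auto simp: W_def)
    then show "card {i. i < K \<and> z \<in> W i} \<le> d" using u(2) \<open>z \<in> carrier U\<close> by simp
  qed (use T in auto)
  then show False by (simp add: K_def)
qed

end

section \<open>Type-definable subgroups\<close>

text \<open>Each choice depends on the set of all earlier ones. As \<open>P\<close> has to be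
  satisfiable over every finite set, applications make it vacuous on sets that cannot arise.\<close>

lemma dependent_choice_finite_sets:
  assumes "\<And>A. finite A \<Longrightarrow> \<exists>x. P A x"
  obtains f :: "nat \<Rightarrow> 'a" where "\<forall>i. P (f ` {..<i}) (f i)"
proof -
  define ch where "ch A = (SOME x. P A x)" for A
  have ch: "P A (ch A)" if "finite A" for A
    unfolding ch_def by (rule someI_ex[OF assms[OF that]])
  define l where "l = rec_nat [] (\<lambda>_ xs. xs @ [ch (set xs)])"
  define f where "f i = ch (set (l i))" for i
  have "set (l i) = f ` {..<i}" for i
  proof (induction i)
    case (Suc i)
    have "set (l (Suc i)) = insert (f i) (set (l i))" by (simp add: l_def f_def)
    then show ?case using Suc by (simp add: lessThan_Suc)
  qed (simp add: l_def)
  then have "P (f ` {..<i}) (f i)" for i using ch[of "set (l i)"] by (simp add: f_def[of i])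
  then show ?thesis using that by blast
qed

section \<open>Sets of at most as many elements as there are formulas\<close>

context saturated_structure
begin

text \<open>In contrast to smallness, this size passes to unions over an index set of the same size,
  and by the bound on \<open>\<kappa>\<close> it makes power sets small.\<close>

abbreviation few :: "'a set \<Rightarrow> bool" where
  "few T \<equiv> |T| \<le>o |formulas|"

lemma few_nat: "few (UNIV :: nat set)"
  using infinite_formulas infinite_iff_card_of_nat by blast

lemma few_Times: "few A \<Longrightarrow> few B \<Longrightarrow> few (A \<times> B)"
  by (rule card_of_Times_ordLeq_infinite_Field) (simp_all add: infinite_formulas card_of_card_order_on Field_card_of)

lemma few_Un: "few A \<Longrightarrow> few B \<Longrightarrow> few (A \<union> B)"
  by (rule card_of_Un_ordLeq_infinite_Field)
    (simp_all add: infinite_formulas card_of_card_order_on Field_card_of)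

lemma few_finite: "finite A \<Longrightarrow> few A"
proof -
  assume "finite A"
  then obtain f :: "'a \<Rightarrow> nat" where "inj_on f A" using finite_imp_inj_to_nat_seg[of A] by auto
  then have "|A| \<le>o |UNIV :: nat set|" using card_of_ordLeq[of A UNIV] by auto
  then show ?thesis using few_nat by (rule ordLeq_transitive)
qed

lemma few_UN: "few I \<Longrightarrow> (\<And>i. i \<in> I \<Longrightarrow> few (A i)) \<Longrightarrow> few (\<Union>i\<in>I. A i)"
  by (rule card_of_UNION_ordLeq_infinite[OF infinite_formulas]) auto

lemma few_small: "few A \<Longrightarrow> small \<kappa> A"
  using small_formulas unfolding small_def by (rule_tac ordLeq_ordLess_trans)

lemma small_Pow_few:
  assumes "few A" shows "small \<kappa> (Pow A)"
proof -
  obtain e where e: "inj_on e A" "e ` A \<subseteq> formulas"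
    using assms card_of_ordLeq[of A formulas] by auto
  have "Pow A \<subseteq> (\<lambda>B. e -` B \<inter> A) ` Pow formulas"
  proof
    fix B assume B: "B \<in> Pow A"
    then have "e -` (e ` B) \<inter> A = B" using e(1) by (auto simp: inj_on_def)
    moreover have "e ` B \<in> Pow formulas" using B e(2) by auto
    ultimately show "B \<in> (\<lambda>B. e -` B \<inter> A) ` Pow formulas" by (auto simp: image_iff intro!: exI[of _ "e ` B"])
  qed
  then show ?thesis by (rule small_subset[OF small_image[OF small_Pow_formulas]])
qed

end

section \<open>Bounded index and compactness for subgroups\<close>

context vee_group
begin

lemma mult_cancel_quotient:
  assumes "c \<in> carrier U" "a \<in> carrier U" "b \<in> carrier U"
  shows "(c \<otimes> a) \<otimes> inv (c \<otimes> b) = a \<otimes> inv b"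
proof -
  have "(c \<otimes> a) \<otimes> inv (c \<otimes> b) = (c \<otimes> inv c) \<otimes> (a \<otimes> inv b)"
    using assms by (simp add: inv_mult m_ac del: r_inv Units_r_inv)
  then show ?thesis using assms by simp
qed

text \<open>An element \<open>u\<close> is coded by a translate of \<open>X\<close> containing it
  and, for each \<open>t\<close>, by the number of a translate of \<open>D t\<close> containing
  \<open>inv (s u) \<otimes> u\<close>. The latter is a function on \<open>T\<close>, whose graph is
  a subset of a \<open>few\<close> set, so the codes form a small set. Elements with equal codes
  differ by a quotient from every \<open>D t\<close>, hence lie in one coset of
  \<open>H\<close>.\<close>

lemma bounded_indexI:
  assumes X: "generic \<kappa> M n U X" and H: "subgroup H U" and T: "few T"
    and D: "\<And>t. t \<in> T \<Longrightarrow> D t \<subseteq> carrier U" "\<And>t. t \<in> T \<Longrightarrow> covers (D t) X"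
    and sub: "\<And>z. z \<in> carrier U \<Longrightarrow> (\<And>t. t \<in> T \<Longrightarrow> \<exists>a\<in>D t. \<exists>b\<in>D t. z = a \<otimes> inv b) \<Longrightarrow> z \<in> H"
  shows "bounded_index \<kappa> U H"
proof -
  obtain S where S: "S \<subseteq> carrier U" "small \<kappa> S" "carrier U \<subseteq> (\<Union>g\<in>S. g <# X)"
    using X unfolding generic_iff by blast
  have XU: "X \<subseteq> carrier U" by (rule dU_carrier[OF generic_dU[OF X]])
  have "\<forall>t\<in>T. \<exists>h. (\<forall>i::nat. h i \<in> carrier U) \<and> X \<subseteq> (\<Union>i. h i <# D t)"
  proof
    fix t assume "t \<in> T"
    from D(2)[OF this] obtain k where "covers_by k (D t) X" unfolding covers_iff ..
    then obtain h where h: "\<forall>i<k. h i \<in> carrier U" "X \<subseteq> (\<Union>i<k. h i <# D t)"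
      unfolding covers_by_def by blast
    have "X \<subseteq> (\<Union>i. (if i < k then h i else \<one>) <# D t)"
    proof
      fix x assume "x \<in> X"
      then obtain i where "i < k" "x \<in> h i <# D t" using h(2) by auto
      then show "x \<in> (\<Union>i. (if i < k then h i else \<one>) <# D t)" by (intro UN_I[of i]) auto
    qed
    then show "\<exists>h. (\<forall>i::nat. h i \<in> carrier U) \<and> X \<subseteq> (\<Union>i. h i <# D t)"
      using h(1) by (intro exI[of _ "\<lambda>i. if i < k then h i else \<one>"]) auto
  qed
  from bchoice[OF this] obtain h where
    h': "\<forall>t\<in>T. (\<forall>i::nat. h t i \<in> carrier U) \<and> X \<subseteq> (\<Union>i. h t i <# D t)" ..
  have h: "h t i \<in> carrier U" "X \<subseteq> (\<Union>i::nat. h t i <# D t)" if "t \<in> T" for t i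
    using h' that by simp_all
  define s where "s u = (SOME g. g \<in> S \<and> u \<in> g <# X)" for u
  have s: "s u \<in> S \<and> u \<in> s u <# X" if "u \<in> carrier U" for u
    unfolding s_def by (rule someI_ex) (use S(3) that in auto)
  define f where "f u t = (SOME i. inv (s u) \<otimes> u \<in> h t i <# D t)" for u t
  have f: "inv (s u) \<otimes> u \<in> h t (f u t) <# D t" if "u \<in> carrier U" "t \<in> T" for u t
    unfolding f_def
  proof (rule someI_ex)
    have "inv (s u) \<otimes> u \<in> X" using s[OF that(1)] mem_l_coset_iff[OF _ XU that(1), of "s u"] S(1) by auto
    then show "\<exists>i. inv (s u) \<otimes> u \<in> h t i <# D t" using h(2)[OF that(2)] by auto
  qed
  define code where "code u = (s u, {(t, f u t) | t. t \<in> T})" for u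
  have code: "H #> u = H #> v" if uv: "u \<in> carrier U" "v \<in> carrier U" "code u = code v" for u v
  proof -
    have suv: "s u = s v" using uv(3) by (simp add: code_def)
    have fuv: "f u t = f v t" if "t \<in> T" for t
    proof -
      have "(t, f u t) \<in> {(t, f v t) | t. t \<in> T}" using uv(3) that by (auto simp: code_def)
      then show ?thesis by auto
    qed
    have sU: "s v \<in> carrier U" using s[OF uv(2)] S(1) by auto
    have "u \<otimes> inv v \<in> H"
    proof (rule sub)
      fix t assume t: "t \<in> T"
      define k where "k = h t (f v t)"
      have kU: "k \<in> carrier U" by (simp add: k_def h(1) t)
      obtain a where a: "a \<in> D t" "inv (s v) \<otimes> u = k \<otimes> a"
        using f[OF uv(1) t] fuv[OF t] suv by (auto simp: l_coset_def k_def)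
      obtain b where b: "b \<in> D t" "inv (s v) \<otimes> v = k \<otimes> b"
        using f[OF uv(2) t] by (auto simp: l_coset_def k_def)
      have ab: "a \<in> carrier U" "b \<in> carrier U" using a b D(1)[OF t] by auto
      have "u \<otimes> inv v = (inv (s v) \<otimes> u) \<otimes> inv (inv (s v) \<otimes> v)"
        using uv sU by (simp add: mult_cancel_quotient)
      also have "\<dots> = (k \<otimes> a) \<otimes> inv (k \<otimes> b)" by (simp only: a(2) b(2))
      also have "\<dots> = a \<otimes> inv b" using ab kU by (simp add: mult_cancel_quotient)
      finally show "\<exists>a\<in>D t. \<exists>b\<in>D t. u \<otimes> inv v = a \<otimes> inv b" using a(1) b(1) by blast
    qed (use uv in auto)
    then have "(u \<otimes> inv v) \<otimes> v \<in> H #> v" by (auto simp: r_coset_def)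
    then have "u \<in> H #> v" using uv by (simp add: m_assoc)
    then show ?thesis using repr_independence[OF _ uv(2) H] by blast
  qed
  have "code ` carrier U \<subseteq> S \<times> Pow (T \<times> UNIV)" using s by (auto simp: code_def)
  moreover have "small \<kappa> (S \<times> Pow (T \<times> (UNIV :: nat set)))"
    by (intro small_Times S small_Pow_few few_Times T few_nat)
  ultimately have "small \<kappa> (code ` carrier U)" by (rule_tac small_subset)
  then have "small \<kappa> ((\<lambda>c. H #> (SOME u. u \<in> carrier U \<and> code u = c)) ` (code ` carrier U))"
    by (rule small_image)
  moreover have "rcosets H \<subseteq> (\<lambda>c. H #> (SOME u. u \<in> carrier U \<and> code u = c)) ` (code ` carrier U)"
  proof
    fix R assume "R \<in> rcosets H"
    then obtain u where u: "u \<in> carrier U" "R = H #> u" by (auto simp: RCOSETS_def)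
    define v where "v = (SOME v. v \<in> carrier U \<and> code v = code u)"
    have "v \<in> carrier U \<and> code v = code u" unfolding v_def by (rule someI[of _ u]) (use u in auto)
    then have "R = H #> v" using code[of u v] u by auto
    then show "R \<in> (\<lambda>c. H #> (SOME u. u \<in> carrier U \<and> code u = c)) ` (code ` carrier U)"
      using u(1) unfolding v_def by blast
  qed
  ultimately show ?thesis unfolding bounded_index_def by (rule small_subset)
qed

text \<open>Compactness is used twice: on \<open>n\<close>-tuples to get a finite intersection
  inside \<open>U\<close>, where quotients make sense, and on pairs, coded as
  \<open>2 n\<close>-tuples, to get the quotients into \<open>D\<close>.\<close>

lemma subgroup_compactness:
  assumes F: "small \<kappa> F" "\<And>D. D \<in> F \<Longrightarrow> definable M n D"
    and H: "subgroup (tuples n \<inter> \<Inter>F) U"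
    and D: "definable M n D" "tuples n \<inter> \<Inter>F \<subseteq> D"
  obtains F0 where "F0 \<subseteq> F" "finite F0" "tuples n \<inter> \<Inter>F0 \<subseteq> carrier U"
    "\<forall>x\<in>tuples n \<inter> \<Inter>F0. \<forall>y\<in>tuples n \<inter> \<Inter>F0. x \<otimes> inv y \<in> D"
proof -
  have HU: "tuples n \<inter> \<Inter>F \<subseteq> carrier U" using subgroup.subset[OF H] .
  obtain F1 C0 where F1: "F1 \<subseteq> F" "finite F1" "C0 \<subseteq> \<X>" "finite C0" "tuples n \<inter> \<Inter>F1 \<subseteq> \<Union>C0"
    by (rule compactness_cover[OF F small_family definable_family]) (use HU carrier_family in auto)
  define E where "E = tuples n \<inter> \<Inter>F1"
  have "\<Union>C0 \<subseteq> carrier U" using F1(3) carrier_family by auto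
  then have EU: "E \<subseteq> carrier U" using F1(5) by (simp add: E_def)
  have dE: "dU E" unfolding definable_in_def
    using EU definable_Inter_finite[OF F1(2), of M n] F1(1) F(2) by (auto simp: E_def)
  define Z where "Z = (E <#> m_inv U ` E) \<inter> (tuples n - D)"
  have dZ: "dU Z" unfolding Z_def by (intro dU_Int dU_set_mult dU_inverse dE definable_compl D)
  \<comment> \<open>These are the pairs from \<open>E\<close> whose quotient misses
    \<open>D\<close>; writing \<open>x = a \<otimes> y\<close> with \<open>a\<close> in
    \<open>Z\<close> expresses this by multiplication between definable sets.\<close>
  define Bad where "Bad = {x @ y | x y. x \<in> tuples n \<and> y \<in> tuples n \<and>
     x \<in> E \<and> y \<in> E \<and> (\<exists>a. length a = n \<and> a \<in> Z \<and> x = a \<otimes> y)}"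
  have "bd (\<lambda>w. (w 0 \<in> E \<and> w 1 \<in> E) \<and> (w 2 \<in> Z \<and> w 1 \<in> E \<and> w 0 = w 2 \<otimes> w 1))"
    by (intro block_definable_conj bd_mult[OF dZ dE, of 2 1 0] block_definable_mem dU_definable dE)
  from block_definable_ex[OF this, of 2]
  have "bd (\<lambda>w. w 0 \<in> E \<and> w 1 \<in> E \<and> (\<exists>a. length a = n \<and> a \<in> Z \<and> w 0 = a \<otimes> w 1))"
    by (rule block_definable_cong) auto
  from definable_if_block_definable2[OF this] have dBad: "definable M (2 * n) Bad"
    unfolding Bad_def by simp
  define pull where "pull D' = {x @ y | x y. x \<in> tuples n \<and> y \<in> tuples n \<and> x \<in> D' \<and> y \<in> D'}"
    for D' :: "'m list set"
  have dpull: "definable M (2 * n) (pull D')" if "D' \<in> F" for D'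
  proof -
    have "bd (\<lambda>w. w 0 \<in> D' \<and> w 1 \<in> D')" by (intro block_definable_conj block_definable_mem F(2) that)
    from definable_if_block_definable2[OF this] show ?thesis unfolding pull_def by simp
  qed
  have pull_iff: "x @ y \<in> pull D' \<longleftrightarrow> x \<in> D' \<and> y \<in> D'" if "x \<in> tuples n" "y \<in> tuples n" for x y D'
    using that by (auto simp: pull_def tuples_def)
  have "tuples (2 * n) \<inter> \<Inter>(pull ` F) \<subseteq> \<Union>{tuples (2 * n) - Bad}"
  proof
    fix z assume z: "z \<in> tuples (2 * n) \<inter> \<Inter>(pull ` F)"
    have "z \<notin> Bad"
    proof
      assume "z \<in> Bad"
      then obtain x y a where xy: "z = x @ y" "x \<in> tuples n" "y \<in> tuples n" "x \<in> E" "y \<in> E" "a \<in> Z"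
        "x = a \<otimes> y" by (auto simp: Bad_def)
      have "x \<in> tuples n \<inter> \<Inter>F" "y \<in> tuples n \<inter> \<Inter>F" using z xy pull_iff by auto
      then have "x \<otimes> inv y \<in> tuples n \<inter> \<Inter>F"
        by (intro subgroup.m_closed[OF H] subgroup.m_inv_closed[OF H])
      then have inD: "x \<otimes> inv y \<in> D" using D by auto
      have "a \<in> carrier U" "y \<in> carrier U" using xy EU dU_carrier[OF dZ] by auto
      then have "x \<otimes> inv y = a" unfolding xy(7) by (simp add: m_assoc)
      then show False using xy(6) inD by (simp add: Z_def)
    qed
    then show "z \<in> \<Union>{tuples (2 * n) - Bad}" using z by auto
  qed
  then obtain G0 C1 where G0: "G0 \<subseteq> pull ` F" "finite G0" "C1 \<subseteq> {tuples (2 * n) - Bad}" "finite C1"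
    "tuples (2 * n) \<inter> \<Inter>G0 \<subseteq> \<Union>C1"
    by (rule compactness_cover[OF small_image[OF F(1), of pull] _ small_finite, rotated 3])
      (use dpull dBad definable_compl in auto)
  obtain F2 where F2: "F2 \<subseteq> F" "finite F2" "G0 = pull ` F2"
    using finite_subset_image[OF G0(2,1)] by auto
  show ?thesis
  proof (rule that[of "F1 \<union> F2"])
    show "tuples n \<inter> \<Inter>(F1 \<union> F2) \<subseteq> carrier U" using EU by (auto simp: E_def)
    show "\<forall>x\<in>tuples n \<inter> \<Inter>(F1 \<union> F2). \<forall>y\<in>tuples n \<inter> \<Inter>(F1 \<union> F2). x \<otimes> inv y \<in> D"
    proof (intro ballI)
      fix x y assume x: "x \<in> tuples n \<inter> \<Inter>(F1 \<union> F2)" and y: "y \<in> tuples n \<inter> \<Inter>(F1 \<union> F2)"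
      have xy: "x \<in> tuples n" "y \<in> tuples n" using x y by auto
      have xyE: "x \<in> E" "y \<in> E" using x y by (auto simp: E_def)
      then have xyU: "x \<in> carrier U" "y \<in> carrier U" using EU by auto
      have "x @ y \<in> tuples (2 * n) \<inter> \<Inter>G0"
        using x y pull_iff[OF xy] by (auto simp: F2 tuples_def)
      then have "x @ y \<notin> Bad" using G0(3,5) by auto
      show "x \<otimes> inv y \<in> D"
      proof (rule ccontr)
        assume "x \<otimes> inv y \<notin> D"
        moreover have "x \<otimes> inv y \<in> E <#> m_inv U ` E" using xyE by (intro set_multI) auto
        ultimately have "x \<otimes> inv y \<in> Z"
          using xyU carrier_tuples unfolding Z_def by auto
        moreover have "length (x \<otimes> inv y) = n" using xyU by (intro length_carrier) auto
        moreover have "x = (x \<otimes> inv y) \<otimes> y" using xyU by (simp add: m_assoc)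
        ultimately have "x @ y \<in> Bad" unfolding Bad_def using xy xyE by blast
        then show False using \<open>x @ y \<notin> Bad\<close> by simp
      qed
    qed
  qed (use F1 F2 in auto)
qed

end

section \<open>The stabilizer of a generic set\<close>

context vee_group
begin

lemma nongeneric_subset:
  assumes "nongeneric \<kappa> M n U W" "dU V" "V \<subseteq> W"
  shows "nongeneric \<kappa> M n U V"
  using assms generic_superset[of V W] unfolding nongeneric_def by blast

lemma nongeneric_translate:
  assumes "nongeneric \<kappa> M n U W" "g \<in> carrier U"
  shows "nongeneric \<kappa> M n U (g <# W)"
proof -
  have dW: "dU W" using assms(1) by (simp add: nongeneric_def)
  have "inv g <# (g <# W) = W"
    using assms(2) dU_carrier[OF dW] by (simp add: l_coset_l_coset lcos_mult_one)
  then have "generic \<kappa> M n U W" if "generic \<kappa> M n U (g <# W)"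
    using generic_translate[OF that, of "inv g"] assms(2) by simp
  then show ?thesis using assms dU_translate[OF assms(2) dW] unfolding nongeneric_def by blast
qed

lemma dU_sym_diff:
  assumes "dU A" "dU B"
  shows "dU (sym_diff A B)"
  by (intro dU_Un dU_diff assms)

lemma generic_nonempty: "generic \<kappa> M n U W \<Longrightarrow> W \<noteq> {}"
  unfolding generic_iff using one_closed by (auto simp: l_coset_def)

lemma nongeneric_empty: "dU W \<Longrightarrow> W = {} \<Longrightarrow> nongeneric \<kappa> M n U W"
  using generic_nonempty unfolding nongeneric_def by blast

text \<open>The ideal property enters for products: \<open>ghX \<triangle> X\<close> is contained in
  the union of \<open>g(hX \<triangle> X)\<close> and \<open>gX \<triangle> X\<close>.\<close>

lemma Stab_ng_subgroup:
  assumes X: "generic \<kappa> M n U X" and ideal: "nongeneric_ideal \<kappa> M n U"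
  shows "subgroup (Stab_ng \<kappa> M n U X) U"
proof -
  have dX: "dU X" by (rule generic_dU[OF X])
  have XU: "X \<subseteq> carrier U" by (rule dU_carrier[OF dX])
  have cU: "g <# X \<subseteq> carrier U" if "g \<in> carrier U" for g by (rule l_coset_carrier[OF that XU])
  have dg: "dU (sym_diff (g <# X) X)" if "g \<in> carrier U" for g
    by (intro dU_sym_diff dU_translate dX that)
  show ?thesis
  proof (rule subgroupI)
    show "Stab_ng \<kappa> M n U X \<subseteq> carrier U" by (auto simp: Stab_ng_def)
    have "sym_diff (\<one> <# X) X = {}" using XU by (simp add: lcos_mult_one)
    then have "\<one> \<in> Stab_ng \<kappa> M n U X"
      unfolding Stab_ng_def using nongeneric_empty[OF dg[OF one_closed]] by simp
    then show "Stab_ng \<kappa> M n U X \<noteq> {}" by blast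
  next
    fix g assume "g \<in> Stab_ng \<kappa> M n U X"
    then have g: "g \<in> carrier U" "nongeneric \<kappa> M n U (sym_diff (g <# X) X)" by (auto simp: Stab_ng_def)
    have "inv g <# sym_diff (g <# X) X = sym_diff (inv g <# (g <# X)) (inv g <# X)"
      using g(1) by (intro l_coset_sym_diff XU cU) auto
    also have "\<dots> = sym_diff (inv g <# X) X"
      using g(1) XU by (simp add: l_coset_l_coset lcos_mult_one Un_commute)
    finally show "inv g \<in> Stab_ng \<kappa> M n U X"
      using nongeneric_translate[OF g(2), of "inv g"] g(1) by (simp add: Stab_ng_def)
  next
    fix g h assume "g \<in> Stab_ng \<kappa> M n U X" "h \<in> Stab_ng \<kappa> M n U X"
    then have g: "g \<in> carrier U" "nongeneric \<kappa> M n U (sym_diff (g <# X) X)"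
      and h: "h \<in> carrier U" "nongeneric \<kappa> M n U (sym_diff (h <# X) X)" by (auto simp: Stab_ng_def)
    have "g <# sym_diff (h <# X) X = sym_diff ((g \<otimes> h) <# X) (g <# X)"
      using g(1) h(1) XU by (simp add: l_coset_sym_diff cU l_coset_l_coset)
    then have "nongeneric \<kappa> M n U (sym_diff ((g \<otimes> h) <# X) (g <# X))"
      using nongeneric_translate[OF h(2) g(1)] by simp
    then have "nongeneric \<kappa> M n U (sym_diff ((g \<otimes> h) <# X) (g <# X) \<union> sym_diff (g <# X) X)"
      using ideal g(2) unfolding nongeneric_ideal_def by blast
    then have "nongeneric \<kappa> M n U (sym_diff ((g \<otimes> h) <# X) X)"
      by (rule nongeneric_subset) (use dg[of "g \<otimes> h"] g h in auto)
    then show "g \<otimes> h \<in> Stab_ng \<kappa> M n U X" using g h by (simp add: Stab_ng_def)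
  qed
qed

definition nongeneric_by :: "'m list set \<Rightarrow> nat \<Rightarrow> 'm list set" where
  "nongeneric_by X k = {g \<in> X <#> m_inv U ` X. \<not> covers_by k (sym_diff (g <# X) X) X}"

lemma dU_nongeneric_by:
  assumes "dU X"
  shows "dU (nongeneric_by X k)"
proof -
  let ?Y = "X <#> m_inv U ` X"
  have Y: "dU ?Y" by (intro dU_set_mult dU_inverse assms)
  have "nongeneric_by X k = ?Y - {g \<in> ?Y. covers_by k (sym_diff (g <# X) X) X}"
    by (auto simp: nongeneric_by_def)
  then show ?thesis using dU_diff[OF Y dU_covers_by[OF assms Y]] by simp
qed

lemma nongeneric_by_antimono: "k \<le> l \<Longrightarrow> nongeneric_by X l \<subseteq> nongeneric_by X k"
  unfolding nongeneric_by_def using covers_by_mono by blast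

lemma Stab_ng_eq:
  assumes X: "generic \<kappa> M n U X" and ideal: "nongeneric_ideal \<kappa> M n U"
  shows "Stab_ng \<kappa> M n U X = (\<Inter>k. nongeneric_by X k)"
proof -
  have dX: "dU X" by (rule generic_dU[OF X])
  have XU: "X \<subseteq> carrier U" by (rule dU_carrier[OF dX])
  have dg: "dU (sym_diff (g <# X) X)" if "g \<in> carrier U" for g
    by (intro dU_sym_diff dU_translate dX that)
  have ng: "nongeneric \<kappa> M n U (sym_diff (g <# X) X) \<longleftrightarrow> (\<forall>k. \<not> covers_by k (sym_diff (g <# X) X) X)"
    if "g \<in> carrier U" for g
    using generic_iff_covers[OF X dg[OF that]] dg[OF that] unfolding nongeneric_def by simp
  have YU: "X <#> m_inv U ` X \<subseteq> carrier U"
    by (intro dU_carrier dU_set_mult dU_inverse dX)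
  \<comment> \<open>\<open>X\<close> is generic and \<open>X - (g <# X)\<close> is not, so by the
    ideal property \<open>X \<inter> (g <# X)\<close> is generic, hence nonempty; a common point
    exhibits \<open>g\<close> as a quotient of elements of \<open>X\<close>.\<close>
  have inY: "g \<in> X <#> m_inv U ` X"
    if g: "g \<in> carrier U" "nongeneric \<kappa> M n U (sym_diff (g <# X) X)" for g
  proof -
    have "nongeneric \<kappa> M n U (X - (g <# X))"
      by (rule nongeneric_subset[OF g(2)]) (auto intro!: dU_diff dX dU_translate g(1))
    moreover have "\<not> nongeneric \<kappa> M n U ((X - (g <# X)) \<union> (X \<inter> (g <# X)))"
      using X by (simp add: nongeneric_def Un_Diff_Int)
    ultimately have "\<not> nongeneric \<kappa> M n U (X \<inter> (g <# X))"
      using ideal unfolding nongeneric_ideal_def by blast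
    moreover have "dU (X \<inter> (g <# X))" by (intro dU_Int dU_definable dX dU_translate g(1))
    ultimately have "X \<inter> (g <# X) \<noteq> {}" using nongeneric_empty by blast
    then obtain x y where xy: "x \<in> X" "y \<in> X" "x = g \<otimes> y" by (auto simp: l_coset_def)
    have "y \<in> carrier U" using xy(2) XU by auto
    then have "x \<otimes> inv y = g" unfolding xy(3) using g(1) by (simp add: m_assoc)
    then show ?thesis using set_multI[of x X "inv y" "m_inv U ` X"] xy by simp
  qed
  show ?thesis
  proof (intro equalityI subsetI)
    fix g assume "g \<in> Stab_ng \<kappa> M n U X"
    then have g: "g \<in> carrier U" "nongeneric \<kappa> M n U (sym_diff (g <# X) X)" by (simp_all add: Stab_ng_def)
    then show "g \<in> (\<Inter>k. nongeneric_by X k)" using inY[OF g] ng[OF g(1)] by (simp add: nongeneric_by_def)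
  next
    fix g assume "g \<in> (\<Inter>k. nongeneric_by X k)"
    then have g: "g \<in> X <#> m_inv U ` X" "\<forall>k. \<not> covers_by k (sym_diff (g <# X) X) X"
      by (simp_all add: nongeneric_by_def)
    then have "g \<in> carrier U" using YU by auto
    then show "g \<in> Stab_ng \<kappa> M n U X" using ng g(2) by (simp add: Stab_ng_def)
  qed
qed

text \<open>Otherwise a greedy choice yields \<open>f j\<close> in \<open>X\<close> outside
  \<open>f i <# nongeneric_by X k\<close> for all \<open>i < j\<close>. Then
  \<open>inv (f i) \<otimes> f j\<close> is a quotient from \<open>X\<close> excluded by the
  covering condition alone, so \<open>k\<close> translates of the difference of
  \<open>f i <# X\<close> and \<open>f j <# X\<close> cover \<open>X\<close>, contrary to
  \<open>no_infinite_generic_differences\<close>.\<close>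

lemma covers_nongeneric_by:
  assumes NIP: "NIP M" and X: "generic \<kappa> M n U X"
  shows "covers (nongeneric_by X k) X"
proof (rule ccontr)
  assume neg: "\<not> covers (nongeneric_by X k) X"
  have dX: "dU X" by (rule generic_dU[OF X])
  have XU: "X \<subseteq> carrier U" by (rule dU_carrier[OF dX])
  define P where "P A x \<longleftrightarrow> (A \<subseteq> X \<longrightarrow> x \<in> X \<and> (\<forall>s\<in>A. x \<notin> s <# nongeneric_by X k))" for A x
  have "\<exists>x. P A x" if "finite A" for A
  proof (cases "A \<subseteq> X")
    case True
    then have "\<not> X \<subseteq> (\<Union>s\<in>A. s <# nongeneric_by X k)"
      using neg that XU unfolding covers_def by blast
    then show ?thesis by (auto simp: P_def)
  qed (auto simp: P_def)
  then obtain f where f: "\<forall>i::nat. P (f ` {..<i}) (f i)" by (rule dependent_choice_finite_sets)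
  have fX: "f i \<in> X" for i
  proof (induction i rule: less_induct)
    case (less i)
    then have "f ` {..<i} \<subseteq> X" by auto
    then show ?case using f unfolding P_def by blast
  qed
  have fU: "f i \<in> carrier U" for i using fX XU by auto
  show False
  proof (rule no_infinite_generic_differences[OF NIP X fX])
    fix i j :: nat assume ij: "i < j"
    have "f ` {..<j} \<subseteq> X" using fX by auto
    then have "f j \<notin> f i <# nongeneric_by X k" using f ij unfolding P_def by blast
    then have "inv (f i) \<otimes> f j \<notin> nongeneric_by X k"
      using mem_l_coset_iff[OF fU[of i] dU_carrier[OF dU_nongeneric_by[OF dX]] fU[of j]] by simp
    moreover have "inv (f i) \<otimes> f j \<in> X <#> m_inv U ` X"
      using set_multI[of "f j" X "inv (f i)" "m_inv U ` X"] fX m_comm[of "inv (f i)" "f j"] fU by simp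
    ultimately have "covers_by k (sym_diff ((inv (f i) \<otimes> f j) <# X) X) X"
      unfolding nongeneric_by_def by blast
    moreover have "inv (f i) <# sym_diff (f i <# X) (f j <# X) =
        sym_diff ((inv (f i) \<otimes> f j) <# X) X"
      using fU XU l_coset_carrier[OF fU XU]
      by (simp add: l_coset_sym_diff l_coset_l_coset lcos_mult_one Un_commute)
    ultimately have "covers_by k (inv (f i) <# sym_diff (f i <# X) (f j <# X)) X" by simp
    then show "covers_by k (sym_diff (f i <# X) (f j <# X)) X"
      by (rule covers_by_translate) (use fU l_coset_carrier[OF fU XU] in auto)
  qed
qed

theorem Stab_ng_type_definable_bounded:
  assumes NIP: "NIP M" and X: "generic \<kappa> M n U X" and ideal: "nongeneric_ideal \<kappa> M n U"
  shows "type_definable_subgroup \<kappa> M n U (Stab_ng \<kappa> M n U X)"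
    and "bounded_index \<kappa> U (Stab_ng \<kappa> M n U X)"
proof -
  let ?N = "nongeneric_by X"
  have dX: "dU X" by (rule generic_dU[OF X])
  have dN: "dU (?N k)" for k by (rule dU_nongeneric_by[OF dX])
  have NU: "?N k \<subseteq> carrier U" for k by (rule dU_carrier[OF dN])
  have sN: "small \<kappa> (range ?N)" by (rule small_image[OF small_nat])
  have eq: "Stab_ng \<kappa> M n U X = tuples n \<inter> \<Inter>(range ?N)"
    using Stab_ng_eq[OF X ideal] NU carrier_tuples by blast
  have sub: "subgroup (tuples n \<inter> \<Inter>(range ?N)) U"
    using Stab_ng_subgroup[OF X ideal] unfolding eq .
  show "type_definable_subgroup \<kappa> M n U (Stab_ng \<kappa> M n U X)"
    unfolding type_definable_subgroup_def type_definable_def eq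
    using sub sN dU_definable[OF dN] by blast
  \<comment> \<open>The sets decrease and intersect in a subgroup, so compactness applies. It turns
    quotients from all of the sets into elements of their intersection, as
    \<open>bounded_indexI\<close> requires.\<close>
  have quot: "\<exists>l. \<forall>x\<in>?N l. \<forall>y\<in>?N l. x \<otimes> inv y \<in> ?N k" for k
  proof -
    obtain F0 where F0: "F0 \<subseteq> range ?N" "finite F0"
      "\<forall>x\<in>tuples n \<inter> \<Inter>F0. \<forall>y\<in>tuples n \<inter> \<Inter>F0. x \<otimes> inv y \<in> ?N k"
      by (rule subgroup_compactness[OF sN _ sub dU_definable[OF dN, of k]])
        (use dU_definable[OF dN] in auto)
    from finite_subset_image[OF F0(2,1)] obtain K where K: "finite K" "F0 = ?N ` K" by blast
    define l where "l = Max (insert 0 K)"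
    have "?N l \<subseteq> ?N j" if "j \<in> K" for j
      by (rule nongeneric_by_antimono) (use K that in \<open>simp add: l_def\<close>)
    then have "?N l \<subseteq> tuples n \<inter> \<Inter>F0" using NU[of l] carrier_tuples K(2) by blast
    then show ?thesis using F0(3) by blast
  qed
  show "bounded_index \<kappa> U (Stab_ng \<kappa> M n U X)"
  proof (rule bounded_indexI[OF X Stab_ng_subgroup[OF X ideal] few_nat, of ?N])
    fix z assume z: "z \<in> carrier U" "\<And>t. t \<in> UNIV \<Longrightarrow> \<exists>a\<in>?N t. \<exists>b\<in>?N t. z = a \<otimes> inv b"
    have "z \<in> ?N k" for k using quot[of k] z(2) by blast
    then show "z \<in> Stab_ng \<kappa> M n U X" unfolding Stab_ng_eq[OF X ideal] by blast
  qed (use NU covers_nongeneric_by[OF NIP X] in auto)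
qed

end

section \<open>Chains of generic sets\<close>

context vee_group
begin

text \<open>The shape is that of a basis of symmetric neighbourhoods of the identity in the
  metrization of topological groups; it makes \<open>core\<close> a subgroup.\<close>

definition chain :: "(nat \<Rightarrow> 'm list set) \<Rightarrow> bool" where
  "chain E \<longleftrightarrow> (\<forall>j. generic \<kappa> M n U (E j) \<and> \<one> \<in> E j \<and> (\<forall>x\<in>E j. inv x \<in> E j) \<and>
    (\<forall>x\<in>E (Suc j). \<forall>y\<in>E (Suc j). x \<otimes> y \<in> E j))"

definition core :: "(nat \<Rightarrow> 'm list set) \<Rightarrow> 'm list set" where
  "core E = (\<Inter>j. E j)"

lemma chainD:
  assumes "chain E"
  shows "generic \<kappa> M n U (E j)" "\<one> \<in> E j" "x \<in> E j \<Longrightarrow> inv x \<in> E j"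
    "x \<in> E (Suc j) \<Longrightarrow> y \<in> E (Suc j) \<Longrightarrow> x \<otimes> y \<in> E j"
  using assms unfolding chain_def by auto

lemma chain_carrier: "chain E \<Longrightarrow> E j \<subseteq> carrier U"
  using chainD(1) generic_dU dU_carrier by blast

lemma chain_antimono:
  assumes "chain E" "i \<le> j"
  shows "E j \<subseteq> E i"
proof -
  have "E (Suc j) \<subseteq> E j" for j
  proof
    fix x assume x: "x \<in> E (Suc j)"
    then have "x \<otimes> \<one> \<in> E j" using chainD(2,4)[OF assms(1)] by blast
    then show "x \<in> E j" using x chain_carrier[OF assms(1), of "Suc j"] by auto
  qed
  then show ?thesis using assms(2) by (rule lift_Suc_antimono_le)
qed

lemma core_subset: "core E \<subseteq> E j"
  by (auto simp: core_def)

lemma core_subgroup: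
  assumes "chain E" shows "subgroup (core E) U"
proof (rule subgroupI)
  show "core E \<subseteq> carrier U" using chain_carrier[OF assms, of 0] core_subset[of E 0] by auto
  show "core E \<noteq> {}" using chainD(2)[OF assms] by (auto simp: core_def)
  show "inv x \<in> core E" if "x \<in> core E" for x
    using that chainD(3)[OF assms] by (auto simp: core_def)
  show "x \<otimes> y \<in> core E" if "x \<in> core E" "y \<in> core E" for x y
    using that chainD(4)[OF assms] by (auto simp: core_def)
qed

text \<open>Each multiplication costs one level of the chain.\<close>

lemma chain_finprod:
  assumes "chain E" "finite I" "\<And>i. i \<in> I \<Longrightarrow> e i \<in> E (s + card I)"
  shows "finprod U e I \<in> E s"
  using assms(2,3)
proof (induction I arbitrary: s rule: finite_induct)
  case empty
  then show ?case using chainD(2)[OF assms(1)] by simp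
next
  case (insert i I)
  have e: "e k \<in> E (Suc s + card I)" if "k \<in> insert i I" for k
    using insert.prems[OF that] insert.hyps by simp
  have "finprod U e I \<in> E (Suc s)" by (rule insert.IH) (use e in auto)
  moreover have "e i \<in> E (Suc s)" using e[of i] chain_antimono[OF assms(1), of "Suc s" "Suc s + card I"] by auto
  ultimately have "e i \<otimes> finprod U e I \<in> E s" by (rule_tac chainD(4)[OF assms(1)])
  moreover have "e k \<in> carrier U" if "k \<in> insert i I" for k
    using e[OF that] chain_carrier[OF assms(1)] by blast
  ultimately show ?case using insert.hyps by (subst finprod_insert) auto
qed

text \<open>Each coset of \<open>H\<close> is the translate of \<open>H\<close>, hence part of the
  translate of \<open>E\<close>, by any of its representatives.\<close>

lemma bounded_index_generic:
  assumes H: "subgroup H U" "bounded_index \<kappa> U H" and E: "dU E" "H \<subseteq> E"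
  shows "generic \<kappa> M n U E"
proof -
  define r where "r R = (SOME x. x \<in> R)" for R :: "'m list set"
  define S where "S = r ` (rcosets H)"
  have HU: "H \<subseteq> carrier U" by (rule subgroup.subset[OF H(1)])
  have r: "r (H #> u) \<in> carrier U \<and> u \<in> r (H #> u) <# E" if u: "u \<in> carrier U" for u
  proof -
    have "u \<in> H #> u" using u H(1) by (rule rcos_self)
    then have "r (H #> u) \<in> H #> u" unfolding r_def by (rule someI)
    then obtain h where h: "h \<in> H" "r (H #> u) = h \<otimes> u" by (auto simp: r_coset_def)
    have hU: "h \<in> carrier U" using h HU by auto
    have "u = r (H #> u) \<otimes> inv h" unfolding h(2) using hU u by (simp add: m_comm[of h u] m_assoc)
    moreover have "inv h \<in> E" using h(1) E(2) subgroup.m_inv_closed[OF H(1)] by auto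
    ultimately have "u \<in> r (H #> u) <# E" unfolding l_coset_def by blast
    then show ?thesis using h(2) hU u by simp
  qed
  have "S \<subseteq> carrier U" using r by (auto simp: S_def RCOSETS_def)
  moreover have "small \<kappa> S" using H(2) unfolding S_def bounded_index_def by (rule small_image)
  moreover have "carrier U \<subseteq> (\<Union>g\<in>S. g <# E)"
  proof
    fix u assume u: "u \<in> carrier U"
    then have "r (H #> u) \<in> S" by (auto simp: S_def RCOSETS_def)
    then show "u \<in> (\<Union>g\<in>S. g <# E)" using r[OF u] by blast
  qed
  ultimately show ?thesis unfolding generic_iff using E(1) by blast
qed

text \<open>Compactness gives a definable set with quotients in \<open>D\<close>; intersecting it
  with its set of inverses turns quotients into products. Genericity comes from the bounded index of
  \<open>H\<close>.\<close>

lemma subgroup_square_root: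
  assumes H: "type_definable_subgroup \<kappa> M n U H" "bounded_index \<kappa> U H"
    and D: "definable M n D" "H \<subseteq> D"
  obtains E where "generic \<kappa> M n U E" "H \<subseteq> E" "\<forall>x\<in>E. inv x \<in> E" "\<forall>x\<in>E. \<forall>y\<in>E. x \<otimes> y \<in> D"
proof -
  have sub: "subgroup H U" using H(1) by (simp add: type_definable_subgroup_def)
  obtain F where F: "small \<kappa> F" "\<And>D. D \<in> F \<Longrightarrow> definable M n D" "H = tuples n \<inter> \<Inter>F"
    using H(1) unfolding type_definable_subgroup_def type_definable_def by blast
  obtain F0 where F0: "F0 \<subseteq> F" "finite F0" "tuples n \<inter> \<Inter>F0 \<subseteq> carrier U"
    "\<forall>x\<in>tuples n \<inter> \<Inter>F0. \<forall>y\<in>tuples n \<inter> \<Inter>F0. x \<otimes> inv y \<in> D"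
    by (rule subgroup_compactness[OF F(1,2) sub[unfolded F(3)] D(1) D(2)[unfolded F(3)]])
  define E0 where "E0 = tuples n \<inter> \<Inter>F0"
  have E0U: "E0 \<subseteq> carrier U" using F0(3) by (simp add: E0_def)
  have "definable M n E0" unfolding E0_def by (rule definable_Inter_finite[OF F0(2)]) (use F0(1) F(2) in auto)
  then have dE0: "dU E0" using E0U by (simp add: definable_in_def)
  have HE0: "H \<subseteq> E0" using F(3) F0(1) by (auto simp: E0_def)
  define E where "E = E0 \<inter> m_inv U ` E0"
  have dE: "dU E" unfolding E_def by (intro dU_Int dU_definable dU_inverse dE0)
  have EU: "E \<subseteq> carrier U" by (rule dU_carrier[OF dE])
  have inv: "inv x \<in> E" if "x \<in> E" for x
  proof -
    obtain y where y: "y \<in> E0" "x = inv y" "x \<in> E0" using \<open>x \<in> E\<close> by (auto simp: E_def)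
    then have "inv x = y" using E0U by auto
    then show ?thesis using y(1) image_eqI[OF _ y(3), of "inv x" "m_inv U"] by (auto simp: E_def)
  qed
  have HE: "H \<subseteq> E"
  proof
    fix h assume h: "h \<in> H"
    then have "inv h \<in> E0" using HE0 subgroup.m_inv_closed[OF sub] by auto
    moreover have "inv (inv h) = h" using h subgroup.subset[OF sub] by auto
    ultimately have "h \<in> m_inv U ` E0" by (metis image_eqI)
    then show "h \<in> E" using h HE0 by (auto simp: E_def)
  qed
  have "x \<otimes> y \<in> D" if "x \<in> E" "y \<in> E" for x y
  proof -
    have "x \<otimes> inv (inv y) \<in> D"
      using F0(4)[folded E0_def] that(1) inv[OF that(2)] unfolding E_def by blast
    then show ?thesis using that EU by (simp add: subset_iff)
  qed
  then show ?thesis using that[OF bounded_index_generic[OF sub H(2) dE HE] HE] inv by blast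
qed

text \<open>Square roots are taken repeatedly. As \<open>D\<close> is an arbitrary definable
  superset of \<open>H\<close>, chains determine \<open>H\<close>, which lets them replace subgroups
  in the proof of minimality.\<close>

lemma chain_exists:
  assumes H: "type_definable_subgroup \<kappa> M n U H" "bounded_index \<kappa> U H"
    and D: "definable M n D" "H \<subseteq> D"
  obtains E where "chain E" "E 0 \<subseteq> D" "H \<subseteq> core E"
proof -
  have sub: "subgroup H U" using H(1) by (simp add: type_definable_subgroup_def)
  have oneH: "\<one> \<in> H" by (rule subgroup.one_closed[OF sub])
  define good where "good E \<longleftrightarrow> generic \<kappa> M n U E \<and> H \<subseteq> E \<and> (\<forall>x\<in>E. inv x \<in> E) \<and> E \<subseteq> D" for E
  have step: "\<exists>E. good E \<and> (\<forall>x\<in>E. \<forall>y\<in>E. x \<otimes> y \<in> D')"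
    if D': "definable M n D'" "H \<subseteq> D'" "D' \<subseteq> D" for D'
  proof -
    obtain E where E: "generic \<kappa> M n U E" "H \<subseteq> E" "\<forall>x\<in>E. inv x \<in> E" "\<forall>x\<in>E. \<forall>y\<in>E. x \<otimes> y \<in> D'"
      by (rule subgroup_square_root[OF H D'(1,2)])
    have "E \<subseteq> D'"
    proof
      fix x assume x: "x \<in> E"
      then have "x \<otimes> \<one> \<in> D'" using E(2,4) oneH by blast
      then show "x \<in> D'" using x dU_carrier[OF generic_dU[OF E(1)]] by auto
    qed
    then show ?thesis using E D'(3) unfolding good_def by blast
  qed
  obtain E where E: "\<And>j::nat. good (E j)" "\<And>j. \<forall>x\<in>E (Suc j). \<forall>y\<in>E (Suc j). x \<otimes> y \<in> E j"
  proof -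
    have "\<exists>E. \<forall>j::nat. good (E j) \<and> (\<forall>x\<in>E (Suc j). \<forall>y\<in>E (Suc j). x \<otimes> y \<in> E j)"
    proof (rule dependent_nat_choice)
      show "\<exists>E. good E" using step[OF D order_refl] by blast
      show "\<exists>E'. good E' \<and> (\<forall>x\<in>E'. \<forall>y\<in>E'. x \<otimes> y \<in> E)" if "good E" for E
        by (rule step) (use that dU_definable[OF generic_dU] in \<open>auto simp: good_def\<close>)
    qed
    then show thesis using that by blast
  qed
  have "chain E" unfolding chain_def using E oneH unfolding good_def by blast
  moreover have "E 0 \<subseteq> D" "H \<subseteq> core E" using E(1) by (auto simp: good_def core_def)
  ultimately show ?thesis by (rule that)
qed

text \<open>Ramsey's theorem and the covering bound \<open>N\<close> make \<open>c i \<otimes> inv (c i')\<close> lie in a deep member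
  of the chain \<open>E l\<close> for \<open>i < i' < l\<close>; then the products of the elements
  \<open>c (2 i) \<otimes> inv (c (2 i + 1))\<close> shatter the sets \<open>E (2 l) 1\<close>.\<close>

lemma no_independent_chains:
  fixes E :: "nat \<Rightarrow> nat \<Rightarrow> 'm list set" and c :: "nat \<Rightarrow> 'm list"
  assumes d: "shatter_free M n m p d"
    and E: "\<And>i. chain (E i)"
    and b: "\<And>i. length (b i) = m" "\<And>i. E i 1 = {x \<in> tuples n. sat M (nth (x @ b i)) p}"
    and N: "\<And>i. covers_by N (E i (d + 3)) V" and V: "V \<subseteq> carrier U"
    and c: "\<And>i. c i \<in> V" "\<And>i j. i < j \<Longrightarrow> c j \<in> core (E i)" "\<And>i. c i \<notin> E i 0"
  shows False
proof -
  have cU: "c i \<in> carrier U" for i using c(1) V by auto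
  \<comment> \<open>The levels are spent as follows: dividing two points of one translate leads from
    \<open>d + 3\<close> to \<open>d + 2\<close>, a product of at most \<open>d\<close> factors from
    there to 2, and two more multiplications to 0, where \<open>c\<close> is excluded.\<close>
  define col where "col s \<longleftrightarrow> c (s 0) \<otimes> inv (c (s 1)) \<in> E (s 2) (d + 2)" for s :: "nat \<Rightarrow> nat"
  have col_cong: "col s = col t" if "\<And>i. i < 3 \<Longrightarrow> s i = t i" for s t
    using that[of 0] that[of 1] that[of 2] by (simp add: col_def)
  obtain u :: "nat \<Rightarrow> nat" and v where u: "strict_mono u" "\<forall>s. strict_mono_on {..<3} s \<longrightarrow> col (u \<circ> s) = v"
    by (rule Ramsey_sequence[OF finite_UNIV[where 'a = bool] UNIV_I col_cong])
  have col: "(c (u i) \<otimes> inv (c (u j)) \<in> E (u l) (d + 2)) = v" if "i < j" "j < l" for i j l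
  proof -
    define s where "s k = (if k = 0 then i else if k = 1 then j else l)" for k :: nat
    have "strict_mono_on {..<3} s"
      using that by (intro strict_mono_onI) (auto simp: s_def)
    then have "col (u \<circ> s) = v" using u(2) by blast
    then show ?thesis by (simp add: col_def s_def)
  qed
  \<comment> \<open>Pigeonhole: two of the \<open>N + 1\<close> points
    \<open>c (u 0), ..., c (u N)\<close> share one of the \<open>N\<close> translates belonging to
    the chain \<open>E (u (Suc N))\<close>. One triple thus has the colour \<open>True\<close>,
    hence all have it.\<close>
  have v
  proof -
    obtain h where h: "\<forall>i<N. h i \<in> carrier U" "V \<subseteq> (\<Union>i<N. h i <# E (u (Suc N)) (d + 3))"
      using N[of "u (Suc N)"] unfolding covers_by_def by blast
    have "\<forall>i\<in>{..N}. \<exists>k. k < N \<and> c (u i) \<in> h k <# E (u (Suc N)) (d + 3)"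
      using h(2) c(1) by blast
    from bchoice[OF this] obtain f where f: "\<forall>i\<in>{..N}. f i < N \<and> c (u i) \<in> h (f i) <# E (u (Suc N)) (d + 3)" ..
    have "\<not> inj_on f {..N}"
    proof
      assume "inj_on f {..N}"
      then have "card {..N} \<le> card {..<N}" by (rule card_inj_on_le) (use f in auto)
      then show False by simp
    qed
    then obtain i j where ij: "i < j" "j \<le> N" "f i = f j"
      unfolding inj_on_def by (metis atMost_iff linorder_neqE_nat)
    define g where "g = h (f j)"
    have gU: "g \<in> carrier U" using f h(1) ij by (auto simp: g_def)
    have "c (u i) \<in> g <# E (u (Suc N)) (d + 3)" "c (u j) \<in> g <# E (u (Suc N)) (d + 3)"
      using f ij unfolding g_def by (metis atMost_iff less_imp_le order_trans)+
    then obtain x y where xy: "x \<in> E (u (Suc N)) (Suc (d + 2))" "y \<in> E (u (Suc N)) (Suc (d + 2))"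
      "c (u i) = g \<otimes> x" "c (u j) = g \<otimes> y" by (auto simp: l_coset_def eval_nat_numeral)
    have xyU: "x \<in> carrier U" "y \<in> carrier U" using xy chain_carrier[OF E] by blast+
    have "x \<otimes> inv y \<in> E (u (Suc N)) (d + 2)" by (intro chainD(4)[OF E] chainD(3)[OF E] xy)
    then have "c (u i) \<otimes> inv (c (u j)) \<in> E (u (Suc N)) (d + 2)"
      unfolding xy(3,4) using mult_cancel_quotient[OF gU xyU] by simp
    then show ?thesis using col[of i j "Suc N"] ij by simp
  qed
  define C where "C i = c (u i)" for i
  define G where "G i = E (u i)" for i
  have G: "chain (G i)" for i by (simp add: G_def E)
  have CU: "C i \<in> carrier U" for i by (simp add: C_def cU)
  have Ccore: "C j \<in> core (G i)" if "i < j" for i j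
    unfolding C_def G_def by (rule c(2)) (use u(1) that in \<open>simp add: strict_mono_def\<close>)
  have C0: "C i \<notin> G i 0" for i by (simp add: C_def G_def c(3))
  define e where "e i = C (2 * i) \<otimes> inv (C (2 * i + 1))" for i
  have eU: "e i \<in> carrier U" for i by (simp add: e_def CU)
  \<comment> \<open>For \<open>i < l\<close> this is homogeneity; for \<open>i > l\<close> both
    factors of \<open>e i\<close> lie in the core of the earlier chain.\<close>
  have e: "e i \<in> G (2 * l) (d + 2)" if "i \<noteq> l" for i l
  proof (cases "i < l")
    case True
    then show ?thesis using col[of "2 * i" "2 * i + 1" "2 * l"] \<open>v\<close> by (simp add: e_def C_def G_def)
  next
    case False
    then have "l < i" using that by simp
    then have "e i \<in> core (G (2 * l))" unfolding e_def
      by (intro subgroup.m_closed[OF core_subgroup[OF G]] subgroup.m_inv_closed[OF core_subgroup[OF G]] Ccore) auto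
    then show ?thesis using core_subset by blast
  qed
  have prod: "finprod U e I \<in> G (2 * l) s" if I: "I \<subseteq> {..<d}" "l \<notin> I" "s \<le> 2" for I l s
  proof (rule chain_finprod[OF G])
    show "finite I" using I(1) finite_subset by blast
    have "card I \<le> d" using card_mono[OF _ I(1)] by simp
    then show "e i \<in> G (2 * l) (s + card I)" if "i \<in> I" for i
      using e[of i l] that I chain_antimono[OF G, of "s + card I" "d + 2" "2 * l"] by auto
  qed
  have iff: "finprod U e I \<in> G (2 * l) 1 \<longleftrightarrow> l \<notin> I" if I: "I \<subseteq> {..<d}" for I l
  proof
    show "finprod U e I \<in> G (2 * l) 1" if "l \<notin> I" by (rule prod) (use I that in auto)
    show "l \<notin> I" if inG: "finprod U e I \<in> G (2 * l) 1"
    proof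
      \<comment> \<open>Multiplying the product \<open>e l \<otimes> q\<close> by
        \<open>inv q \<otimes> C (2 * l + 1)\<close>, which lies at level 1, leaves
        \<open>C (2 * l)\<close> and would put it at level 0.\<close>
      assume l: "l \<in> I"
      define q where "q = finprod U e (I - {l})"
      have finI: "finite I" using I finite_subset by blast
      have "finprod U e (insert l (I - {l})) = e l \<otimes> q"
        unfolding q_def by (rule finprod_insert) (use finI eU in auto)
      then have eq: "finprod U e I = e l \<otimes> q" using l by (simp add: insert_absorb)
      have q: "q \<in> G (2 * l) 2" unfolding q_def by (rule prod) (use I in auto)
      have qU: "q \<in> carrier U" using q chain_carrier[OF G] by blast
      have "C (2 * l + 1) \<in> G (2 * l) 2" using Ccore[of "2 * l" "2 * l + 1"] core_subset by auto
      then have "inv q \<otimes> C (2 * l + 1) \<in> G (2 * l) 1"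
        using chainD(4)[OF G, of "inv q" "2 * l" 1] chainD(3)[OF G q] by (simp add: eval_nat_numeral)
      then have "(e l \<otimes> q) \<otimes> (inv q \<otimes> C (2 * l + 1)) \<in> G (2 * l) 0"
        using chainD(4)[OF G, of _ "2 * l" 0] inG eq by simp
      moreover have "(e l \<otimes> q) \<otimes> (inv q \<otimes> C (2 * l + 1)) = C (2 * l)"
      proof -
        have "q \<otimes> (inv q \<otimes> C (2 * l + 1)) = C (2 * l + 1)"
          using qU CU by (simp add: m_assoc[symmetric])
        then have "(e l \<otimes> q) \<otimes> (inv q \<otimes> C (2 * l + 1)) = e l \<otimes> C (2 * l + 1)"
          using eU qU CU by (simp add: m_assoc)
        also have "\<dots> = C (2 * l)" using CU by (simp add: e_def m_assoc)
        finally show ?thesis .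
      qed
      ultimately show False using C0[of "2 * l"] by simp
    qed
  qed
  define a where "a i = b (u (2 * i))" for i
  \<comment> \<open>Membership in the set with index \<open>l\<close> means that the factor
    \<open>e l\<close> is absent, hence the complement.\<close>
  define B where "B S = finprod U e ({..<d} - S)" for S
  have BU: "B S \<in> carrier U" for S unfolding B_def by (rule finprod_closed) (use eU in auto)
  have "sat M (nth (B S @ a i)) p \<longleftrightarrow> i \<in> S" if "i < d" for i S
  proof -
    have "sat M (nth (B S @ a i)) p \<longleftrightarrow> B S \<in> G (2 * i) 1"
      using BU carrier_tuples unfolding G_def b(2) a_def by auto
    also have "\<dots> \<longleftrightarrow> i \<in> S" unfolding B_def using iff[of "{..<d} - S" i] that by auto
    finally show ?thesis .
  qed
  moreover have "length (a i) = m" "length (B S) = n" for i S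
    by (simp_all add: a_def b(1) length_carrier[OF BU])
  ultimately have "(\<forall>i<d. length (a i) = m) \<and> (\<forall>S\<subseteq>{..<d}. length (B S) = n) \<and>
     (\<forall>i<d. \<forall>S\<subseteq>{..<d}. sat M (nth (B S @ a i)) p \<longleftrightarrow> i \<in> S)" by simp
  then show False using d[unfolded shatter_free_def, THEN spec, THEN spec, of a B] by (rule_tac notE)
qed

end

section \<open>The smallest type-definable subgroup of bounded index\<close>

context vee_group
begin

text \<open>It is chosen from the formula alone, before any chain is given, so that the level used
  in \<open>chain_kind\<close> depends only on the kind.\<close>

definition shatter_bound :: "('f, 'r) fo_form \<Rightarrow> nat \<Rightarrow> nat" where
  "shatter_bound p m = (SOME d. shatter_free M n m p d)"

text \<open>The parameters \<open>b\<close> are not part of the kind, which leaves no more kinds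
  than formulas. Level 1 is the one recorded because \<open>no_independent_chains\<close> shatters
  the sets at that level.\<close>

definition chain_kind ::
  "'m list set \<Rightarrow> (nat \<Rightarrow> 'm list set) \<Rightarrow> ('f, 'r) fo_form \<times> nat \<times> nat \<Rightarrow> bool" where
  "chain_kind V E = (\<lambda>(p, m, N). chain E \<and> wf_form M p \<and> fv p \<subseteq> {..<n + m} \<and>
     (\<exists>b. length b = m \<and> E 1 = {x \<in> tuples n. sat M (nth (x @ b)) p}) \<and>
     covers_by N (E (shatter_bound p m + 3)) V)"

lemma chain_kind_exists:
  assumes "chain E" "dU V"
  shows "\<exists>\<tau> \<in> formulas \<times> UNIV \<times> UNIV. chain_kind V E \<tau>"
proof -
  have "definable M n (E 1)" using chainD(1)[OF assms(1)] generic_dU dU_definable by blast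
  then obtain p b where p: "wf_form M p" "fv p \<subseteq> {..<n + length b}"
    "E 1 = {x \<in> tuples n. sat M (nth (x @ b)) p}"
    unfolding definable_over_def by blast
  have "covers (E (shatter_bound p (length b) + 3)) V"
    by (rule generic_covers[OF chainD(1)[OF assms(1)] assms(2)])
  then obtain N where "covers_by N (E (shatter_bound p (length b) + 3)) V" unfolding covers_iff ..
  then have "chain_kind V E (p, length b, N)" unfolding chain_kind_def using p assms(1) by auto
  then show ?thesis using p(1) by blast
qed

text \<open>If no finite set works, one can successively choose chains and points of
  \<open>W\<close> such that each point lies in the cores of all earlier chains but outside level 0
  of its own; \<open>no_independent_chains\<close> forbids this. Reaching level 0 is enough, since
  by \<open>chain_exists\<close> level 0 can be placed inside any given definable superset of a
  subgroup of bounded index.\<close>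

lemma finitely_many_chains_suffice:
  assumes NIP: "NIP M" and V: "V \<subseteq> carrier U" and W: "W \<subseteq> V"
  shows "\<exists>\<C>. finite \<C> \<and> (\<forall>E\<in>\<C>. chain_kind V E \<tau>) \<and>
    (\<forall>E. chain_kind V E \<tau> \<longrightarrow> W \<inter> (\<Inter>E'\<in>\<C>. core E') \<subseteq> E 0)"
proof (rule ccontr)
  assume neg: "\<not> ?thesis"
  obtain p m N where \<tau>: "\<tau> = (p, m, N)" by (cases \<tau>) auto
  define P where "P A x \<longleftrightarrow> ((\<forall>a\<in>A. chain_kind V (fst a) \<tau>) \<longrightarrow>
    chain_kind V (fst x) \<tau> \<and> snd x \<in> W \<and> (\<forall>a\<in>A. snd x \<in> core (fst a)) \<and> snd x \<notin> fst x 0)"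
    for A :: "((nat \<Rightarrow> 'm list set) \<times> 'm list) set" and x :: "(nat \<Rightarrow> 'm list set) \<times> 'm list"
  have "\<exists>x. P A x" if "finite A" for A
  proof (cases "\<forall>a\<in>A. chain_kind V (fst a) \<tau>")
    case True
    then have "finite (fst ` A) \<and> (\<forall>E\<in>fst ` A. chain_kind V E \<tau>)" using that by auto
    then have "\<not> (\<forall>E. chain_kind V E \<tau> \<longrightarrow> W \<inter> (\<Inter>E'\<in>fst ` A. core E') \<subseteq> E 0)"
      using neg by blast
    then obtain E where E: "chain_kind V E \<tau>" "\<not> W \<inter> (\<Inter>E'\<in>fst ` A. core E') \<subseteq> E 0" by blast
    from E(2) obtain c where c: "c \<in> W" "\<forall>a\<in>A. c \<in> core (fst a)" "c \<notin> E 0" by auto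
    have "P A (E, c)" unfolding P_def using E(1) c by simp
    then show ?thesis ..
  qed (auto simp: P_def)
  then obtain f where f: "\<forall>i::nat. P (f ` {..<i}) (f i)" by (rule dependent_choice_finite_sets)
  have kind: "chain_kind V (fst (f i)) \<tau>" for i
  proof (induction i rule: less_induct)
    case (less i)
    then have "\<forall>a\<in>f ` {..<i}. chain_kind V (fst a) \<tau>" by auto
    then show ?case using f unfolding P_def by blast
  qed
  have fi: "snd (f i) \<in> W" "\<forall>a\<in>f ` {..<i}. snd (f i) \<in> core (fst a)" "snd (f i) \<notin> fst (f i) 0" for i
  proof -
    have "\<forall>a\<in>f ` {..<i}. chain_kind V (fst a) \<tau>" using kind by auto
    then show "snd (f i) \<in> W" "\<forall>a\<in>f ` {..<i}. snd (f i) \<in> core (fst a)" "snd (f i) \<notin> fst (f i) 0"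
      using spec[OF f, of i] unfolding P_def by simp_all
  qed
  have k: "chain (fst (f i))" "\<exists>b. length b = m \<and> fst (f i) 1 = {x \<in> tuples n. sat M (nth (x @ b)) p}"
    "covers_by N (fst (f i) (shatter_bound p m + 3)) V" for i
    using kind[of i] unfolding chain_kind_def \<tau> by simp_all
  have p: "wf_form M p" "fv p \<subseteq> {..<n + m}" using kind[of 0] unfolding chain_kind_def \<tau> by simp_all
  have d: "shatter_free M n m p (shatter_bound p m)"
    unfolding shatter_bound_def by (rule someI_ex[OF NIP_shatter_free[OF NIP p]])
  from choice[of "\<lambda>i b. length b = m \<and> fst (f i) 1 = {x \<in> tuples n. sat M (nth (x @ b)) p}"] k(2)
  obtain b where b: "\<forall>i. length (b i) = m \<and> fst (f i) 1 = {x \<in> tuples n. sat M (nth (x @ b i)) p}"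
    by blast
  show False
  proof (rule no_independent_chains[OF d, of "\<lambda>i. fst (f i)" b N V "\<lambda>i. snd (f i)"])
    show "snd (f i) \<in> V" for i using fi(1) W by auto
    show "snd (f j) \<in> core (fst (f i))" if "i < j" for i j using fi(2)[of j] that by auto
  qed (use k(1,3) b V fi(3) in auto)
qed

theorem exists_00_if_bounded_subgroup:
  assumes NIP: "NIP M" and H: "type_definable_subgroup \<kappa> M n U H" "bounded_index \<kappa> U H"
  shows "exists_00 \<kappa> M n U"
proof -
  have "H \<subseteq> tuples n" using H(1) unfolding type_definable_subgroup_def type_definable_def by auto
  \<comment> \<open>The subgroup \<open>H\<close> supplies a first chain: \<open>V\<close> is the
    definable set against which covering numbers are taken, and \<open>core E0\<close> keeps the
    points to be compared inside \<open>V\<close>.\<close>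
  then obtain E0 where E0: "chain E0" by (rule chain_exists[OF H definable_tuples])
  define V where "V = E0 0"
  have gV: "generic \<kappa> M n U V" unfolding V_def by (rule chainD(1)[OF E0])
  have dV: "dU V" by (rule generic_dU[OF gV])
  have "\<forall>\<tau>. \<exists>\<C>. finite \<C> \<and> (\<forall>E\<in>\<C>. chain_kind V E \<tau>) \<and>
      (\<forall>E. chain_kind V E \<tau> \<longrightarrow> core E0 \<inter> (\<Inter>E'\<in>\<C>. core E') \<subseteq> E 0)"
    using finitely_many_chains_suffice[OF NIP dU_carrier[OF dV] core_subset[of E0 0, folded V_def]] by blast
  from choice[OF this] obtain \<C> where \<C>: "\<forall>\<tau>. finite (\<C> \<tau>) \<and> (\<forall>E\<in>\<C> \<tau>. chain_kind V E \<tau>) \<and>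
      (\<forall>E. chain_kind V E \<tau> \<longrightarrow> core E0 \<inter> (\<Inter>E'\<in>\<C> \<tau>. core E') \<subseteq> E 0)" ..
  have fin: "finite (\<C> \<tau>)" for \<tau> using spec[OF \<C>] by blast
  have suffice: "core E0 \<inter> (\<Inter>E'\<in>\<C> \<tau>. core E') \<subseteq> E 0" if "chain_kind V E \<tau>" for E \<tau>
    using spec[OF \<C>, of \<tau>] that by simp
  define T where "T = {E0} \<union> (\<Union>\<tau>\<in>formulas \<times> UNIV \<times> UNIV. \<C> \<tau>)"
  have few_T: "few T"
  proof -
    have "few (\<Union>\<tau>\<in>formulas \<times> (UNIV :: nat set) \<times> (UNIV :: nat set). \<C> \<tau>)"
    proof (rule few_UN)
      show "few (formulas \<times> (UNIV :: nat set) \<times> (UNIV :: nat set))"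
        by (intro few_Times few_nat card_of_mono1 order_refl)
    qed (rule few_finite[OF fin])
    then show ?thesis unfolding T_def by (rule few_Un[rotated]) (rule few_finite, simp)
  qed
  have chT: "chain E" if "E \<in> T" for E
    using that E0 \<C> unfolding T_def chain_kind_def by auto
  have E0T: "E0 \<in> T" by (simp add: T_def)
  define K where "K = (\<Inter>E\<in>T. core E)"
  have KE0: "K \<subseteq> core E0" using E0T by (auto simp: K_def)
  have sub: "subgroup K U"
  proof (rule subgroupI)
    show "K \<subseteq> carrier U" using KE0 subgroup.subset[OF core_subgroup[OF E0]] by auto
    show "K \<noteq> {}" using subgroup.one_closed[OF core_subgroup[OF chT]] by (auto simp: K_def)
    show "inv x \<in> K" if "x \<in> K" for x
      using that subgroup.m_inv_closed[OF core_subgroup[OF chT]] by (auto simp: K_def)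
    show "x \<otimes> y \<in> K" if "x \<in> K" "y \<in> K" for x y
      using that subgroup.m_closed[OF core_subgroup[OF chT]] by (auto simp: K_def)
  qed
  define F where "F = (\<lambda>(E, j). E j) ` (T \<times> (UNIV :: nat set))"
  have "small \<kappa> F" unfolding F_def by (intro small_image few_small few_Times few_T few_nat)
  moreover have "definable M n D" if "D \<in> F" for D
    using that chT chainD(1) generic_dU dU_definable unfolding F_def by auto
  moreover have "K = tuples n \<inter> \<Inter>F"
    using subgroup.subset[OF sub] carrier_tuples by (auto simp: K_def F_def core_def)
  ultimately have "type_definable_subgroup \<kappa> M n U K"
    unfolding type_definable_subgroup_def type_definable_def using sub by blast
  moreover have "bounded_index \<kappa> U K"
  proof (rule bounded_indexI[OF gV sub few_Times[OF few_T few_nat], of "\<lambda>(E, j). E j"])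
    fix t assume "t \<in> T \<times> (UNIV :: nat set)"
    then obtain E j where t: "t = (E, j)" "chain E" using chT by auto
    show "(case t of (E, j) \<Rightarrow> E j) \<subseteq> carrier U" using chain_carrier t by simp
    show "covers (case t of (E, j) \<Rightarrow> E j) V"
      using generic_covers[OF chainD(1)[OF t(2)] dV] t(1) by simp
  next
    fix z assume z: "\<And>t. t \<in> T \<times> (UNIV :: nat set) \<Longrightarrow>
      \<exists>a\<in>case t of (E, j) \<Rightarrow> E j. \<exists>b\<in>case t of (E, j) \<Rightarrow> E j. z = a \<otimes> inv b"
    \<comment> \<open>Taking \<open>a\<close> and \<open>b\<close> one level deeper absorbs the
      quotient.\<close>
    have "z \<in> E j" if "E \<in> T" for E j
      using z[of "(E, Suc j)"] that chainD(3,4)[OF chT[OF that]] by auto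
    then show "z \<in> K" by (auto simp: K_def core_def)
  qed
  moreover have "K \<subseteq> K'" if K': "type_definable_subgroup \<kappa> M n U K'" "bounded_index \<kappa> U K'" for K'
  proof -
    obtain F' where F': "\<And>D. D \<in> F' \<Longrightarrow> definable M n D" "K' = tuples n \<inter> \<Inter>F'"
      using K'(1) unfolding type_definable_subgroup_def type_definable_def by blast
    have "K \<subseteq> D" if D: "D \<in> F'" for D
    proof -
      have "K' \<subseteq> D" using F'(2) D by auto
      then obtain E where E: "chain E" "E 0 \<subseteq> D" by (rule chain_exists[OF K' F'(1)[OF D]])
      obtain \<tau> where \<tau>: "\<tau> \<in> formulas \<times> UNIV \<times> UNIV" "chain_kind V E \<tau>"
        using chain_kind_exists[OF E(1) dV] by blast
      have "\<C> \<tau> \<subseteq> T" using \<tau>(1) by (auto simp: T_def)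
      then have "K \<subseteq> core E0 \<inter> (\<Inter>E'\<in>\<C> \<tau>. core E')" using KE0 by (auto simp: K_def)
      also have "\<dots> \<subseteq> E 0" using \<tau>(2) by (rule suffice)
      finally show ?thesis using E(2) by simp
    qed
    then show ?thesis using F'(2) subgroup.subset[OF sub] carrier_tuples by auto
  qed
  ultimately show ?thesis unfolding exists_00_def by blast
qed

end

theorem theorem2p6:
  fixes M :: "('f, 'r, 'm) fo_structure"
    and \<kappa> :: "'k rel"
    and U :: "('m list, 'b) monoid_scheme"
    and n :: nat
  assumes "sufficiently_large \<kappa> M"
    and "saturated \<kappa> M"
    and "NIP M"
    and "comm_group U"
    and "vee_definable_group \<kappa> M n U"
    and "nongeneric_ideal \<kappa> M n U"
    and "\<exists>X. generic \<kappa> M n U X"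
  shows "(\<forall>X. generic \<kappa> M n U X \<longrightarrow>
            type_definable_subgroup \<kappa> M n U (Stab_ng \<kappa> M n U X) \<and>
            bounded_index \<kappa> U (Stab_ng \<kappa> M n U X))
       \<and> exists_00 \<kappa> M n U"
proof -
  obtain \<X> where \<X>: "small \<kappa> \<X>" "\<forall>X\<in>\<X>. definable M n X" "\<forall>X\<in>\<X>. \<forall>Y\<in>\<X>. \<exists>Z\<in>\<X>. X \<union> Y \<subseteq> Z"
    "carrier U = \<Union>\<X>"
    "\<forall>X\<in>\<X>. \<forall>Y\<in>\<X>. definable M (3 * n) {x @ y @ (x \<otimes>\<^bsub>U\<^esub> y) | x y. x \<in> X \<and> y \<in> Y}"
    using assms(5) unfolding vee_definable_group_def by blast
  interpret comm_group U by (rule assms(4))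
  interpret vee_group M \<kappa> U n \<X>
    by unfold_locales (use assms(1,2) \<X> in auto)
  have "type_definable_subgroup \<kappa> M n U (Stab_ng \<kappa> M n U X) \<and>
      bounded_index \<kappa> U (Stab_ng \<kappa> M n U X)" if "generic \<kappa> M n U X" for X
    using Stab_ng_type_definable_bounded[OF assms(3) that assms(6)] ..
  moreover from this have "exists_00 \<kappa> M n U"
    using assms(7) exists_00_if_bounded_subgroup[OF assms(3)] by blast
  ultimately show ?thesis by blast
qed

end
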